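(* Let $\mathcal{N}_2$ be the germ $(\mathbb{C}^2,0)$, with coordinates $(t_1,t_2)$, equipped with the multiplication $\circ$ on its tangent bundle with unit field $\partial_1$ and $\partial_2\circ\partial_2=0$. Let $$C_1=\mathrm{Id}_2,\quad C_2=\begin{pmatrix}0&0\\1&0\end{pmatrix},\quad E=\begin{pmatrix}0&1\\0&0\end{pmatrix}.$$ Consider (holomorphic or formal) $(T)$-structures of the form $$(\ast)\qquad A_1=C_1,\quad A_2=C_2+zfE,$$ and write $f=\sum_{n\geq0}f(n)z^n$ with $f(n)\in\mathbb{C}\{t_2\}$. (i) Any holomorphic $(T)$-structure over $\mathcal{N}_2$ is (holomorphically) gauge isomorphic to a $(T)$-structure of the form $(\ast)$ with $f\in\mathbb{C}\{t_2,z\}$ holomorphic. (ii) Any formal $(T)$-structure over $\mathcal{N}_2$ is formally gauge isomorphic to a formal $(T)$-structure of the form $(\ast)$ with $f\in\mathbb{C}\{t_2,z]]$. (iii) For a holomorphic or formal $(T)$-structure of the form $(\ast)$ over $\mathcal{N}_2$, with $f\in\mathbb{C}\{t_2,z\}$ respectively $f\in\mathbb{C}\{t_2,z]]$, the function $f(0)\in\mathbb{C}\{t_2\}$ is a formal gauge invariant (that is, if two such structures with functions $f,\tilde f$ are formally gauge isomorphic, then $f(0)=\tilde f(0)$). If $f(0)=0$, then also $f(1)\in\mathbb{C}\{t_2\}$ is a formal gauge invariant. (iv) A holomorphic $(T)$-structure of the form $(\ast)$ over $\mathcal{N}_2$ with $f(0)=0$ is (holomorphically) gauge isomorphic to the $(T)$-structure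 $$A_1=C_1,\quad A_2=C_2+z^2f(1)E,$$ and this is the unique $(T)$-structure of the form $A_1=C_1$, $A_2=C_2+z^2gE$ with $g\in\mathbb{C}\{t_2\}$ to which it is gauge isomorphic. (v) Consider a holomorphic or formal $(T)$-structure of the form $(\ast)$ over $\mathcal{N}_2$ with $f(0)\neq0$ and $\mathrm{ord}_0f(0)=r\in\mathbb{Z}_{\geq0}$. If $r\in\{0,1\}$, it is formally gauge isomorphic to the $(T)$-structure $$A_1=C_1,\quad A_2=C_2+zf(0)E .$$ If $r\geq2$, it is formally gauge isomorphic to a formal $(T)$-structure $$A_1=C_1,\quad A_2=C_2+z\tilde fE,$$ where $\tilde f(0)=f(0)$ and $\tilde f(k)\in\mathbb{C}[t_2]_{\leq r-2}$ for any $k\geq1$. These normal forms are formal gauge invariants and are unique, i.e. two structures in these normal forms which are formally gauge isomorphic coincide.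
   Context: Rings: $t=(t_1,t_2)$; $\mathbb{C}\{t_2\}$, $\mathbb{C}\{t,z\}$, $\mathbb{C}\{t_2,z\}$ are rings of convergent power series. $\mathbb{C}\{t,z]]$ (respectively $\mathbb{C}\{t_2,z]]$) is the ring of formal power series $\sum_{n\geq 0}a_n z^n$ with all $a_n=a_n(t)$ (respectively $a_n(t_2)$) holomorphic on the same neighbourhood of $0$. $\mathbb{C}[t_2]_{\leq k}$ is the space of polynomials in $t_2$ of degree at most $k$. $\mathrm{ord}_0$ denotes the vanishing order at $t_2=0$. For a matrix $A$ with entries in these rings write $A=\sum_{n\geq0}A(n)z^n$ with $A(n)$ independent of $z$. $(T)$-structures: a $(T)$-structure over a complex manifold $M$ is a holomorphic vector bundle $H\to\mathbb{C}\times M$ with a map $\nabla:\mathcal{O}(H)\to\frac1z\mathcal{O}_{\mathbb{C}\times M}\cdot\Omega^1_M\otimes\mathcal{O}(H)$ whose restriction to $H|_{\{z\}\times M}$ is a flat connection for every $z\in\mathbb{C}^*$. Over the germ $M=(\mathbb{C}^2,0)$ the bundle $H$ (a germ along $(0,0)\in\mathbb{C}\times\mathbb{C}^2$) is assumed trivial; in the rank 2 case, in a trivialization $\underline{s}=(s_1,s_2)$, one has $\nabla\underline{s}=\underline{s}\cdot\frac1z(A_1dt_1+A_2dt_2)$ with $A_1,A_2\in M_{2\times2}(\mathbb{C}\{t,z\})$, and flatness means $z\partial_1A_2-z\partial_2A_1+[A_1,A_2]=0$. So a $(T)$-structure is given by such a pair $(A_1,A_2)$. A formal $(T)$-structure is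 given by a pair $(A_1,A_2)$ of matrices with entries in $\mathbb{C}\{t,z]]$ satisfying the same equation. Unfolding condition and induced multiplication: on $K=H|_{\{0\}\times M}$ one has the Higgs field $C_{\partial_i}=A_i(0)$ (these commute). The (formal) $(T)$-structure satisfies the unfolding condition if there is a section $\zeta\in\mathcal{O}(K)$ such that $X\mapsto C_X\zeta$ is an isomorphism $TM\to K$. It then induces a well-defined multiplication on $TM$ by $C_{X\circ Y}\zeta=C_XC_Y\zeta$, whose unit field $e$ is determined by $C_e\zeta=\zeta$. A (formal) $(T)$-structure "over $\mathcal{N}_2$" means a (formal) $(T)$-structure over $(\mathbb{C}^2,0)$ which satisfies the unfolding condition and induces the multiplication and unit field of $\mathcal{N}_2$. Gauge isomorphisms: $(A_1,A_2)$ and $(\tilde A_1,\tilde A_2)$ are (holomorphically) gauge isomorphic, respectively formally gauge isomorphic, if there is a matrix $T$ with entries in $\mathbb{C}\{t,z\}$, respectively $\mathbb{C}\{t,z]]$, with $T(0)$ invertible, such that $z\partial_iT+A_iT-T\tilde A_i=0$ for $i=1,2$. *)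

theory Defs
  imports "HOL-Analysis.Analysis"
begin

text \<open>
  A germ of a holomorphic function is represented by its Taylor series at the origin, as an iterated
  formal power series.  The indeterminates are nested with \<open>z\<close> outermost, then \<open>t\<^sub>1\<close>, then \<open>t\<^sub>2\<close>:
  the coefficient of \<open>z\<^sup>n t\<^sub>1\<^sup>i t\<^sub>2\<^sup>j\<close> in \<open>a :: ser_tz\<close> is
  \<open>fps_nth (fps_nth (fps_nth a n) i) j\<close>, and \<open>fps_nth a n\<close> is \<open>a(n)\<close>.
\<close>

type_synonym ser_t2 = "complex fps"              (* in t_2 *)
type_synonym ser_t = "complex fps fps"           (* in t_1 (outer) and t_2 (inner) *)
type_synonym ser_t2z = "complex fps fps"         (* in z (outer) and t_2 (inner) *)
type_synonym ser_tz = "complex fps fps fps"      (* in z, t_1, t_2 *)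

subsection \<open>Rings of convergent and partially convergent power series\<close>

definition Conv_t2 :: "ser_t2 set" where
  "Conv_t2 = {g. fps_conv_radius g > 0}"

definition abs_conv2_at :: "real \<Rightarrow> complex fps fps \<Rightarrow> bool" where
  "abs_conv2_at r a \<longleftrightarrow>
     (\<lambda>(i, j). norm (fps_nth (fps_nth a i) j) * r ^ (i + j)) summable_on UNIV"

definition abs_conv3_at :: "real \<Rightarrow> complex fps fps fps \<Rightarrow> bool" where
  "abs_conv3_at r a \<longleftrightarrow>
     (\<lambda>(n, i, j). norm (fps_nth (fps_nth (fps_nth a n) i) j) * r ^ (n + i + j)) summable_on UNIV"

definition Conv_t :: "ser_t set" where
  "Conv_t = {a. \<exists>r>0. abs_conv2_at r a}"

definition Conv_t2z :: "ser_t2z set" where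
  "Conv_t2z = {f. \<exists>r>0. abs_conv2_at r f}"

definition Conv_tz :: "ser_tz set" where
  "Conv_tz = {a. \<exists>r>0. abs_conv3_at r a}"

text \<open>
  In the next two rings the coefficients of the powers of \<open>z\<close> are holomorphic on one common
  neighbourhood of \<open>0\<close>: the radius \<open>r\<close> does not depend on \<open>n\<close>.
\<close>

definition Form_t2z :: "ser_t2z set" where
  "Form_t2z = {f. \<exists>r>0. \<forall>n. ereal r \<le> fps_conv_radius (fps_nth f n)}"

definition Form_tz :: "ser_tz set" where
  "Form_tz = {a. \<exists>r>0. \<forall>n. abs_conv2_at r (fps_nth a n)}"

definition Poly_t2_le :: "nat \<Rightarrow> ser_t2 set" where
  "Poly_t2_le k = {g. \<forall>j>k. fps_nth g j = 0}"

abbreviation z :: ser_tz where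
  "z \<equiv> fps_X"

definition d1 :: "ser_tz \<Rightarrow> ser_tz" where
  "d1 a = Abs_fps (\<lambda>n. fps_deriv (fps_nth a n))"

definition d2 :: "ser_tz \<Rightarrow> ser_tz" where
  "d2 a = Abs_fps (\<lambda>n. Abs_fps (\<lambda>i. fps_deriv (fps_nth (fps_nth a n) i)))"

definition of_t2z :: "ser_t2z \<Rightarrow> ser_tz" where
  "of_t2z f = Abs_fps (\<lambda>n. fps_const (fps_nth f n))"

definition of_t2 :: "ser_t2 \<Rightarrow> ser_tz" where
  "of_t2 g = fps_const (fps_const g)"

subsection \<open>Matrices\<close>

definition entries_in :: "'a set \<Rightarrow> 'a^2^2 \<Rightarrow> bool" where
  "entries_in R A \<longleftrightarrow> (\<forall>i j. A $ i $ j \<in> R)"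

definition smult_mat :: "'a::times \<Rightarrow> 'a^2^2 \<Rightarrow> 'a^2^2" where
  "smult_mat c A = map_matrix (\<lambda>a. c * a) A"

text \<open>\<open>at_z0 A\<close> is \<open>A(0)\<close>.\<close>

definition at_z0 :: "ser_tz^2^2 \<Rightarrow> ser_t^2^2" where
  "at_z0 A = map_matrix (\<lambda>a. fps_nth a 0) A"

definition C1 :: "ser_tz^2^2" where
  "C1 = mat 1"

definition C2 :: "ser_tz^2^2" where
  "C2 = vector [vector [0, 0], vector [1, 0]]"

definition E :: "ser_tz^2^2" where
  "E = vector [vector [0, 1], vector [0, 0]]"

subsection \<open>Rank 2 (T)-structures over the germ of the complex plane\<close>

text \<open>
  The parameter \<open>R\<close> is \<open>Conv_tz\<close> for holomorphic and \<open>Form_tz\<close> for formal (T)-structures and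
  gauge isomorphisms.
\<close>

type_synonym mat_pair = "(ser_tz^2^2) \<times> (ser_tz^2^2)"

fun T_structure :: "ser_tz set \<Rightarrow> mat_pair \<Rightarrow> bool" where
  "T_structure R (A1, A2) \<longleftrightarrow> entries_in R A1 \<and> entries_in R A2 \<and>
     smult_mat z (map_matrix d1 A2) - smult_mat z (map_matrix d2 A1) + (A1 ** A2 - A2 ** A1) = 0"

fun gauge_iso :: "ser_tz set \<Rightarrow> mat_pair \<Rightarrow> mat_pair \<Rightarrow> bool" where
  "gauge_iso R (A1, A2) (B1, B2) \<longleftrightarrow>
     (\<exists>T. entries_in R T \<and>
          (\<exists>S. entries_in Conv_t S \<and> at_z0 T ** S = mat 1 \<and> S ** at_z0 T = mat 1) \<and>
          smult_mat z (map_matrix d1 T) + A1 ** T - T ** B1 = 0 \<and>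
          smult_mat z (map_matrix d2 T) + A2 ** T - T ** B2 = 0)"

text \<open>
  Germs of vector fields and germs of sections of \<open>K\<close>, in the frames \<open>\<partial>\<^sub>1, \<partial>\<^sub>2\<close> and
  \<open>s\<^sub>1, s\<^sub>2\<close> restricted to \<open>z = 0\<close>.
\<close>

definition sections :: "(ser_t^2) set" where
  "sections = {v. \<forall>i. v $ i \<in> Conv_t}"

text \<open>The Higgs field \<open>C\<^sub>X\<close> for the vector field \<open>X = X\<^sub>1 \<partial>\<^sub>1 + X\<^sub>2 \<partial>\<^sub>2\<close>.\<close>

fun higgs :: "mat_pair \<Rightarrow> ser_t^2 \<Rightarrow> ser_t^2^2" where
  "higgs (A1, A2) X = smult_mat (X $ 1) (at_z0 A1) + smult_mat (X $ 2) (at_z0 A2)"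

definition unfolding_section :: "mat_pair \<Rightarrow> ser_t^2 \<Rightarrow> bool" where
  "unfolding_section A \<zeta> \<longleftrightarrow>
     \<zeta> \<in> sections \<and> bij_betw (\<lambda>X. higgs A X *v \<zeta>) sections sections"

text \<open>
  The unfolding condition together with the statement that the induced multiplication and unit
  field are \<open>m\<close> and \<open>e\<close>.
\<close>

definition induces_mult ::
  "mat_pair \<Rightarrow> (ser_t^2 \<Rightarrow> ser_t^2 \<Rightarrow> ser_t^2) \<Rightarrow> ser_t^2 \<Rightarrow> bool" where
  "induces_mult A m e \<longleftrightarrow>
     (\<exists>\<zeta>. unfolding_section A \<zeta> \<and>
          (\<forall>X\<in>sections. \<forall>Y\<in>sections.
             higgs A (m X Y) *v \<zeta> = higgs A X *v (higgs A Y *v \<zeta>)) \<and>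
          higgs A e *v \<zeta> = \<zeta>)"

text \<open>
  The \<open>\<O>\<close>-bilinear multiplication with unit field \<open>\<partial>\<^sub>1\<close> and \<open>\<partial>\<^sub>2 \<circ> \<partial>\<^sub>2 = 0\<close>.
\<close>

definition N2_mult :: "ser_t^2 \<Rightarrow> ser_t^2 \<Rightarrow> ser_t^2" where
  "N2_mult X Y = vector [X $ 1 * Y $ 1, X $ 1 * Y $ 2 + X $ 2 * Y $ 1]"

definition N2_unit :: "ser_t^2" where
  "N2_unit = vector [1, 0]"

definition T_structure_over_N2 :: "ser_tz set \<Rightarrow> mat_pair \<Rightarrow> bool" where
  "T_structure_over_N2 R A \<longleftrightarrow> T_structure R A \<and> induces_mult A N2_mult N2_unit"

subsection \<open>Normal forms\<close>

definition star :: "ser_t2z \<Rightarrow> mat_pair" where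
  "star f = (C1, C2 + smult_mat (z * of_t2z f) E)"

definition holo_star :: "ser_t2z \<Rightarrow> bool" where
  "holo_star f \<longleftrightarrow> f \<in> Conv_t2z \<and> T_structure_over_N2 Conv_tz (star f)"

definition formal_star :: "ser_t2z \<Rightarrow> bool" where
  "formal_star f \<longleftrightarrow> f \<in> Form_t2z \<and> T_structure_over_N2 Form_tz (star f)"

text \<open>The form of \<open>star f\<close> with \<open>f = z g\<close>.\<close>

definition star_z2 :: "ser_t2 \<Rightarrow> mat_pair" where
  "star_z2 g = (C1, C2 + smult_mat (z ^ 2 * of_t2 g) E)"

text \<open>The form of \<open>star f\<close> with \<open>f = g\<close> independent of \<open>z\<close>.\<close>

definition star_z1 :: "ser_t2 \<Rightarrow> mat_pair" where
  "star_z1 g = (C1, C2 + smult_mat (z * of_t2 g) E)"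

definition formal_normal_form :: "ser_t2z \<Rightarrow> bool" where
  "formal_normal_form f \<longleftrightarrow>
     formal_star f \<and> fps_nth f 0 \<noteq> 0 \<and>
     (if subdegree (fps_nth f 0) \<le> 1
      then \<forall>k\<ge>1. fps_nth f k = 0
      else \<forall>k\<ge>1. fps_nth f k \<in> Poly_t2_le (subdegree (fps_nth f 0) - 2))"

end

(*
  A matrix A_1 with A_1(0) = 1 is gauged to the identity by the linear differential equation in t_1 that
  remains after dividing by z; flatness then frees A_2 from t_1.  Taking a cyclic vector (rescaled by a
  unit) as the first basis section brings A_2 to the companion form.  Between two companion forms, a
  gauge transformation amounts to its first column (a, c), subject to
    2 a' + z c'' + (f - f~) c = 0,   (f - f~) a + z (a'' + (f c)' + f c') = 0.
  The lowest coefficients give the invariants.  If f(0) = 0, eliminating a'' turns the equations for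
  f~ = z f(1) into a regular linear system, hence convergence.  If f(0) is not 0, the coefficient of z^n
  determines c(n-1) and f~(n) from the operator c |-> 2 f(0) c' + f(0)' c, which is injective for r >= 1
  and whose image consists of the multiples of t_2^(r-1) (of all series if r = 0).

  Convergence is controlled by replacing a series by the series of the norms of its coefficients, the
  variables t_1 and t_2 (for holomorphic structures also z) being identified: integration becomes bounded
  by multiplication with the variable, and linear equations u = g + b u with b(0) = 0 are majorized by
  g / (1 - b).
*)
theory Submission
  imports Defs
begin


text \<open>The obstacle is that z is not a variable like the others. A formal structure has no
  growth condition in z, yet all its z-coefficients must converge on one neighbourhood. Majorants
  therefore keep z as a separate outer indeterminate, and both kinds of structures are treated
  together through an abstract condition \<open>P\<close> on majorants. Solving is separated from
  estimating: a formal solution is built by recursion on the total degree, z included, and is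
  bounded afterwards. The companion form has trace zero, and this prescribes the logarithmic
  derivative of the unit that rescales the cyclic vector. If f(0) is not 0, the equation for c(n)
  contains third derivatives of c(n-1). Differentiation does not reduce a radius of convergence, so
  one radius in t_2 survives all orders, but nothing limits the growth in z: the recursion yields a
  formal gauge transformation. If f(0) = 0, these powers of z cancel and z becomes a mere parameter
  of a differential equation in t_2.\<close>

section \<open>Coefficientwise order and radii of convergence of real series\<close>

definition fps_le :: "real fps \<Rightarrow> real fps \<Rightarrow> bool" (infix "\<preceq>" 50) where
  "f \<preceq> g \<longleftrightarrow> (\<forall>n. fps_nth f n \<le> fps_nth g n)"

lemma fps_leD: "f \<preceq> g \<Longrightarrow> fps_nth f n \<le> fps_nth g n"
  by (simp add: fps_le_def)

lemma fps_le_refl [simp]: "f \<preceq> f"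
  by (simp add: fps_le_def)

lemma fps_le_trans [trans]: "f \<preceq> g \<Longrightarrow> g \<preceq> h \<Longrightarrow> f \<preceq> h"
  by (meson fps_le_def order_trans)

lemma fps_le_add: "f \<preceq> g \<Longrightarrow> f' \<preceq> g' \<Longrightarrow> f + f' \<preceq> g + g'"
  by (simp add: fps_le_def add_mono)

lemma fps_le_sum: "(\<And>i. i \<in> I \<Longrightarrow> f i \<preceq> g i) \<Longrightarrow> sum f I \<preceq> sum g I"
  by (simp add: fps_le_def fps_sum_nth sum_mono)

lemma fps_le_mult: "0 \<preceq> f \<Longrightarrow> f \<preceq> f' \<Longrightarrow> 0 \<preceq> g \<Longrightarrow> g \<preceq> g' \<Longrightarrow> f * g \<preceq> f' * g'"
  unfolding fps_le_def fps_mult_nth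
  by (auto intro!: sum_mono mult_mono intro: order_trans)

lemma fps_conv_radius_mono:
  assumes "0 \<preceq> f" "f \<preceq> g"
  shows "fps_conv_radius g \<le> fps_conv_radius f"
  unfolding fps_conv_radius_def
proof (rule conv_radius_geI_ex')
  fix r :: real assume r: "0 < r" "ereal r < conv_radius (fps_nth g)"
  have s: "summable (\<lambda>n. fps_nth g n * of_real r ^ n)"
    using r by (intro summable_in_conv_radius) auto
  show "summable (\<lambda>n. fps_nth f n * of_real r ^ n)"
    by (rule summable_comparison_test'[OF s, of 0])
      (use assms r in \<open>auto simp: fps_le_def intro!: mult_right_mono\<close>)
qed

lemma fps_conv_radius_mult_ge:
  "R \<le> fps_conv_radius f \<Longrightarrow> R \<le> fps_conv_radius g \<Longrightarrow> R \<le> fps_conv_radius (f * g)"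
  using fps_conv_radius_mult[of f g] by (meson min.boundedI order_trans)

lemma fps_conv_radius_add_ge:
  "R \<le> fps_conv_radius f \<Longrightarrow> R \<le> fps_conv_radius g \<Longrightarrow> R \<le> fps_conv_radius (f + g)"
  using fps_conv_radius_add[of f g] by (meson min.boundedI order_trans)

lemma fps_conv_radius_diff_ge:
  "R \<le> fps_conv_radius f \<Longrightarrow> R \<le> fps_conv_radius g \<Longrightarrow> R \<le> fps_conv_radius (f - g)"
  using fps_conv_radius_diff[of f g] by (meson min.boundedI order_trans)

lemma fps_conv_radius_sum_ge:
  "(\<And>i. i \<in> I \<Longrightarrow> R \<le> fps_conv_radius (f i)) \<Longrightarrow> R \<le> fps_conv_radius (sum f I)"
  by (induction I rule: infinite_finite_induct) (auto intro: fps_conv_radius_add_ge)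

text \<open>Since b has no constant term, coefficient n of b e only involves coefficients of e below
  n, so the sign propagates by induction.\<close>

lemma fps_nonneg_fixpoint:
  assumes "e = c + b * e" "0 \<preceq> b" "fps_nth b 0 = 0" "0 \<preceq> c"
  shows "0 \<preceq> e"
proof -
  have "0 \<le> fps_nth e n" for n
  proof (induction n rule: less_induct)
    case (less n)
    have "fps_nth e n = fps_nth c n + (\<Sum>i=0..n. fps_nth b i * fps_nth e (n - i))"
      by (subst assms(1)) (simp add: fps_mult_nth)
    also have "\<dots> \<ge> 0"
    proof (intro add_nonneg_nonneg sum_nonneg)
      fix i assume "i \<in> {0..n}"
      show "0 \<le> fps_nth b i * fps_nth e (n - i)"
      proof (cases "i = 0")
        case False
        with \<open>i \<in> {0..n}\<close> have "n - i < n" by auto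
        then show ?thesis using less[of "n - i"] assms(2) by (auto simp: fps_le_def)
      qed (use assms in auto)
    qed (use assms in \<open>auto simp: fps_le_def\<close>)
    finally show ?case .
  qed
  then show ?thesis by (simp add: fps_le_def)
qed

text \<open>A discrete Gronwall inequality: the majorant \<open>g / (1 - b)\<close> solves \<open>w = g + b w\<close>.\<close>

lemma fps_le_geometric:
  assumes u: "u \<preceq> g + b * u" and b: "0 \<preceq> b" "fps_nth b 0 = 0"
  shows "u \<preceq> g * inverse (1 - b)"
proof -
  define w where "w = g * inverse (1 - b)"
  have "(1 - b) * inverse (1 - b) = 1"
    using b by (intro inverse_mult_eq_1') simp
  then have "(1 - b) * w = g"
    unfolding w_def by (simp add: mult.left_commute)
  then have w: "w = g + b * w"
    by (simp add: algebra_simps)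
  have "0 \<preceq> w - u"
  proof (rule fps_nonneg_fixpoint)
    show "w - u = (g + b * u - u) + b * (w - u)"
      using w by (simp add: algebra_simps)
    show "0 \<preceq> g + b * u - u"
      using u by (simp add: fps_le_def)
  qed (use b in auto)
  then show ?thesis unfolding w_def by (simp add: fps_le_def)
qed

lemma fps_conv_radius_geometric_pos:
  fixes b :: "real fps"
  assumes "fps_nth b 0 = 0" "fps_conv_radius b > 0"
  shows "fps_conv_radius (inverse (1 - b)) > 0"
proof (rule fps_conv_radius_inverse_pos)
  show "fps_conv_radius (1 - b) > 0"
    using assms(2) fps_conv_radius_diff[of 1 b] by (simp add: less_le_trans)
qed (use assms in auto)

subsection \<open>Majorant series in two groups of variables\<close>

text \<open>In the main use the outer index is the power of z and the inner one the total degree in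
  t_1 and t_2: the formal ring bounds the radii of the inner series uniformly, but not their growth
  with the outer index.\<close>

definition fps_le2 :: "real fps fps \<Rightarrow> real fps fps \<Rightarrow> bool" (infix "\<preceq>\<preceq>" 50) where
  "u \<preceq>\<preceq> v \<longleftrightarrow> (\<forall>n. fps_nth u n \<preceq> fps_nth v n)"

lemma fps_le2_refl [simp]: "f \<preceq>\<preceq> f"
  by (simp add: fps_le2_def)

lemma fps_le2_trans [trans]: "f \<preceq>\<preceq> g \<Longrightarrow> g \<preceq>\<preceq> h \<Longrightarrow> f \<preceq>\<preceq> h"
  by (meson fps_le2_def fps_le_trans)

lemma fps_le2_add: "f \<preceq>\<preceq> g \<Longrightarrow> f' \<preceq>\<preceq> g' \<Longrightarrow> f + f' \<preceq>\<preceq> g + g'"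
  by (simp add: fps_le2_def fps_le_add)

lemma fps_le2_sum: "(\<And>i. i \<in> I \<Longrightarrow> f i \<preceq>\<preceq> g i) \<Longrightarrow> sum f I \<preceq>\<preceq> sum g I"
  by (simp add: fps_le2_def fps_sum_nth fps_le_sum)

lemma fps_nonneg2_sum: "(\<And>i. i \<in> I \<Longrightarrow> 0 \<preceq>\<preceq> g i) \<Longrightarrow> 0 \<preceq>\<preceq> sum g I"
  using fps_le2_sum[of I "\<lambda>_. 0" g] by simp

lemma fps_le2_member_sum:
  fixes u :: "'n::finite \<Rightarrow> real fps fps"
  assumes "\<And>i. 0 \<preceq>\<preceq> u i"
  shows "u j \<preceq>\<preceq> (\<Sum>i\<in>UNIV. u i)"
proof -
  have "u j + 0 \<preceq>\<preceq> u j + (\<Sum>i\<in>UNIV - {j}. u i)"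
    by (intro fps_le2_add fps_nonneg2_sum assms fps_le2_refl)
  then show ?thesis by (simp add: sum.remove[of UNIV j])
qed

lemma fps_le2_mult:
  "0 \<preceq>\<preceq> f \<Longrightarrow> f \<preceq>\<preceq> f' \<Longrightarrow> 0 \<preceq>\<preceq> g \<Longrightarrow> g \<preceq>\<preceq> g' \<Longrightarrow> f * g \<preceq>\<preceq> f' * g'"
  unfolding fps_le2_def fps_mult_nth
  by (auto intro!: fps_le_sum fps_le_mult)

lemma fps_nonneg2_mult: "0 \<preceq>\<preceq> f \<Longrightarrow> 0 \<preceq>\<preceq> g \<Longrightarrow> 0 \<preceq>\<preceq> f * g"
  using fps_le2_mult[of 0 f 0 g] by simp

text \<open>\<open>collapse\<close> identifies the two indeterminates of an iterated power series.\<close>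

definition collapse :: "real fps fps \<Rightarrow> real fps" where
  "collapse u = Abs_fps (\<lambda>m. \<Sum>i\<le>m. fps_nth (fps_nth u i) (m - i))"

lemma collapse_nth: "fps_nth (collapse u) m = (\<Sum>i\<le>m. fps_nth (fps_nth u i) (m - i))"
  by (simp add: collapse_def)

lemma collapse_add: "collapse (u + v) = collapse u + collapse v"
  by (rule fps_ext) (simp add: collapse_nth sum.distrib)

text \<open>Setting two indeterminates equal is a ring homomorphism; product estimates for iterated
  series thus become estimates for ordinary ones.\<close>

lemma collapse_mult: "collapse (u * v) = collapse u * collapse v"
proof (rule fps_ext)
  fix m
  let ?u = "\<lambda>k l. fps_nth (fps_nth u k) l" and ?v = "\<lambda>k l. fps_nth (fps_nth v k) l"
  have "fps_nth (collapse (u * v)) m = (\<Sum>i\<le>m. \<Sum>k\<le>i. \<Sum>l\<le>m - i. ?u k l * ?v (i - k) (m - i - l))"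
    by (simp add: collapse_nth fps_mult_nth fps_sum_nth atLeast0AtMost)
  also have "\<dots> = (\<Sum>(i, k, l) \<in> (SIGMA i:{..m}. {..i} \<times> {..m - i}). ?u k l * ?v (i - k) (m - i - l))"
    by (simp add: sum.Sigma sum.cartesian_product)
  \<comment> \<open>The new first index p = k + l is the total degree of the factor from
    \<open>u\<close>.\<close>
  also have "\<dots> = (\<Sum>(p, k, q) \<in> (SIGMA p:{..m}. {..p} \<times> {..m - p}). ?u k (p - k) * ?v q (m - p - q))"
    by (rule sum.reindex_bij_witness[of _ "\<lambda>(p, k, q). (k + q, k, p - k)" "\<lambda>(i, k, l). (k + l, k, i - k)"])
      (auto simp: algebra_simps)
  also have "\<dots> = (\<Sum>p\<le>m. (\<Sum>k\<le>p. ?u k (p - k)) * (\<Sum>q\<le>m - p. ?v q (m - p - q)))"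
    by (simp add: sum.Sigma sum.cartesian_product sum_product)
  also have "\<dots> = fps_nth (collapse u * collapse v) m"
    by (simp add: collapse_nth fps_mult_nth atLeast0AtMost)
  finally show "fps_nth (collapse (u * v)) m = fps_nth (collapse u * collapse v) m" .
qed

lemma collapse_mono: "u \<preceq>\<preceq> v \<Longrightarrow> collapse u \<preceq> collapse v"
  by (simp add: fps_le2_def fps_le_def collapse_nth sum_mono)

lemma collapse_nonneg: "0 \<preceq>\<preceq> v \<Longrightarrow> 0 \<preceq> collapse v"
  by (simp add: fps_le2_def fps_le_def collapse_nth sum_nonneg)

lemma collapse_const: "collapse (fps_const c) = c"
proof (rule fps_ext)
  fix m
  have "(\<Sum>i\<le>m. fps_nth (if i = 0 then c else 0) (m - i)) = (\<Sum>i\<in>{0}. fps_nth c (m - i))"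
    by (rule sum.mono_neutral_cong_right) auto
  then show "fps_nth (collapse (fps_const c)) m = fps_nth c m"
    by (simp add: collapse_nth)
qed

text \<open>The inner derivative brings the factor m - i + 1, differentiation after merging the
  larger factor m + 1.\<close>

lemma collapse_deriv_le:
  assumes "\<And>n. fps_nth u n \<preceq> fps_deriv (fps_nth v n)" "0 \<preceq>\<preceq> v"
  shows "collapse u \<preceq> fps_deriv (collapse v)"
  unfolding fps_le_def
proof
  fix m
  have v: "0 \<le> fps_nth (fps_nth v i) j" for i j
    using assms(2) by (simp add: fps_le2_def fps_le_def)
  have "fps_nth (collapse u) m \<le> (\<Sum>i\<le>m. of_nat (m - i + 1) * fps_nth (fps_nth v i) (m - i + 1))"
    unfolding collapse_nth
    by (intro sum_mono fps_leD[OF assms(1), unfolded fps_deriv_nth])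
  also have "\<dots> \<le> (\<Sum>i\<le>m. of_nat (m + 1) * fps_nth (fps_nth v i) (m + 1 - i))"
    by (intro sum_mono mult_mono) (auto simp: v Suc_diff_le)
  also have "\<dots> \<le> (\<Sum>i\<le>m + 1. of_nat (m + 1) * fps_nth (fps_nth v i) (m + 1 - i))"
    by (intro sum_mono2) (auto simp: v)
  finally show "fps_nth (collapse u) m \<le> fps_nth (fps_deriv (collapse v)) m"
    by (simp only: collapse_nth fps_deriv_nth sum_distrib_left)
qed

text \<open>Dividing by the outer variable drops the terms of outer index 0, which the shift of the
  merged series retains.\<close>

lemma collapse_shift_le:
  assumes "0 \<preceq>\<preceq> u"
  shows "collapse (fps_shift 1 u) \<preceq> fps_shift 1 (collapse u)"
  unfolding fps_le_def
proof
  fix m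
  have "fps_nth (collapse (fps_shift 1 u)) m = (\<Sum>i\<in>{1..m + 1}. fps_nth (fps_nth u i) (m + 1 - i))"
    unfolding collapse_nth
    by (rule sum.reindex_bij_witness[of _ "\<lambda>i. i - 1" "\<lambda>i. i + 1"]) auto
  also have "\<dots> \<le> (\<Sum>i\<le>m + 1. fps_nth (fps_nth u i) (m + 1 - i))"
    by (intro sum_mono2) (use assms in \<open>auto simp: fps_le2_def fps_le_def\<close>)
  finally show "fps_nth (collapse (fps_shift 1 u)) m \<le> fps_nth (fps_shift 1 (collapse u)) m"
    by (simp add: collapse_nth)
qed

section \<open>Majorants of complex series, and the given rings in terms of them\<close>

definition maj1 :: "complex fps \<Rightarrow> real fps" where
  "maj1 a = Abs_fps (\<lambda>j. norm (fps_nth a j))"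

definition maj2 :: "ser_t \<Rightarrow> real fps" where
  "maj2 a = collapse (Abs_fps (\<lambda>i. maj1 (fps_nth a i)))"

text \<open>z stays separate: \<open>collapse (maj3 a)\<close> decides membership in
  \<open>Conv_tz\<close>, the single coefficients of \<open>maj3 a\<close> membership in
  \<open>Form_tz\<close>.\<close>

definition maj3 :: "ser_tz \<Rightarrow> real fps fps" where
  "maj3 a = Abs_fps (\<lambda>n. maj2 (fps_nth a n))"

lemma maj1_nth: "fps_nth (maj1 a) j = norm (fps_nth a j)"
  by (simp add: maj1_def)

lemma maj2_nth: "fps_nth (maj2 a) m = (\<Sum>i\<le>m. norm (fps_nth (fps_nth a i) (m - i)))"
  by (simp add: maj2_def collapse_nth maj1_nth)

lemma maj3_nth: "fps_nth (maj3 a) n = maj2 (fps_nth a n)"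
  by (simp add: maj3_def)

lemma maj1_nonneg: "0 \<preceq> maj1 a"
  by (simp add: fps_le_def maj1_nth)

lemma maj2_nonneg: "0 \<preceq> maj2 a"
  by (simp add: fps_le_def maj2_nth sum_nonneg)

lemma maj3_nonneg: "0 \<preceq>\<preceq> maj3 a"
  by (simp add: fps_le2_def maj3_nth maj2_nonneg)

lemma maj2_add: "maj2 (a + b) \<preceq> maj2 a + maj2 b"
  by (simp add: fps_le_def maj2_nth norm_triangle_ineq sum_mono flip: sum.distrib)

lemma maj3_add: "maj3 (a + b) \<preceq>\<preceq> maj3 a + maj3 b"
  by (simp add: fps_le2_def maj3_nth maj2_add)

lemma maj3_uminus: "maj3 (- a) = maj3 a"
  by (intro fps_ext) (simp add: maj3_nth maj2_nth)

lemma maj3_0 [simp]: "maj3 0 = 0"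
  by (intro fps_ext) (simp add: maj3_nth maj2_nth)

lemma maj1_0 [simp]: "maj1 0 = 0"
  by (rule fps_ext) (simp add: maj1_nth)

lemma maj2_0 [simp]: "maj2 0 = 0"
  by (rule fps_ext) (simp add: maj2_nth)

lemma maj2_const: "maj2 (fps_const c) = maj1 c"
proof -
  have "Abs_fps (\<lambda>i. maj1 (fps_nth (fps_const c) i)) = fps_const (maj1 c)"
    by (rule fps_ext) simp
  then show ?thesis by (simp add: maj2_def collapse_const)
qed

lemma maj1_le_maj2: "maj1 (fps_nth a 0) \<preceq> maj2 a"
  unfolding fps_le_def
proof
  fix m
  have "norm (fps_nth (fps_nth a 0) (m - 0)) \<le> (\<Sum>i\<le>m. norm (fps_nth (fps_nth a i) (m - i)))"
    by (rule member_le_sum) auto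
  then show "fps_nth (maj1 (fps_nth a 0)) m \<le> fps_nth (maj2 a) m"
    by (simp add: maj1_nth maj2_nth)
qed

lemma maj3_const: "maj3 (fps_const c) = fps_const (maj2 c)"
  by (rule fps_ext) (simp add: maj3_nth)

lemma maj1_const: "maj1 (fps_const c) = fps_const (norm c)"
  by (rule fps_ext) (simp add: maj1_nth)

lemma maj1_mult: "maj1 (a * b) \<preceq> maj1 a * maj1 b"
  unfolding fps_le_def maj1_nth fps_mult_nth
  by (auto intro!: order_trans[OF norm_sum] simp: norm_mult)

lemma maj1_sum: "maj1 (sum f I) \<preceq> (\<Sum>i\<in>I. maj1 (f i))"
  unfolding fps_le_def maj1_nth fps_sum_nth by (auto intro: norm_sum)

lemma maj2_mult: "maj2 (a * b) \<preceq> maj2 a * maj2 b"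
proof -
  let ?M = "\<lambda>a. Abs_fps (\<lambda>i. maj1 (fps_nth a i))"
  have "?M (a * b) \<preceq>\<preceq> ?M a * ?M b"
    unfolding fps_le2_def
  proof
    fix n
    have "maj1 (\<Sum>i=0..n. fps_nth a i * fps_nth b (n - i)) \<preceq> (\<Sum>i=0..n. maj1 (fps_nth a i * fps_nth b (n - i)))"
      by (rule maj1_sum)
    also have "\<dots> \<preceq> (\<Sum>i=0..n. maj1 (fps_nth a i) * maj1 (fps_nth b (n - i)))"
      by (intro fps_le_sum maj1_mult)
    finally show "fps_nth (?M (a * b)) n \<preceq> fps_nth (?M a * ?M b) n"
      by (simp add: fps_mult_nth)
  qed
  from collapse_mono[OF this] show ?thesis
    by (simp add: maj2_def collapse_mult)
qed

lemma maj2_sum: "maj2 (sum f I) \<preceq> (\<Sum>i\<in>I. maj2 (f i))"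
proof (induction I rule: infinite_finite_induct)
  case (insert x F)
  then show ?case
    using fps_le_trans[OF maj2_add fps_le_add[OF fps_le_refl]] by simp
qed (simp_all add: fps_le_def maj2_nth)

lemma maj3_mult: "maj3 (a * b) \<preceq>\<preceq> maj3 a * maj3 b"
  unfolding fps_le2_def
proof
  fix n
  have "maj2 (\<Sum>i=0..n. fps_nth a i * fps_nth b (n - i)) \<preceq> (\<Sum>i=0..n. maj2 (fps_nth a i * fps_nth b (n - i)))"
    by (rule maj2_sum)
  also have "\<dots> \<preceq> (\<Sum>i=0..n. maj2 (fps_nth a i) * maj2 (fps_nth b (n - i)))"
    by (intro fps_le_sum maj2_mult)
  finally show "fps_nth (maj3 (a * b)) n \<preceq> fps_nth (maj3 a * maj3 b) n"
    by (simp add: fps_mult_nth maj3_nth)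
qed

lemma maj3_sum: "maj3 (sum f I) \<preceq>\<preceq> (\<Sum>i\<in>I. maj3 (f i))"
proof (induction I rule: infinite_finite_induct)
  case (insert x F)
  then show ?case
    using fps_le2_trans[OF maj3_add fps_le2_add[OF fps_le2_refl]] by simp
qed simp_all

text \<open>For nonnegative terms the sums over all indices of degree below M are cofinal among the
  finite partial sums. This trades summability over multi-indices for the convergence of one power
  series.\<close>

lemma summable_on_graded_iff:
  fixes h :: "'i \<Rightarrow> real" and deg :: "'i \<Rightarrow> nat"
  assumes h: "\<And>x. 0 \<le> h x" and r: "0 \<le> r" and fin: "\<And>m. finite {x. deg x = m}"
  shows "(\<lambda>x. h x * r ^ deg x) summable_on UNIV \<longleftrightarrow> summable (\<lambda>m. (\<Sum>x | deg x = m. h x) * r ^ m)"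
proof -
  have fin': "finite {x. deg x < M}" for M
  proof -
    have "{x. deg x < M} = (\<Union>m<M. {x. deg x = m})" by auto
    then show ?thesis using fin by simp
  qed
  have partial: "(\<Sum>m<M. (\<Sum>x | deg x = m. h x) * r ^ m) = (\<Sum>x | deg x < M. h x * r ^ deg x)" for M
  proof -
    have "(\<Sum>x | deg x < M. h x * r ^ deg x) =
        (\<Sum>m<M. \<Sum>x | x \<in> {x. deg x < M} \<and> deg x = m. h x * r ^ deg x)"
      using fin' by (subst sum.group) auto
    also have "\<dots> = (\<Sum>m<M. (\<Sum>x | deg x = m. h x) * r ^ m)"
      unfolding sum_distrib_right by (intro sum.cong) auto
    finally show ?thesis by simp
  qed
  show ?thesis
  proof
    assume s: "(\<lambda>x. h x * r ^ deg x) summable_on UNIV"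
    show "summable (\<lambda>m. (\<Sum>x | deg x = m. h x) * r ^ m)"
    proof (rule bounded_imp_summable)
      fix M
      have "(\<Sum>m\<le>M. (\<Sum>x | deg x = m. h x) * r ^ m) = (\<Sum>x | deg x < Suc M. h x * r ^ deg x)"
        using partial[of "Suc M"] by (simp only: lessThan_Suc_atMost)
      also have "\<dots> \<le> (\<Sum>\<^sub>\<infinity>x. h x * r ^ deg x)"
        using h r by (intro finite_sum_le_infsum[OF s fin']) auto
      finally show "(\<Sum>m\<le>M. (\<Sum>x | deg x = m. h x) * r ^ m) \<le> (\<Sum>\<^sub>\<infinity>x. h x * r ^ deg x)" .
    qed (use h r in \<open>auto intro!: mult_nonneg_nonneg sum_nonneg\<close>)
  next
    assume s: "summable (\<lambda>m. (\<Sum>x | deg x = m. h x) * r ^ m)"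
    show "(\<lambda>x. h x * r ^ deg x) summable_on UNIV"
    proof (rule nonneg_bdd_above_summable_on)
      show "bdd_above (sum (\<lambda>x. h x * r ^ deg x) ` {F. F \<subseteq> UNIV \<and> finite F})"
      proof (rule bdd_aboveI2)
        fix F assume "F \<in> {F. F \<subseteq> (UNIV :: 'i set) \<and> finite F}"
        then have F: "finite F" by simp
        then obtain M where M: "\<And>x. x \<in> F \<Longrightarrow> deg x < M"
          by (metis finite_imageI finite_nat_set_iff_bounded imageI)
        have "(\<Sum>x\<in>F. h x * r ^ deg x) \<le> (\<Sum>x | deg x < M. h x * r ^ deg x)"
          using F M h r fin' by (intro sum_mono2) auto
        also have "\<dots> = (\<Sum>m<M. (\<Sum>x | deg x = m. h x) * r ^ m)"
          by (simp add: partial)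
        also have "\<dots> \<le> (\<Sum>m. (\<Sum>x | deg x = m. h x) * r ^ m)"
          using h r by (intro sum_le_suminf[OF s]) (auto intro!: mult_nonneg_nonneg sum_nonneg)
        finally show "(\<Sum>x\<in>F. h x * r ^ deg x) \<le> (\<Sum>m. (\<Sum>x | deg x = m. h x) * r ^ m)" .
      qed
    qed (use h r in auto)
  qed
qed

lemma abs_conv2_at_iff:
  assumes "0 \<le> r"
  shows "abs_conv2_at r a \<longleftrightarrow> summable (\<lambda>m. fps_nth (maj2 a) m * r ^ m)"
proof -
  have fin: "finite {x. (\<lambda>(i, j). i + j) x = m}" for m :: nat
    by (rule finite_subset[of _ "{..m} \<times> {..m}"]) auto
  have "fps_nth (maj2 a) m = (\<Sum>x | (\<lambda>(i, j). i + j) x = m. (\<lambda>(i, j). norm (fps_nth (fps_nth a i) j)) x)" for m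
    unfolding maj2_nth
    by (rule sum.reindex_bij_witness[of _ fst "\<lambda>i. (i, m - i)"]) auto
  then show ?thesis
    unfolding abs_conv2_at_def
    using summable_on_graded_iff[of "\<lambda>(i, j). norm (fps_nth (fps_nth a i) j)" r "\<lambda>(i, j). i + j"] fin assms
    by (simp add: case_prod_unfold)
qed

lemma abs_conv3_at_iff:
  assumes "0 \<le> r"
  shows "abs_conv3_at r a \<longleftrightarrow> summable (\<lambda>m. fps_nth (collapse (maj3 a)) m * r ^ m)"
proof -
  let ?deg = "\<lambda>(n, i, j). n + i + j :: nat"
  have fin: "finite {x. ?deg x = m}" for m :: nat
    by (rule finite_subset[of _ "{..m} \<times> {..m} \<times> {..m}"]) auto
  have "fps_nth (collapse (maj3 a)) m =
      (\<Sum>x | ?deg x = m. (\<lambda>(n, i, j). norm (fps_nth (fps_nth (fps_nth a n) i) j)) x)" for m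
  proof -
    have "fps_nth (collapse (maj3 a)) m =
        (\<Sum>(n, i) \<in> (SIGMA n:{..m}. {..m - n}). norm (fps_nth (fps_nth (fps_nth a n) i) (m - n - i)))"
      by (simp add: collapse_nth maj3_nth maj2_nth sum.Sigma)
    also have "\<dots> = (\<Sum>x | ?deg x = m. (\<lambda>(n, i, j). norm (fps_nth (fps_nth (fps_nth a n) i) j)) x)"
      by (rule sum.reindex_bij_witness[of _ "\<lambda>(n, i, j). (n, i)" "\<lambda>(n, i). (n, i, m - n - i)"]) auto
    finally show ?thesis .
  qed
  then show ?thesis
    unfolding abs_conv3_at_def
    using summable_on_graded_iff[of "\<lambda>(n, i, j). norm (fps_nth (fps_nth (fps_nth a n) i) j)" r ?deg] fin assms
    by (simp add: case_prod_unfold)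
qed

lemma summable_imp_le_fps_conv_radius:
  fixes f :: "real fps"
  assumes "0 < r" "summable (\<lambda>m. fps_nth f m * r ^ m)"
  shows "ereal r \<le> fps_conv_radius f"
  using conv_radius_geI[of "fps_nth f" r] assms by (simp add: fps_conv_radius_def)

lemma summable_less_fps_conv_radius:
  fixes f :: "real fps"
  assumes "0 \<le> r" "ereal r < fps_conv_radius f"
  shows "summable (\<lambda>m. fps_nth f m * r ^ m)"
  using summable_in_conv_radius[of r "fps_nth f"] assms by (simp add: fps_conv_radius_def)

lemma abs_conv2_at_ex_iff: "(\<exists>r>0. abs_conv2_at r a) \<longleftrightarrow> 0 < fps_conv_radius (maj2 a)"
proof
  assume "\<exists>r>0. abs_conv2_at r a"
  then obtain r where "r > 0" "ereal r \<le> fps_conv_radius (maj2 a)"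
    using summable_imp_le_fps_conv_radius abs_conv2_at_iff by (meson less_imp_le)
  then show "0 < fps_conv_radius (maj2 a)"
    by (meson ereal_less(2) less_le_trans)
next
  assume "0 < fps_conv_radius (maj2 a)"
  then obtain r where "0 < ereal r" "ereal r < fps_conv_radius (maj2 a)"
    using ereal_dense2 by blast
  then show "\<exists>r>0. abs_conv2_at r a"
    using summable_less_fps_conv_radius[of r] abs_conv2_at_iff[of r] by auto
qed

lemma Conv_t_iff: "a \<in> Conv_t \<longleftrightarrow> 0 < fps_conv_radius (maj2 a)"
  by (simp add: Conv_t_def abs_conv2_at_ex_iff)

lemma Conv_t2z_iff: "a \<in> Conv_t2z \<longleftrightarrow> 0 < fps_conv_radius (maj2 a)"
  by (simp add: Conv_t2z_def abs_conv2_at_ex_iff)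

lemma Conv_tz_iff: "a \<in> Conv_tz \<longleftrightarrow> 0 < fps_conv_radius (collapse (maj3 a))"
proof
  assume "a \<in> Conv_tz"
  then obtain r where "r > 0" "ereal r \<le> fps_conv_radius (collapse (maj3 a))"
    unfolding Conv_tz_def
    using summable_imp_le_fps_conv_radius abs_conv3_at_iff by (auto dest: less_imp_le)
  then show "0 < fps_conv_radius (collapse (maj3 a))"
    by (meson ereal_less(2) less_le_trans)
next
  assume "0 < fps_conv_radius (collapse (maj3 a))"
  then obtain r where "0 < ereal r" "ereal r < fps_conv_radius (collapse (maj3 a))"
    using ereal_dense2 by blast
  then show "a \<in> Conv_tz"
    unfolding Conv_tz_def
    using summable_less_fps_conv_radius[of r] abs_conv3_at_iff[of r] by auto
qed

lemma Form_tz_iff: "a \<in> Form_tz \<longleftrightarrow> (\<exists>R>0. \<forall>n. ereal R \<le> fps_conv_radius (fps_nth (maj3 a) n))"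
proof
  assume "a \<in> Form_tz"
  then obtain r where r: "r > 0" "\<And>n. abs_conv2_at r (fps_nth a n)"
    by (auto simp: Form_tz_def)
  then have "ereal r \<le> fps_conv_radius (fps_nth (maj3 a) n)" for n
    using summable_imp_le_fps_conv_radius[of r] abs_conv2_at_iff[of r] by (simp add: maj3_nth)
  with r show "\<exists>R>0. \<forall>n. ereal R \<le> fps_conv_radius (fps_nth (maj3 a) n)" by blast
next
  assume "\<exists>R>0. \<forall>n. ereal R \<le> fps_conv_radius (fps_nth (maj3 a) n)"
  then obtain R where R: "R > 0" "\<And>n. ereal R \<le> fps_conv_radius (maj2 (fps_nth a n))"
    by (auto simp: maj3_nth)
  \<comment> \<open>Summability is guaranteed only strictly inside the disc of convergence; half the
    radius works for all n.\<close>
  have "ereal (R / 2) < fps_conv_radius (maj2 (fps_nth a n))" for n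
    using R(1) by (intro less_le_trans[OF _ R(2)]) simp
  then have "abs_conv2_at (R / 2) (fps_nth a n)" for n
    using summable_less_fps_conv_radius[of "R / 2"] abs_conv2_at_iff[of "R / 2"] R(1) by simp
  then show "a \<in> Form_tz"
    unfolding Form_tz_def using R(1) by (auto intro!: exI[of _ "R / 2"])
qed


section \<open>The holomorphic and the formal ring under one majorant condition\<close>

definition conv_majorant :: "real fps fps \<Rightarrow> bool" where
  "conv_majorant u \<longleftrightarrow> 0 < fps_conv_radius (collapse u)"

definition form_majorant :: "real fps fps \<Rightarrow> bool" where
  "form_majorant u \<longleftrightarrow> (\<exists>R>0. \<forall>n. ereal R \<le> fps_conv_radius (fps_nth u n))"

lemma form_majorantE2:
  assumes "form_majorant u" "form_majorant v"
  obtains R where "R > 0" "\<And>n. ereal R \<le> fps_conv_radius (fps_nth u n)"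
    "\<And>n. ereal R \<le> fps_conv_radius (fps_nth v n)"
proof -
  from assms obtain R1 R2 where R: "R1 > 0" "\<And>n. ereal R1 \<le> fps_conv_radius (fps_nth u n)"
    "R2 > 0" "\<And>n. ereal R2 \<le> fps_conv_radius (fps_nth v n)"
    unfolding form_majorant_def by blast
  have "ereal (min R1 R2) \<le> ereal R1" "ereal (min R1 R2) \<le> ereal R2" by auto
  then show ?thesis
    using R by (intro that[of "min R1 R2"]) (auto simp: min_le_iff_disj)
qed

lemma ereal_pos_real_below:
  assumes "0 < (x :: ereal)"
  obtains R where "0 < R" "ereal R \<le> x"
  using ereal_dense2[OF assms] by (force intro: less_imp_le)

lemma fps_conv_radius_add_pos:
  "0 < fps_conv_radius f \<Longrightarrow> 0 < fps_conv_radius g \<Longrightarrow> 0 < fps_conv_radius (f + g)"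
  using fps_conv_radius_add[of f g] by (meson less_le_trans min_less_iff_conj)

lemma fps_conv_radius_mult_pos:
  "0 < fps_conv_radius f \<Longrightarrow> 0 < fps_conv_radius g \<Longrightarrow> 0 < fps_conv_radius (f * g)"
  using fps_conv_radius_mult[of f g] by (meson less_le_trans min_less_iff_conj)

text \<open>The two cases are listed instead of axiomatized: the closure properties of
  \<open>P\<close> are checked once per case, and all that is built on them holds for holomorphic
  and formal structures alike.\<close>

locale germ_ring =
  fixes R :: "ser_tz set" and P :: "real fps fps \<Rightarrow> bool"
  assumes R_cases: "R = Conv_tz \<and> P = conv_majorant \<or> R = Form_tz \<and> P = form_majorant"
begin

lemma mem_iff: "a \<in> R \<longleftrightarrow> P (maj3 a)"
  using R_cases by (auto simp: Conv_tz_iff Form_tz_iff conv_majorant_def form_majorant_def)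

lemma majorant_mono:
  assumes "0 \<preceq>\<preceq> u" "u \<preceq>\<preceq> v" "P v"
  shows "P u"
proof -
  have "conv_majorant u" if "conv_majorant v"
    using that fps_conv_radius_mono[OF collapse_nonneg[OF assms(1)] collapse_mono[OF assms(2)]]
    by (auto simp: conv_majorant_def)
  moreover have "form_majorant u" if "form_majorant v"
    using that assms fps_conv_radius_mono unfolding form_majorant_def fps_le2_def
    by (metis fps_zero_nth order_trans)
  ultimately show ?thesis using R_cases assms(3) by auto
qed

lemma majorant_add:
  assumes "P u" "P v"
  shows "P (u + v)"
proof -
  have "conv_majorant (u + v)" if "conv_majorant u" "conv_majorant v"
    using that by (simp add: conv_majorant_def collapse_add fps_conv_radius_add_pos)
  moreover have "form_majorant (u + v)" if uv: "form_majorant u" "form_majorant v"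
    using uv by (rule form_majorantE2) (auto simp: form_majorant_def intro!: fps_conv_radius_add_ge)
  ultimately show ?thesis using R_cases assms by auto
qed

lemma majorant_mult:
  assumes "P u" "P v"
  shows "P (u * v)"
proof -
  have "conv_majorant (u * v)" if "conv_majorant u" "conv_majorant v"
    using that by (simp add: conv_majorant_def collapse_mult fps_conv_radius_mult_pos)
  moreover have "form_majorant (u * v)" if uv: "form_majorant u" "form_majorant v"
    using uv by (rule form_majorantE2)
      (auto simp: form_majorant_def fps_mult_nth intro!: fps_conv_radius_mult_ge fps_conv_radius_sum_ge)
  ultimately show ?thesis using R_cases assms by auto
qed

lemma majorant_const:
  assumes "0 < fps_conv_radius c"
  shows "P (fps_const c)"
proof -
  obtain r where "0 < r" "ereal r \<le> fps_conv_radius c"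
    using assms by (rule ereal_pos_real_below)
  then show ?thesis
    using R_cases assms by (auto simp: conv_majorant_def form_majorant_def collapse_const)
qed

lemma majorant_X: "P fps_X"
proof -
  have "collapse fps_X = fps_X"
  proof (rule fps_ext)
    fix m
    have "fps_nth (collapse fps_X) m = (\<Sum>i\<le>m. if i = 1 then fps_nth 1 (m - 1) else 0)"
      unfolding collapse_nth by (intro sum.cong) auto
    then show "fps_nth (collapse fps_X) m = fps_nth fps_X m"
      by simp
  qed
  then show ?thesis
    using R_cases by (auto simp: conv_majorant_def form_majorant_def intro!: exI[of _ 1])
qed

lemma majorant_sum: "(\<And>i. i \<in> I \<Longrightarrow> P (u i)) \<Longrightarrow> P (sum u I)"
proof (induction I rule: infinite_finite_induct)
  case (insert x F)
  then show ?case by (simp add: majorant_add)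
qed (use majorant_const[of 0] in auto)

lemma majorant_deriv:
  assumes "\<And>n. fps_nth u n \<preceq> fps_deriv (fps_nth v n)" "0 \<preceq>\<preceq> u" "0 \<preceq>\<preceq> v" "P v"
  shows "P u"
proof -
  have "conv_majorant u" if "conv_majorant v"
    using that fps_conv_radius_mono[OF collapse_nonneg[OF assms(2)] collapse_deriv_le[OF assms(1,3)]]
      fps_conv_radius_deriv[of "collapse v"]
    by (auto simp: conv_majorant_def)
  moreover have "form_majorant u" if "form_majorant v"
    using that assms fps_conv_radius_mono fps_conv_radius_deriv unfolding form_majorant_def fps_le2_def
    by (metis fps_zero_nth order_trans)
  ultimately show ?thesis using R_cases assms(4) by auto
qed

lemma majorant_shift:
  assumes "0 \<preceq>\<preceq> u" "P u"
  shows "P (fps_shift 1 u)"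
proof -
  have "0 \<preceq>\<preceq> fps_shift 1 u"
    using assms(1) by (simp add: fps_le2_def)
  then have "conv_majorant (fps_shift 1 u)" if "conv_majorant u"
    using that fps_conv_radius_mono[OF collapse_nonneg collapse_shift_le[OF assms(1)]]
    by (auto simp: conv_majorant_def)
  moreover have "form_majorant (fps_shift 1 u)" if "form_majorant u"
    using that by (auto simp: form_majorant_def)
  ultimately show ?thesis using R_cases assms(2) by auto
qed

text \<open>In the convergent case, merging z with the other variables reduces this to the scalar
  geometric majorant. In the formal case one proceeds by orders in z: only b(0) multiplies the
  unknown coefficient of order n, so a common radius for g, b and 1 / (1 - b(0)) serves every
  n.\<close>

lemma majorant_geometric:
  assumes u: "u \<preceq>\<preceq> g + b * u" "0 \<preceq>\<preceq> u" and g: "P g" and b: "P b" "0 \<preceq>\<preceq> b"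
    and b0: "fps_nth (fps_nth b 0) 0 = 0"
  shows "P u"
proof -
  have "conv_majorant u" if gb: "conv_majorant g" "conv_majorant b"
  proof -
    have c0: "fps_nth (collapse b) 0 = 0"
      using b0 by (simp add: collapse_nth)
    have "collapse u \<preceq> collapse g * inverse (1 - collapse b)"
      using collapse_mono[OF u(1)] c0 collapse_nonneg[OF b(2)]
      by (intro fps_le_geometric) (simp_all add: collapse_add collapse_mult)
    then have "fps_conv_radius (collapse g * inverse (1 - collapse b)) \<le> fps_conv_radius (collapse u)"
      by (intro fps_conv_radius_mono collapse_nonneg u)
    moreover have "0 < fps_conv_radius (inverse (1 - collapse b))"
      using gb c0 by (intro fps_conv_radius_geometric_pos) (simp_all add: conv_majorant_def)
    ultimately show ?thesis
      using gb(1) fps_conv_radius_mult_pos[of "collapse g" "inverse (1 - collapse b)"]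
      unfolding conv_majorant_def by (meson less_le_trans)
  qed
  moreover have "form_majorant u" if gb: "form_majorant g" "form_majorant b"
  proof -
    let ?e = "inverse (1 - fps_nth b 0)"
    from gb obtain r where r: "r > 0" "\<And>n. ereal r \<le> fps_conv_radius (fps_nth g n)"
      "\<And>n. ereal r \<le> fps_conv_radius (fps_nth b n)"
      by (rule form_majorantE2) blast
    have "0 < fps_conv_radius (fps_nth b 0)"
      using r(1) r(3)[of 0] by (meson ereal_less(2) less_le_trans)
    then have "0 < fps_conv_radius ?e"
      using b0 by (intro fps_conv_radius_geometric_pos)
    then obtain r' where r': "0 < r'" "ereal r' \<le> fps_conv_radius ?e"
      by (rule ereal_pos_real_below)
    define s where "s = min r r'"
    have s: "s > 0" "ereal s \<le> ereal r" "ereal s \<le> fps_conv_radius ?e"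
      using r(1) r' by (auto simp: s_def intro: order_trans[OF _ r'(2)])
    have s': "ereal s \<le> fps_conv_radius (fps_nth g n)" "ereal s \<le> fps_conv_radius (fps_nth b n)" for n
      using r(2,3)[of n] s(2) by (blast intro: order_trans)+
    have "ereal s \<le> fps_conv_radius (fps_nth u n)" for n
    proof (induction n rule: less_induct)
      case (less n)
      let ?g = "fps_nth g n + (\<Sum>i\<in>{1..n}. fps_nth b i * fps_nth u (n - i))"
      have "(\<Sum>i=0..n. fps_nth b i * fps_nth u (n - i)) =
          fps_nth b 0 * fps_nth u n + (\<Sum>i\<in>{1..n}. fps_nth b i * fps_nth u (n - i))"
        by (simp add: sum.atLeast_Suc_atMost)
      moreover have "fps_nth u n \<preceq> fps_nth (g + b * u) n"
        using u(1) by (simp only: fps_le2_def)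
      ultimately have "fps_nth u n \<preceq> ?g + fps_nth b 0 * fps_nth u n"
        by (simp add: fps_mult_nth algebra_simps)
      moreover have "0 \<preceq> fps_nth b 0"
        using b(2) by (simp add: fps_le2_def)
      ultimately have "fps_nth u n \<preceq> ?g * ?e"
        using b0 by (intro fps_le_geometric)
      then have "fps_conv_radius (?g * ?e) \<le> fps_conv_radius (fps_nth u n)"
        using u(2) by (intro fps_conv_radius_mono) (simp_all add: fps_le2_def)
      moreover have "ereal s \<le> fps_conv_radius (?g * ?e)"
        using less s s' by (intro fps_conv_radius_mult_ge fps_conv_radius_add_ge fps_conv_radius_sum_ge) auto
      ultimately show ?case by (rule order_trans[rotated])
    qed
    with s(1) show ?thesis by (auto simp: form_majorant_def)
  qed
  ultimately show ?thesis using R_cases g b by auto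
qed

lemma mem_add: "a \<in> R \<Longrightarrow> b \<in> R \<Longrightarrow> a + b \<in> R"
  unfolding mem_iff using majorant_mono[OF maj3_nonneg maj3_add] majorant_add by blast

lemma mem_mult: "a \<in> R \<Longrightarrow> b \<in> R \<Longrightarrow> a * b \<in> R"
  unfolding mem_iff using majorant_mono[OF maj3_nonneg maj3_mult] majorant_mult by blast

lemma mem_uminus: "a \<in> R \<Longrightarrow> - a \<in> R"
  by (simp add: mem_iff maj3_uminus)

lemma mem_diff: "a \<in> R \<Longrightarrow> b \<in> R \<Longrightarrow> a - b \<in> R"
  using mem_add[of a "- b"] mem_uminus[of b] by simp

lemma mem_const: "c \<in> Conv_t \<Longrightarrow> fps_const c \<in> R"
  by (simp add: mem_iff maj3_const majorant_const Conv_t_iff)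

lemma mem_const2: "0 < fps_conv_radius c \<Longrightarrow> fps_const (fps_const c) \<in> R"
  by (intro mem_const) (simp add: Conv_t_iff maj2_const maj1_def)

lemma mem_0: "0 \<in> R" and mem_1: "1 \<in> R"
  using mem_const2[of 0] mem_const2[of 1] by simp_all

lemma mem_z: "z \<in> R"
proof -
  have "maj3 z = fps_X"
  proof (rule fps_ext)
    fix n
    have "maj2 1 = 1"
      using maj2_const[of 1] maj1_const[of 1] by simp
    then show "fps_nth (maj3 z) n = fps_nth fps_X n"
      by (cases "n = 1") (simp_all add: maj3_nth)
  qed
  then show ?thesis by (simp add: mem_iff majorant_X)
qed

lemma mem_shift: "a \<in> R \<Longrightarrow> fps_shift 1 a \<in> R"
proof -
  have "maj3 (fps_shift 1 a) = fps_shift 1 (maj3 a)"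
    by (rule fps_ext) (simp add: maj3_nth)
  then show "a \<in> R \<Longrightarrow> fps_shift 1 a \<in> R"
    by (metis mem_iff majorant_shift maj3_nonneg)
qed

lemma mem_d2: "a \<in> R \<Longrightarrow> d2 a \<in> R"
  unfolding mem_iff
proof (rule majorant_deriv[OF _ maj3_nonneg maj3_nonneg])
  fix n
  show "fps_nth (maj3 (d2 a)) n \<preceq> fps_deriv (fps_nth (maj3 a) n)"
    unfolding maj3_nth maj2_def
  proof (rule collapse_deriv_le)
    fix i
    show "fps_nth (Abs_fps (\<lambda>i. maj1 (fps_nth (fps_nth (d2 a) n) i))) i \<preceq>
        fps_deriv (fps_nth (Abs_fps (\<lambda>i. maj1 (fps_nth (fps_nth a n) i))) i)"
      unfolding fps_le_def
    proof
      fix j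
      have "norm ((1 + of_nat j) * c) = (1 + real j) * norm c" for c :: complex
        using norm_mult[of "of_nat (Suc j)" c] norm_of_nat[of "Suc j", where 'a = complex] by simp
      then show "fps_nth (fps_nth (Abs_fps (\<lambda>i. maj1 (fps_nth (fps_nth (d2 a) n) i))) i) j \<le>
        fps_nth (fps_deriv (fps_nth (Abs_fps (\<lambda>i. maj1 (fps_nth (fps_nth a n) i))) i)) j"
        by (simp add: d2_def maj1_nth)
    qed
  qed (simp add: fps_le2_def maj1_nonneg)
qed

end

section \<open>Linear systems: formal solutions and their convergence\<close>

lemma norm_nth_le_maj3: "norm (fps_nth (fps_nth (fps_nth a n) i) j) \<le> fps_nth (fps_nth (maj3 a) n) (i + j)"
proof -
  have "norm (fps_nth (fps_nth (fps_nth a n) i) (i + j - i)) \<le>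
      (\<Sum>k\<le>i + j. norm (fps_nth (fps_nth (fps_nth a n) k) (i + j - k)))"
    by (rule member_le_sum) auto
  then show ?thesis by (simp add: maj3_nth maj2_nth)
qed

text \<open>\<open>J\<close> is later an integration with \<open>x\<close> the merged variable, or
  the identity with \<open>x = 1\<close>. Adding up all components replaces the matrix by one scalar
  majorant, which is enough for the geometric bound.\<close>

lemma maj3_linear_le:
  fixes B :: "ser_tz^'n^'n"
  assumes J: "\<And>a. maj3 (J a) \<preceq>\<preceq> x * maj3 a" and x: "0 \<preceq>\<preceq> x"
  shows "(\<Sum>i\<in>UNIV. maj3 (J (\<Sum>j\<in>UNIV. B $ i $ j * v j))) \<preceq>\<preceq>
    x * (\<Sum>i\<in>UNIV. \<Sum>j\<in>UNIV. maj3 (B $ i $ j)) * (\<Sum>j\<in>UNIV. maj3 (v j))"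
proof -
  let ?w = "\<Sum>j\<in>UNIV. maj3 (v j)"
  have le: "maj3 (v j) \<preceq>\<preceq> ?w" for j
    by (rule fps_le2_member_sum) (rule maj3_nonneg)
  have "maj3 (J (\<Sum>j\<in>UNIV. B $ i $ j * v j)) \<preceq>\<preceq> x * ((\<Sum>j\<in>UNIV. maj3 (B $ i $ j)) * ?w)" for i
  proof -
    have "maj3 (J (\<Sum>j\<in>UNIV. B $ i $ j * v j)) \<preceq>\<preceq> x * maj3 (\<Sum>j\<in>UNIV. B $ i $ j * v j)"
      by (rule J)
    also have "\<dots> \<preceq>\<preceq> x * (\<Sum>j\<in>UNIV. maj3 (B $ i $ j * v j))"
      by (intro fps_le2_mult x maj3_nonneg maj3_sum fps_le2_refl)
    also have "\<dots> \<preceq>\<preceq> x * (\<Sum>j\<in>UNIV. maj3 (B $ i $ j) * maj3 (v j))"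
      by (intro fps_le2_mult x fps_nonneg2_sum maj3_nonneg fps_le2_sum maj3_mult fps_le2_refl)
    also have "\<dots> \<preceq>\<preceq> x * (\<Sum>j\<in>UNIV. maj3 (B $ i $ j) * ?w)"
      by (intro fps_le2_mult x fps_nonneg2_sum fps_nonneg2_mult maj3_nonneg fps_le2_sum le fps_le2_refl)
    finally show ?thesis by (simp add: sum_distrib_right)
  qed
  then have "(\<Sum>i\<in>UNIV. maj3 (J (\<Sum>j\<in>UNIV. B $ i $ j * v j))) \<preceq>\<preceq>
      (\<Sum>i\<in>UNIV. x * ((\<Sum>j\<in>UNIV. maj3 (B $ i $ j)) * ?w))"
    by (intro fps_le2_sum)
  moreover have "(\<Sum>i\<in>UNIV. x * (S i * w)) = x * (\<Sum>i\<in>UNIV. S i) * w" for S :: "'n \<Rightarrow> real fps fps" and w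
    by (simp add: sum_distrib_left sum_distrib_right mult.assoc)
  ultimately show ?thesis by simp
qed

text \<open>Well-founded recursion in fixed-point form: an operator on whole families is admissible
  if its value at an index looks only at smaller degrees.\<close>

lemma graded_fixpoint:
  fixes F :: "('i \<Rightarrow> 'b) \<Rightarrow> 'i \<Rightarrow> 'b" and deg :: "'i \<Rightarrow> nat"
  assumes "\<And>x y i. (\<And>j. deg j < deg i \<Longrightarrow> x j = y j) \<Longrightarrow> F x i = F y i"
  shows "\<exists>x. x = F x"
proof -
  have "adm_wf (Wellfounded.measure deg) F"
    unfolding adm_wf_def by (intro allI impI, rule assms) simp
  from wfrec_fixpoint[OF wf_measure this] show ?thesis
    by (rule exI[where P = "\<lambda>x. x = F x"])
qed

text \<open>The majorant estimate itself shows that the recursion is well founded: the scalar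
  majorant has no constant term, so two candidates that agree below a total degree have images under
  \<open>K\<close> that agree in that degree too.\<close>

lemma linear_system_formal_solution:
  fixes B :: "ser_tz^'n^'n" and g :: "'n \<Rightarrow> ser_tz"
  assumes J: "\<And>a. maj3 (J a) \<preceq>\<preceq> x * maj3 a" and x: "0 \<preceq>\<preceq> x"
    and J_diff: "\<And>a b. J (a - b) = J a - J b"
    and x0: "fps_nth (fps_nth (x * (\<Sum>i\<in>UNIV. \<Sum>j\<in>UNIV. maj3 (B $ i $ j))) 0) 0 = 0"
  shows "\<exists>v. \<forall>i. v i = g i + J (\<Sum>j\<in>UNIV. B $ i $ j * v j)"
proof -
  define V :: "('n \<times> nat \<times> nat \<times> nat \<Rightarrow> complex) \<Rightarrow> 'n \<Rightarrow> ser_tz" where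
    "V y i = Abs_fps (\<lambda>n. Abs_fps (\<lambda>k. Abs_fps (\<lambda>l. y (i, n, k, l))))" for y i
  define K where "K v i = J (\<Sum>j\<in>UNIV. B $ i $ j * v j)" for v i
  define F where "F y = (\<lambda>(i, n, k, l). fps_nth (fps_nth (fps_nth (g i + K (V y) i) n) k) l)" for y
  let ?b = "x * (\<Sum>i\<in>UNIV. \<Sum>j\<in>UNIV. maj3 (B $ i $ j))"
  have "\<exists>y. y = F y"
  proof (rule graded_fixpoint[of "\<lambda>(i, n, k, l). n + k + l :: nat"])
    fix y y' :: "'n \<times> nat \<times> nat \<times> nat \<Rightarrow> complex" and q :: "'n \<times> nat \<times> nat \<times> nat"
    obtain i n k l where q: "q = (i, n, k, l)" by (cases q) auto
    assume "\<And>q'. (\<lambda>(i, n, k, l). n + k + l) q' < (\<lambda>(i, n, k, l). n + k + l) q \<Longrightarrow> y q' = y' q'"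
    then have eq: "y (i', n', k', l') = y' (i', n', k', l')" if "n' + k' + l' < n + k + l" for i' n' k' l'
      using that by (auto simp: q)
    define w where "w j = V y j - V y' j" for j
    let ?w = "\<Sum>j\<in>UNIV. maj3 (w j)"
    have w: "fps_nth (fps_nth ?w n') m = 0" if "n' + m < n + (k + l)" for n' m
      unfolding fps_sum_nth maj3_nth maj2_nth
      using that by (auto simp: w_def V_def eq intro!: sum.neutral)
    have bw: "fps_nth (fps_nth (?b * ?w) n) (k + l) = 0"
    proof -
      have "fps_nth (fps_nth (?b * ?w) n) (k + l) =
          (\<Sum>a=0..n. \<Sum>c=0..k + l. fps_nth (fps_nth ?b a) c * fps_nth (fps_nth ?w (n - a)) (k + l - c))"
        by (simp only: fps_mult_nth[of ?b ?w] fps_sum_nth[of _ "{0..n}"] fps_mult_nth[of "fps_nth _ _" "fps_nth ?w _"])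
      also have "\<dots> = 0"
      proof (intro sum.neutral ballI)
        fix a c assume ac: "a \<in> {0..n}" "c \<in> {0..k + l}"
        show "fps_nth (fps_nth ?b a) c * fps_nth (fps_nth ?w (n - a)) (k + l - c) = 0"
        proof (cases "a = 0 \<and> c = 0")
          case False
          then have "n - a + (k + l - c) < n + (k + l)" using ac by auto
          from w[OF this] show ?thesis by simp
        qed (use x0 in simp)
      qed
      finally show ?thesis .
    qed
    have K_diff: "K (V y) i - K (V y') i = K w i"
      by (simp add: K_def w_def J_diff[symmetric] right_diff_distrib sum_subtractf)
    have "maj3 (K w i) \<preceq>\<preceq> (\<Sum>i\<in>UNIV. maj3 (K w i))"
      by (rule fps_le2_member_sum) (rule maj3_nonneg)
    also have "\<dots> \<preceq>\<preceq> ?b * ?w"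
      unfolding K_def by (rule maj3_linear_le[OF J x])
    finally have "fps_nth (fps_nth (maj3 (K w i)) n) (k + l) \<le> 0"
      using bw by (metis fps_le2_def fps_le_def)
    with norm_nth_le_maj3[of "K w i" n k l] have "fps_nth (fps_nth (fps_nth (K w i) n) k) l = 0"
      by (meson norm_le_zero_iff order_trans)
    then show "F y q = F y' q"
      unfolding F_def q K_diff[symmetric] by simp
  qed
  then obtain y where y: "y = F y" by blast
  have "V y i = g i + K (V y) i" for i
  proof (intro fps_ext)
    fix n k l
    have "fps_nth (fps_nth (fps_nth (V y i) n) k) l = F y (i, n, k, l)"
      by (simp add: V_def flip: y)
    then show "fps_nth (fps_nth (fps_nth (V y i) n) k) l = fps_nth (fps_nth (fps_nth (g i + K (V y) i) n) k) l"
      by (simp add: F_def)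
  qed
  then show ?thesis unfolding K_def by blast
qed

context germ_ring
begin

lemma linear_system_solution:
  fixes B :: "ser_tz^'n^'n" and g :: "'n \<Rightarrow> ser_tz"
  assumes J: "\<And>a. maj3 (J a) \<preceq>\<preceq> x * maj3 a" and x: "0 \<preceq>\<preceq> x" "P x"
    and J_diff: "\<And>a b. J (a - b) = J a - J b"
    and x0: "fps_nth (fps_nth (x * (\<Sum>i\<in>UNIV. \<Sum>j\<in>UNIV. maj3 (B $ i $ j))) 0) 0 = 0"
    and B: "\<And>i j. B $ i $ j \<in> R" and g: "\<And>i. g i \<in> R"
  shows "\<exists>v. \<forall>i. v i \<in> R \<and> v i = g i + J (\<Sum>j\<in>UNIV. B $ i $ j * v j)"
proof -
  obtain v where v: "\<And>i. v i = g i + J (\<Sum>j\<in>UNIV. B $ i $ j * v j)"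
    using linear_system_formal_solution[OF J x(1) J_diff x0] by blast
  let ?b = "x * (\<Sum>i\<in>UNIV. \<Sum>j\<in>UNIV. maj3 (B $ i $ j))"
  let ?w = "\<Sum>j\<in>UNIV. maj3 (v j)"
  have "?w \<preceq>\<preceq> (\<Sum>i\<in>UNIV. maj3 (g i) + maj3 (J (\<Sum>j\<in>UNIV. B $ i $ j * v j)))"
  proof (rule fps_le2_sum)
    fix i
    show "maj3 (v i) \<preceq>\<preceq> maj3 (g i) + maj3 (J (\<Sum>j\<in>UNIV. B $ i $ j * v j))"
      using maj3_add[of "g i" "J (\<Sum>j\<in>UNIV. B $ i $ j * v j)"] by (simp only: v[symmetric])
  qed
  also have "\<dots> \<preceq>\<preceq> (\<Sum>i\<in>UNIV. maj3 (g i)) + ?b * ?w"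
    unfolding sum.distrib by (intro fps_le2_add fps_le2_refl maj3_linear_le J x)
  finally have "?w \<preceq>\<preceq> (\<Sum>i\<in>UNIV. maj3 (g i)) + ?b * ?w" .
  then have "P ?w"
  proof (rule majorant_geometric[OF _ _ _ _ _ x0])
    show "0 \<preceq>\<preceq> ?w" "0 \<preceq>\<preceq> ?b"
      by (intro fps_nonneg2_mult fps_nonneg2_sum maj3_nonneg x)+
    show "P (\<Sum>i\<in>UNIV. maj3 (g i))" "P ?b"
      by (intro majorant_mult majorant_sum x B[unfolded mem_iff] g[unfolded mem_iff])+
  qed
  moreover have "maj3 (v j) \<preceq>\<preceq> ?w" for j
    by (rule fps_le2_member_sum) (rule maj3_nonneg)
  ultimately have "v j \<in> R" for j
    unfolding mem_iff by (meson majorant_mono maj3_nonneg)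
  with v show ?thesis by blast
qed

text \<open>A system of size one with \<open>J\<close> the identity: \<open>C\<close> inverts the
  constant term of a, so 1 - C a has none and v = C + (1 - C a) v is solvable. This says C a v = C
  with C a nonzero element of a domain.\<close>

lemma inverse_exists:
  assumes a: "a \<in> R" and a0: "fps_nth (fps_nth (fps_nth a 0) 0) 0 \<noteq> 0"
  shows "\<exists>b\<in>R. a * b = 1"
proof -
  define c where "c = inverse (fps_nth (fps_nth (fps_nth a 0) 0) 0)"
  define C where "C = fps_const (fps_const (fps_const c))"
  have C: "C \<in> R"
    unfolding C_def by (intro mem_const2) simp
  let ?y = "1 - C * a"
  have y: "?y \<in> R"
    using a C by (intro mem_diff mem_mult mem_1)
  have y0: "fps_nth (fps_nth (maj3 ?y) 0) 0 = 0"
    using a0 by (simp add: maj3_nth maj2_nth C_def c_def)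
  have "\<exists>v. \<forall>i::1. v i \<in> R \<and> v i = C + (\<Sum>j\<in>UNIV. ((\<chi> i j. ?y) :: ser_tz^1^1) $ i $ j * v j)"
    using y y0 C by (intro linear_system_solution[of "\<lambda>a. a" 1])
      (auto simp: fps_le2_def fps_le_def majorant_const[of 1, simplified] split: if_splits)
  then obtain w where w: "\<And>i::1. w i \<in> R \<and> w i = C + (\<Sum>j\<in>UNIV. ((\<chi> i j. ?y) :: ser_tz^1^1) $ i $ j * w j)"
    by blast
  define v where "v = w 1"
  have "(\<Sum>j\<in>UNIV. ((\<chi> i j. ?y) :: ser_tz^1^1) $ 1 $ j * w j) = ?y * v"
    by (simp add: UNIV_1 v_def)
  with w[of 1] have v: "v \<in> R" "v = C + ?y * v"
    by (simp_all only: v_def)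
  have "C * (a * v) = v - ?y * v"
    by (simp add: algebra_simps)
  also have "\<dots> = C * 1"
    by (subst (1) v(2)) simp
  finally have "C * (a * v) = C * 1" .
  moreover have "C \<noteq> 0"
    using a0 by (simp add: C_def c_def)
  ultimately have "a * v = 1"
    by (metis mult_left_cancel)
  with v show ?thesis by blast
qed

end


section \<open>Derivations, and series independent of t_1\<close>

definition fps_map :: "('a \<Rightarrow> 'b) \<Rightarrow> 'a fps \<Rightarrow> 'b fps" where
  "fps_map h a = Abs_fps (\<lambda>n. h (fps_nth a n))"

lemma fps_map_nth [simp]: "fps_nth (fps_map h a) n = h (fps_nth a n)"
  by (simp add: fps_map_def)

lemma additive_sum:
  fixes h :: "'a::comm_monoid_add \<Rightarrow> 'b::comm_monoid_add"
  assumes "\<And>a b. h (a + b) = h a + h b" "h 0 = 0"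
  shows "h (sum f I) = (\<Sum>i\<in>I. h (f i))"
  by (induction I rule: infinite_finite_induct) (simp_all add: assms)

lemma fps_map_mult_hom:
  fixes h :: "'a::comm_ring_1 \<Rightarrow> 'b::comm_ring_1"
  assumes "\<And>a b. h (a + b) = h a + h b" "h 0 = 0" "\<And>a b. h (a * b) = h a * h b"
  shows "fps_map h (a * b) = fps_map h a * fps_map h b"
  by (rule fps_ext) (simp add: fps_mult_nth additive_sum[of h, OF assms(1,2)] assms(3))

lemma fps_map_mult_derivation:
  fixes h :: "'a::comm_ring_1 \<Rightarrow> 'a"
  assumes "\<And>a b. h (a + b) = h a + h b" "h 0 = 0" "\<And>a b. h (a * b) = h a * b + a * h b"
  shows "fps_map h (a * b) = fps_map h a * b + a * fps_map h b"
  by (rule fps_ext) (simp add: fps_mult_nth additive_sum[of h, OF assms(1,2)] assms(3) sum.distrib)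

lemma fps_map_X:
  fixes h :: "'a::comm_ring_1 \<Rightarrow> 'b::comm_ring_1"
  assumes "h 0 = 0" "h 1 = 1"
  shows "fps_map h fps_X = fps_X"
  by (rule fps_ext) (simp add: assms)

definition D :: "ser_t2z \<Rightarrow> ser_t2z" where
  "D = fps_map fps_deriv"

text \<open>Evaluation at t_1 = 0, a ring homomorphism and left inverse of
  \<open>of_t2z\<close>.\<close>

definition to_t2z :: "ser_tz \<Rightarrow> ser_t2z" where
  "to_t2z = fps_map (\<lambda>a. fps_nth a 0)"

lemma d1_map: "d1 = fps_map fps_deriv"
  by (rule ext) (simp add: d1_def fps_map_def)

lemma d2_map: "d2 = fps_map (fps_map fps_deriv)"
  by (rule ext) (simp add: d2_def fps_map_def)

lemma of_t2z_map: "of_t2z = fps_map fps_const"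
  by (rule ext) (simp add: of_t2z_def fps_map_def)

lemma D_nth [simp]: "fps_nth (D a) n = fps_deriv (fps_nth a n)"
  by (simp add: D_def)

lemma D_add: "D (a + b) = D a + D b" and D_diff: "D (a - b) = D a - D b"
  and D_uminus: "D (- a) = - D a" and D_0: "D 0 = 0" and D_1: "D 1 = 0"
  by (rule fps_ext; simp)+

lemma D_mult: "D (a * b) = D a * b + a * D b"
  unfolding D_def by (intro fps_map_mult_derivation) (simp_all add: algebra_simps)

lemma D_X: "D fps_X = 0"
  by (rule fps_ext) simp

lemma D_X_mult: "D (fps_X * a) = fps_X * D a"
  by (simp add: D_mult D_X)

lemma d1_add: "d1 (a + b) = d1 a + d1 b" and d1_diff: "d1 (a - b) = d1 a - d1 b"
  and d1_0: "d1 0 = 0"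
  by (rule fps_ext; simp add: d1_def)+

lemma d1_mult: "d1 (a * b) = d1 a * b + a * d1 b"
  unfolding d1_map by (intro fps_map_mult_derivation) (simp_all add: algebra_simps)

lemma d2_add: "d2 (a + b) = d2 a + d2 b" and d2_diff: "d2 (a - b) = d2 a - d2 b"
  and d2_0: "d2 0 = 0"
  by (intro fps_ext; simp add: d2_def algebra_simps)+

lemma d2_mult: "d2 (a * b) = d2 a * b + a * d2 b"
  unfolding d2_map
proof (rule fps_map_mult_derivation)
  fix a b :: ser_t
  show "fps_map fps_deriv (a * b) = fps_map fps_deriv a * b + a * fps_map fps_deriv b"
    by (intro fps_map_mult_derivation) (simp_all add: algebra_simps)
qed (intro fps_ext; simp add: algebra_simps)+

lemma d1_d2_commute: "d1 (d2 a) = d2 (d1 a)"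
  by (intro fps_ext) (simp add: d1_def d2_def algebra_simps)

lemma of_t2z_add: "of_t2z (a + b) = of_t2z a + of_t2z b"
  and of_t2z_diff: "of_t2z (a - b) = of_t2z a - of_t2z b"
  and of_t2z_uminus: "of_t2z (- a) = - of_t2z a"
  and of_t2z_0: "of_t2z 0 = 0"
  by (rule fps_ext; simp add: of_t2z_def)+

lemma of_t2z_1: "of_t2z 1 = 1"
  by (rule fps_ext) (simp add: of_t2z_def)

lemma of_t2z_mult: "of_t2z (a * b) = of_t2z a * of_t2z b"
  unfolding of_t2z_map by (intro fps_map_mult_hom) simp_all

lemma of_t2z_X: "of_t2z fps_X = z"
  unfolding of_t2z_map by (intro fps_map_X) simp_all

lemma of_t2z_const: "of_t2z (fps_const g) = of_t2 g"
  by (rule fps_ext) (simp add: of_t2z_def of_t2_def)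

lemma to_t2z_add: "to_t2z (a + b) = to_t2z a + to_t2z b"
  and to_t2z_0: "to_t2z 0 = 0"
  by (rule fps_ext; simp add: to_t2z_def)+

lemma to_t2z_mult: "to_t2z (a * b) = to_t2z a * to_t2z b"
  unfolding to_t2z_def by (intro fps_map_mult_hom) simp_all

lemma to_t2z_sum: "to_t2z (sum f I) = (\<Sum>i\<in>I. to_t2z (f i))"
  by (rule additive_sum) (simp_all add: to_t2z_add to_t2z_0)

lemma to_of_t2z [simp]: "to_t2z (of_t2z f) = f"
  by (rule fps_ext) (simp add: to_t2z_def of_t2z_def)

lemma of_t2z_eq_iff: "of_t2z f = of_t2z g \<longleftrightarrow> f = g"
  by (metis to_of_t2z)

lemma to_t2z_d2: "to_t2z (d2 a) = D (to_t2z a)"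
  by (intro fps_ext) (simp add: to_t2z_def d2_def)

lemma d2_of_t2z: "d2 (of_t2z f) = of_t2z (D f)"
proof -
  have "fps_map fps_deriv (fps_const c) = fps_const (fps_deriv c)" for c :: ser_t2
    by (rule fps_ext) simp
  then show ?thesis
    unfolding d2_map of_t2z_map by (intro fps_ext) simp
qed

lemma d1_of_t2z: "d1 (of_t2z f) = 0"
  by (rule fps_ext) (simp add: d1_def of_t2z_def)

lemma of_t2z_to_t2z:
  assumes "d1 a = 0"
  shows "of_t2z (to_t2z a) = a"
proof (rule fps_ext)
  fix n
  have "fps_deriv (fps_nth a n) = fps_nth (d1 a) n"
    by (simp add: d1_def)
  then have "fps_nth a n = fps_const (fps_nth (fps_nth a n) 0)"
    unfolding assms fps_zero_nth fps_deriv_eq_0_iff .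
  then show "fps_nth (of_t2z (to_t2z a)) n = fps_nth a n"
    by (simp add: of_t2z_def to_t2z_def)
qed

subsection \<open>Integration and linear differential equations\<close>

definition J1 :: "ser_tz \<Rightarrow> ser_tz" where
  "J1 a = Abs_fps (\<lambda>n. Abs_fps (\<lambda>i.
     if i = 0 then 0 else fps_const (1 / of_nat i) * fps_nth (fps_nth a n) (i - 1)))"

definition J2 :: "ser_tz \<Rightarrow> ser_tz" where
  "J2 a = Abs_fps (\<lambda>n. Abs_fps (\<lambda>i. Abs_fps (\<lambda>j.
     if j = 0 then 0 else fps_nth (fps_nth (fps_nth a n) i) (j - 1) / of_nat j)))"

lemma J1_diff: "J1 (a - b) = J1 a - J1 b"
  by (intro fps_ext) (simp add: J1_def algebra_simps)

lemma J2_diff: "J2 (a - b) = J2 a - J2 b"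
  by (intro fps_ext) (simp add: J2_def diff_divide_distrib)

lemma d1_J1: "d1 (J1 a) = a"
proof (intro fps_ext)
  fix n i j
  have "(1 + of_nat i :: ser_t2) = fps_const (1 + of_nat i)"
    by (simp add: fps_of_nat flip: fps_const_add)
  moreover have "(1 + of_nat i :: complex) \<noteq> 0"
    by (metis of_nat_Suc of_nat_eq_0_iff nat.distinct(1))
  ultimately have "(1 + of_nat i :: ser_t2) * fps_const (1 / (1 + of_nat i)) = 1"
    by simp
  then have "(1 + of_nat i) * (fps_const (1 / (1 + of_nat i)) * fps_nth (fps_nth a n) i) = fps_nth (fps_nth a n) i"
    by (simp only: mult.assoc[symmetric] mult_1_left)
  moreover have "fps_nth (fps_nth (d1 (J1 a)) n) i =
      (1 + of_nat i) * (fps_const (1 / (1 + of_nat i)) * fps_nth (fps_nth a n) i)"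
    by (simp add: d1_def J1_def)
  ultimately show "fps_nth (fps_nth (fps_nth (d1 (J1 a)) n) i) j = fps_nth (fps_nth (fps_nth a n) i) j"
    by (simp only:)
qed

lemma d2_J2: "d2 (J2 a) = a"
proof (intro fps_ext)
  fix n i j
  have "(1 + of_nat j :: complex) \<noteq> 0"
    by (metis of_nat_Suc of_nat_eq_0_iff nat.distinct(1))
  then show "fps_nth (fps_nth (fps_nth (d2 (J2 a)) n) i) j = fps_nth (fps_nth (fps_nth a n) i) j"
    by (simp add: d2_def J2_def)
qed

lemma to_t2z_J1: "to_t2z (J1 a) = 0"
  by (rule fps_ext) (simp add: to_t2z_def J1_def)

text \<open>Integration raises the degree by one and divides by an integer of at least 1, so its
  majorant is at most the merged variable times the old one. The hypothesis is put in terms of total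
  degree because \<open>J1\<close> and \<open>J2\<close> differ only in the index that they
  shift.\<close>

lemma maj3_le_X_mult:
  assumes "\<And>n m. (\<Sum>i\<le>m. norm (fps_nth (fps_nth (fps_nth b n) i) (m - i))) \<le>
    (if m = 0 then 0 else \<Sum>i\<le>m - 1. norm (fps_nth (fps_nth (fps_nth a n) i) (m - 1 - i)))"
  shows "maj3 b \<preceq>\<preceq> fps_const fps_X * maj3 a"
  unfolding fps_le2_def fps_le_def
proof (intro allI)
  fix n m
  show "fps_nth (fps_nth (maj3 b) n) m \<le> fps_nth (fps_nth (fps_const fps_X * maj3 a) n) m"
    using assms[of n m] by (cases m) (simp_all add: maj3_nth maj2_nth)
qed

lemma divide_of_nat_le: "0 \<le> (x :: real) \<Longrightarrow> x / (1 + real i) \<le> x"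
  by (simp add: divide_le_eq mult_le_cancel_left1)

lemma norm_Suc_complex: "norm (1 + of_nat i :: complex) = 1 + real i"
  using norm_of_nat[of "Suc i", where 'a = complex] by simp

lemma maj3_J1: "maj3 (J1 a) \<preceq>\<preceq> fps_const fps_X * maj3 a"
proof (rule maj3_le_X_mult)
  fix n m
  show "(\<Sum>i\<le>m. norm (fps_nth (fps_nth (fps_nth (J1 a) n) i) (m - i))) \<le>
    (if m = 0 then 0 else \<Sum>i\<le>m - 1. norm (fps_nth (fps_nth (fps_nth a n) i) (m - 1 - i)))"
  proof (cases m)
    case (Suc k)
    show ?thesis
      unfolding Suc sum.atMost_Suc_shift
      by (auto simp: J1_def norm_divide norm_mult norm_Suc_complex intro!: sum_mono divide_of_nat_le)
  qed (simp add: J1_def)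
qed

lemma X_majorant_nonneg: "0 \<preceq>\<preceq> fps_const fps_X"
  by (simp add: fps_le2_def fps_le_def)

lemma maj3_J2: "maj3 (J2 a) \<preceq>\<preceq> fps_const fps_X * maj3 a"
proof (rule maj3_le_X_mult)
  fix n m
  show "(\<Sum>i\<le>m. norm (fps_nth (fps_nth (fps_nth (J2 a) n) i) (m - i))) \<le>
    (if m = 0 then 0 else \<Sum>i\<le>m - 1. norm (fps_nth (fps_nth (fps_nth a n) i) (m - 1 - i)))"
  proof (cases m)
    case (Suc k)
    show ?thesis
      unfolding Suc sum.atMost_Suc
      by (auto simp: J2_def Suc_diff_le norm_divide norm_Suc_complex simp del: of_nat_diff intro!: sum_mono divide_of_nat_le)
  qed (simp add: J2_def)
qed

context germ_ring
begin

text \<open>Taken as a preimage so that closure properties are inherited from \<open>R\<close>; in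
  the two cases it is \<open>Conv_t2z\<close> and \<open>Form_t2z\<close>.\<close>

definition R2 :: "ser_t2z set" where
  "R2 = {f. of_t2z f \<in> R}"

lemma R2_iff: "f \<in> R2 \<longleftrightarrow> of_t2z f \<in> R"
  by (simp add: R2_def)

lemma R2_add: "a \<in> R2 \<Longrightarrow> b \<in> R2 \<Longrightarrow> a + b \<in> R2"
  and R2_diff: "a \<in> R2 \<Longrightarrow> b \<in> R2 \<Longrightarrow> a - b \<in> R2"
  and R2_mult: "a \<in> R2 \<Longrightarrow> b \<in> R2 \<Longrightarrow> a * b \<in> R2"
  and R2_uminus: "a \<in> R2 \<Longrightarrow> - a \<in> R2"
  and R2_0: "0 \<in> R2" and R2_1: "1 \<in> R2" and R2_X: "fps_X \<in> R2"
  by (simp_all add: R2_iff of_t2z_add of_t2z_diff of_t2z_mult of_t2z_uminus of_t2z_0 of_t2z_1 of_t2z_X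
      mem_add mem_diff mem_mult mem_uminus mem_0 mem_1 mem_z)

lemma R2_D: "a \<in> R2 \<Longrightarrow> D a \<in> R2"
  by (simp add: R2_iff mem_d2 flip: d2_of_t2z)

lemma R2_const: "0 < fps_conv_radius c \<Longrightarrow> fps_const c \<in> R2"
  by (simp add: R2_iff of_t2z_const of_t2_def mem_const2)

lemma R2_shift: "a \<in> R2 \<Longrightarrow> fps_shift 1 a \<in> R2"
proof -
  have "of_t2z (fps_shift 1 a) = fps_shift 1 (of_t2z a)"
    by (rule fps_ext) (simp add: of_t2z_def)
  then show "a \<in> R2 \<Longrightarrow> fps_shift 1 a \<in> R2"
    using mem_shift[of "of_t2z a"] by (simp add: R2_iff)
qed

lemma R2_to_t2z: "a \<in> R \<Longrightarrow> to_t2z a \<in> R2"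
proof -
  have "maj3 (of_t2z (to_t2z a)) \<preceq>\<preceq> maj3 a"
    by (simp add: maj1_le_maj2 fps_le2_def maj3_nth of_t2z_def to_t2z_def maj2_const)
  then show "a \<in> R \<Longrightarrow> to_t2z a \<in> R2"
    unfolding R2_iff mem_iff by (meson majorant_mono maj3_nonneg)
qed

lemma R2_inverse:
  assumes "a \<in> R2" "fps_nth (fps_nth a 0) 0 \<noteq> 0"
  shows "\<exists>b\<in>R2. a * b = 1"
proof -
  obtain b where b: "b \<in> R" "of_t2z a * b = 1"
    using inverse_exists[of "of_t2z a"] assms by (auto simp: R2_iff of_t2z_def)
  from arg_cong[OF b(2), of to_t2z] have "a * to_t2z b = to_t2z (of_t2z 1)"
    by (simp add: to_t2z_mult of_t2z_1)
  with b show ?thesis by (auto intro: R2_to_t2z)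
qed

lemma mem_at_z0:
  assumes "a \<in> R"
  shows "fps_nth a 0 \<in> Conv_t"
proof -
  have "fps_nth (maj3 a) 0 \<preceq> collapse (maj3 a)"
    unfolding fps_le_def
  proof
    fix m
    have "fps_nth (fps_nth (maj3 a) 0) (m - 0) \<le> (\<Sum>i\<le>m. fps_nth (fps_nth (maj3 a) i) (m - i))"
      by (rule member_le_sum) (auto simp: maj3_nth maj2_nth intro!: sum_nonneg)
    then show "fps_nth (fps_nth (maj3 a) 0) m \<le> fps_nth (collapse (maj3 a)) m"
      by (simp add: collapse_nth)
  qed
  then have "0 < fps_conv_radius (fps_nth (maj3 a) 0)" if "conv_majorant (maj3 a)"
    using that fps_conv_radius_mono[of "fps_nth (maj3 a) 0"]
    by (auto simp: conv_majorant_def maj3_nth maj2_nonneg intro: less_le_trans)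
  moreover have "0 < fps_conv_radius (fps_nth (maj3 a) 0)" if "form_majorant (maj3 a)"
    using that unfolding form_majorant_def by (meson ereal_less(2) less_le_trans)
  ultimately show ?thesis
    using R_cases assms unfolding mem_iff by (auto simp: Conv_t_iff maj3_nth)
qed

text \<open>Integrated, the equation is v = g + J1 (B v). The factor t contributed by
  \<open>J1\<close> makes the majorant of the operator vanish at the origin whatever
  \<open>B\<close> is, and z is a mere parameter.\<close>

lemma ode_t1:
  fixes B :: "ser_tz^'n^'n" and g :: "'n \<Rightarrow> ser_tz"
  assumes B: "\<And>i j. B $ i $ j \<in> R" and g: "\<And>i. g i \<in> R" "\<And>i. d1 (g i) = 0"
  shows "\<exists>v. \<forall>i. v i \<in> R \<and> d1 (v i) = (\<Sum>j\<in>UNIV. B $ i $ j * v j) \<and> to_t2z (v i) = to_t2z (g i)"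
proof -
  have "\<exists>v. \<forall>i. v i \<in> R \<and> v i = g i + J1 (\<Sum>j\<in>UNIV. B $ i $ j * v j)"
    by (rule linear_system_solution[OF maj3_J1 X_majorant_nonneg _ J1_diff])
      (simp_all add: B g majorant_const)
  then obtain v where v: "\<And>i. v i \<in> R" "\<And>i. v i = g i + J1 (\<Sum>j\<in>UNIV. B $ i $ j * v j)"
    by blast
  have "d1 (v i) = (\<Sum>j\<in>UNIV. B $ i $ j * v j)" for i
    using arg_cong[OF v(2)[of i], of d1] unfolding d1_add g(2) d1_J1 by simp
  moreover have "to_t2z (v i) = to_t2z (g i)" for i
    using arg_cong[OF v(2)[of i], of to_t2z] unfolding to_t2z_add to_t2z_J1 by simp
  ultimately show ?thesis using v(1) by blast
qed

text \<open>Solved with \<open>J2\<close> in the larger ring and then restricted to t_1 = 0, which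
  is compatible because \<open>B\<close> does not involve t_1.\<close>

lemma ode_t2:
  fixes B :: "ser_t2z^'n^'n" and c :: "'n \<Rightarrow> complex"
  assumes B: "\<And>i j. B $ i $ j \<in> R2"
  shows "\<exists>v. \<forall>i. v i \<in> R2 \<and> D (v i) = (\<Sum>j\<in>UNIV. B $ i $ j * v j) \<and> fps_nth (fps_nth (v i) 0) 0 = c i"
proof -
  let ?B = "\<chi> i j. of_t2z (B $ i $ j)" and ?g = "\<lambda>i. of_t2z (fps_const (fps_const (c i)))"
  have "\<exists>v. \<forall>i. v i \<in> R \<and> v i = ?g i + J2 (\<Sum>j\<in>UNIV. ?B $ i $ j * v j)"
  proof (rule linear_system_solution[OF maj3_J2 X_majorant_nonneg _ J2_diff])
    show "?g i \<in> R" for i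
      using R2_const[of "fps_const (c i)"] by (simp add: R2_iff)
  qed (use B in \<open>simp_all add: R2_iff majorant_const\<close>)
  then obtain v where v: "\<And>i. v i \<in> R" "\<And>i. v i = ?g i + J2 (\<Sum>j\<in>UNIV. ?B $ i $ j * v j)"
    by blast
  have "d2 (v i) = (\<Sum>j\<in>UNIV. ?B $ i $ j * v j)" for i
  proof -
    have "D (fps_const (fps_const (c i))) = 0"
      by (rule fps_ext) simp
    then show ?thesis
      using arg_cong[OF v(2)[of i], of d2] by (simp add: d2_add d2_J2 d2_of_t2z of_t2z_0)
  qed
  then have "D (to_t2z (v i)) = (\<Sum>j\<in>UNIV. B $ i $ j * to_t2z (v j))" for i
    by (simp add: to_t2z_mult to_t2z_sum flip: to_t2z_d2)
  moreover have "fps_nth (fps_nth (to_t2z (v i)) 0) 0 = c i" for i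
    using arg_cong[OF v(2)[of i], of "\<lambda>a. fps_nth (fps_nth (to_t2z a) 0) 0"]
    by (simp add: to_t2z_add) (simp add: to_t2z_def J2_def)
  ultimately show ?thesis using v(1) R2_to_t2z
    by (intro exI[of _ "\<lambda>i. to_t2z (v i)"]) blast
qed

end


subsection \<open>Two by two matrices\<close>

lemma mat2_eq_iff:
  fixes A B :: "'a^2^2"
  shows "A = B \<longleftrightarrow> A $ 1 $ 1 = B $ 1 $ 1 \<and> A $ 1 $ 2 = B $ 1 $ 2 \<and> A $ 2 $ 1 = B $ 2 $ 1 \<and> A $ 2 $ 2 = B $ 2 $ 2"
  by (auto simp: vec_eq_iff forall_2)

lemma mat2_mult_nth:
  fixes A B :: "'a::semiring_1^2^2"
  shows "(A ** B) $ i $ j = A $ i $ 1 * B $ 1 $ j + A $ i $ 2 * B $ 2 $ j"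
  by (simp add: matrix_matrix_mult_def sum_2)

lemma smult_mat_nth [simp]: "smult_mat c A $ i $ j = c * A $ i $ j"
  by (simp add: smult_mat_def)

lemma mat_nth: "mat c $ i $ j = (if i = j then c else 0)"
  by (simp add: mat_def)

lemma smult_mat_mult_left: "smult_mat c A ** B = smult_mat c (A ** B)"
  and smult_mat_mult_right: "A ** smult_mat c B = smult_mat c (A ** B)"
  and smult_mat_add: "smult_mat c (A + B) = smult_mat c A + smult_mat c B"
  and smult_mat_diff: "smult_mat c (A - B) = smult_mat c A - smult_mat c B"
  for A B :: "'a::comm_ring_1^2^2"
  by (simp_all add: mat2_eq_iff mat2_mult_nth algebra_simps)

lemma smult_mat_cancel: "c \<noteq> 0 \<Longrightarrow> smult_mat c A = smult_mat c B \<longleftrightarrow> A = B"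
  for c :: "'a::idom"
  by (simp add: mat2_eq_iff)

lemma mat2_add_mult: "(A + B) ** C = A ** C + B ** C"
  and mat2_diff_mult: "(A - B) ** C = A ** C - B ** C"
  and mat2_mult_add: "A ** (B + C) = A ** B + A ** C"
  and mat2_mult_diff: "A ** (B - C) = A ** B - A ** C"
  for A B C :: "'a::comm_ring_1^2^2"
  by (simp_all add: mat2_eq_iff mat2_mult_nth algebra_simps)

lemma map_matrix_mult_hom:
  fixes A B :: "'a::comm_ring_1^2^2" and h :: "'a \<Rightarrow> 'b::comm_ring_1"
  assumes "\<And>a b. h (a + b) = h a + h b" "\<And>a b. h (a * b) = h a * h b"
  shows "map_matrix h (A ** B) = map_matrix h A ** map_matrix h B"
  by (simp add: mat2_eq_iff mat2_mult_nth assms)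

lemma map_matrix_mult_derivation:
  fixes A B :: "'a::comm_ring_1^2^2" and h :: "'a \<Rightarrow> 'a"
  assumes "\<And>a b. h (a + b) = h a + h b" "\<And>a b. h (a * b) = h a * b + a * h b"
  shows "map_matrix h (A ** B) = map_matrix h A ** B + A ** map_matrix h B"
  by (simp add: mat2_eq_iff mat2_mult_nth assms algebra_simps)

lemma det_map_matrix:
  fixes A :: "'a::comm_ring_1^2^2" and h :: "'a \<Rightarrow> 'b::comm_ring_1"
  assumes "\<And>a b. h (a - b) = h a - h b" "\<And>a b. h (a * b) = h a * h b"
  shows "det (map_matrix h A) = h (det A)"
  by (simp add: det_2 assms)

lemma entries_in_iff:
  "entries_in R A \<longleftrightarrow> A $ 1 $ 1 \<in> R \<and> A $ 1 $ 2 \<in> R \<and> A $ 2 $ 1 \<in> R \<and> A $ 2 $ 2 \<in> R"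
  by (auto simp: entries_in_def forall_2)

lemma map_matrix_d1_mult: "map_matrix d1 (A ** B) = map_matrix d1 A ** B + A ** map_matrix d1 B"
  for A B :: "ser_tz^2^2"
  by (intro map_matrix_mult_derivation d1_add d1_mult)

lemma map_matrix_d2_mult: "map_matrix d2 (A ** B) = map_matrix d2 A ** B + A ** map_matrix d2 B"
  for A B :: "ser_tz^2^2"
  by (intro map_matrix_mult_derivation d2_add d2_mult)

section \<open>Companion matrices and the unfolding condition\<close>

definition const_coeff :: "ser_tz \<Rightarrow> complex" where
  "const_coeff a = fps_nth (fps_nth (fps_nth a 0) 0) 0"

definition companion :: "ser_t2z \<Rightarrow> ser_t2z^2^2" where
  "companion f = vector [vector [0, fps_X * f], vector [1, 0]]"

lemma companion_nth [simp]:
  "companion f $ 1 $ 1 = 0" "companion f $ 1 $ 2 = fps_X * f" "companion f $ 2 $ 1 = 1" "companion f $ 2 $ 2 = 0"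
  by (simp_all add: companion_def)

lemma star_eq: "star f = (mat 1, map_matrix of_t2z (companion f))"
  by (simp add: star_def C1_def C2_def E_def mat2_eq_iff of_t2z_mult of_t2z_X of_t2z_0 of_t2z_1)

lemma star_z1_eq: "star_z1 g = star (fps_const g)"
  by (simp add: star_z1_def star_def of_t2z_const)

lemma star_z2_eq: "star_z2 g = star (fps_X * fps_const g)"
  by (simp add: star_z2_def star_def of_t2z_const of_t2z_mult of_t2z_X power2_eq_square mult.assoc)

lemma at_z0_nth [simp]: "at_z0 A $ i $ j = fps_nth (A $ i $ j) 0"
  by (simp add: at_z0_def)

lemma at_z0_mult: "at_z0 (A ** B) = at_z0 A ** at_z0 B"
  unfolding at_z0_def by (intro map_matrix_mult_hom) simp_all

lemma at_z0_mat: "at_z0 (mat 1) = mat 1"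
  by (simp add: mat2_eq_iff mat_nth)

declare higgs.simps [simp del]

lemma higgs_mult_vec:
  "(higgs (A1, A2) X *v \<zeta>) $ i = X $ 1 * (at_z0 A1 *v \<zeta>) $ i + X $ 2 * (at_z0 A2 *v \<zeta>) $ i"
  by (simp add: higgs.simps matrix_vector_mult_def sum_2 algebra_simps)

lemma Conv_t_add: "a \<in> Conv_t \<Longrightarrow> b \<in> Conv_t \<Longrightarrow> a + b \<in> Conv_t"
  unfolding Conv_t_iff
  using fps_conv_radius_add_pos fps_conv_radius_mono[OF maj2_nonneg maj2_add] by (meson less_le_trans)

lemma Conv_t_mult: "a \<in> Conv_t \<Longrightarrow> b \<in> Conv_t \<Longrightarrow> a * b \<in> Conv_t"
  unfolding Conv_t_iff
  using fps_conv_radius_mult_pos fps_conv_radius_mono[OF maj2_nonneg maj2_mult] by (meson less_le_trans)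

lemma Conv_t_0: "0 \<in> Conv_t" and Conv_t_1: "1 \<in> Conv_t"
  using maj2_const[of 1] maj1_const[of 1] by (simp_all add: Conv_t_iff)

lemma Conv_t_fps_nth_0: "a \<in> Conv_t \<Longrightarrow> 0 < fps_conv_radius (fps_nth a 0)"
proof -
  from fps_conv_radius_mono[OF maj1_nonneg maj1_le_maj2[of a]]
  show "a \<in> Conv_t \<Longrightarrow> 0 < fps_conv_radius (fps_nth a 0)"
    by (auto simp: Conv_t_iff maj1_def)
qed

lemma sections_iff: "v \<in> sections \<longleftrightarrow> v $ 1 \<in> Conv_t \<and> v $ 2 \<in> Conv_t"
  by (simp add: sections_def forall_2)

text \<open>
  The unfolding condition makes the matrix with columns \<open>\<zeta>\<close> and \<open>A\<^sub>2(0) \<zeta>\<close> invertible; in the frame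
  that it defines the Higgs field of \<open>\<N>\<^sub>2\<close> is constant.
\<close>

lemma cyclic_frame:
  assumes "induces_mult (A1, A2) N2_mult N2_unit" "entries_in Conv_t (at_z0 A2)"
  obtains Z where "entries_in Conv_t Z" "fps_nth (fps_nth (det Z) 0) 0 \<noteq> 0" "at_z0 A1 = mat 1"
    "at_z0 A2 ** Z = Z ** at_z0 C2"
proof -
  define N1 N2 where "N1 = at_z0 A1" and "N2 = at_z0 A2"
  obtain \<zeta> where bij: "bij_betw (\<lambda>X. higgs (A1, A2) X *v \<zeta>) sections sections"
    and \<zeta>: "\<zeta> \<in> sections"
    and mult: "\<And>X Y. X \<in> sections \<Longrightarrow> Y \<in> sections \<Longrightarrow>
      higgs (A1, A2) (N2_mult X Y) *v \<zeta> = higgs (A1, A2) X *v (higgs (A1, A2) Y *v \<zeta>)"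
    and unit: "higgs (A1, A2) N2_unit *v \<zeta> = \<zeta>"
    using assms(1) by (auto simp: induces_mult_def unfolding_section_def)
  define e1 e2 :: "ser_t^2" where "e1 = vector [1, 0]" and "e2 = vector [0, 1]"
  have e: "e1 \<in> sections" "e2 \<in> sections"
    by (simp_all add: e1_def e2_def sections_iff Conv_t_0 Conv_t_1)
  define \<eta> where "\<eta> = N2 *v \<zeta>"
  have higgs_e: "higgs (A1, A2) e1 *v x = N1 *v x" "higgs (A1, A2) e2 *v x = N2 *v x" for x
    unfolding vec_eq_iff higgs_mult_vec by (simp_all add: e1_def e2_def N1_def N2_def)
  have h1: "N1 *v \<zeta> = \<zeta>"
    using unit unfolding N2_unit_def e1_def[symmetric] higgs_e .
  have "N2_mult e1 e2 = e2"
    by (simp add: N2_mult_def e1_def e2_def)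
  with mult[OF e(1,2)] have h2: "N1 *v \<eta> = \<eta>"
    by (simp add: higgs_e \<eta>_def)
  have "N2_mult e2 e2 = 0"
    by (simp add: N2_mult_def e2_def vec_eq_iff forall_2)
  with mult[OF e(2,2)] have h3: "N2 *v \<eta> = 0"
    by (simp add: higgs_e \<eta>_def) (simp add: vec_eq_iff higgs_mult_vec flip: \<eta>_def)
  define Z :: "ser_t^2^2" where "Z = (\<chi> i j. if j = 1 then \<zeta> $ i else \<eta> $ i)"
  have Z_nth [simp]: "Z $ i $ 1 = \<zeta> $ i" "Z $ i $ 2 = \<eta> $ i" for i
    by (simp_all add: Z_def)
  have mv: "(A *v x) $ i = A $ i $ 1 * x $ 1 + A $ i $ 2 * x $ 2" for A :: "ser_t^2^2" and x i
    by (simp add: matrix_vector_mult_def sum_2)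
  have N1Z: "N1 ** Z = Z"
    using h1 h2 by (simp add: mat2_eq_iff mat2_mult_nth vec_eq_iff forall_2 mv)
  have N2Z: "N2 ** Z = Z ** at_z0 C2"
    using h3 \<eta>_def by (simp add: mat2_eq_iff mat2_mult_nth vec_eq_iff forall_2 mv C2_def)
  have "e1 \<in> (\<lambda>X. higgs (A1, A2) X *v \<zeta>) ` sections" "e2 \<in> (\<lambda>X. higgs (A1, A2) X *v \<zeta>) ` sections"
    using bij e by (simp_all add: bij_betw_imp_surj_on)
  then obtain X Y where XY: "e1 = higgs (A1, A2) X *v \<zeta>" "e2 = higgs (A1, A2) Y *v \<zeta>"
    by blast
  \<comment> \<open>The vector fields that are mapped onto the basis sections form the columns of a
    right inverse of \<open>Z\<close>: invertibility comes from surjectivity in the unfolding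
    condition.\<close>
  define S :: "ser_t^2^2" where "S = (\<chi> i j. if j = 1 then X $ i else Y $ i)"
  have ZS: "Z ** S = mat 1"
    using arg_cong[OF XY(1), of "\<lambda>v. v $ 1"] arg_cong[OF XY(1), of "\<lambda>v. v $ 2"]
      arg_cong[OF XY(2), of "\<lambda>v. v $ 1"] arg_cong[OF XY(2), of "\<lambda>v. v $ 2"]
    unfolding higgs_mult_vec N1_def[symmetric] N2_def[symmetric] h1 \<eta>_def[symmetric]
    by (simp add: mat2_eq_iff mat2_mult_nth mat_nth S_def e1_def e2_def mult.commute)
  have "det Z * det S = 1"
    using arg_cong[OF ZS, of det] by (simp add: det_mul)
  from arg_cong[OF this, of "\<lambda>a. fps_nth (fps_nth a 0) 0"]
  have "fps_nth (fps_nth (det Z) 0) 0 \<noteq> 0"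
    by auto
  moreover have "N1 = mat 1"
    using arg_cong[OF N1Z, of "\<lambda>A. A ** S"] by (simp add: ZS flip: matrix_mul_assoc)
  moreover have "entries_in Conv_t Z"
    using \<zeta> assms(2) unfolding entries_in_iff Z_nth \<eta>_def N2_def mv sections_iff
    by (auto intro!: Conv_t_add Conv_t_mult)
  ultimately show ?thesis
    using N2Z that by (simp add: N1_def N2_def)
qed

lemma C2_companion: "at_z0 C2 = map_matrix (\<lambda>a. fps_nth a 0) (map_matrix of_t2z (companion 0))"
  by (simp add: mat2_eq_iff C2_def of_t2z_def)

context germ_ring
begin

lemma entries_mult: "entries_in R A \<Longrightarrow> entries_in R B \<Longrightarrow> entries_in R (A ** B)"
  by (simp add: entries_in_def mat2_mult_nth mem_add mem_mult)

lemma mat2_inverse: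
  assumes T: "entries_in R T" and det: "const_coeff (det T) \<noteq> 0"
  obtains U where "entries_in R U" "T ** U = mat 1" "U ** T = mat 1"
proof -
  have "det T \<in> R"
    using T by (simp add: det_2 entries_in_iff mem_diff mem_mult)
  then obtain b where b: "b \<in> R" "det T * b = 1"
    using inverse_exists det unfolding const_coeff_def by blast
  define U :: "ser_tz^2^2" where
    "U = smult_mat b (vector [vector [T $ 2 $ 2, - T $ 1 $ 2], vector [- T $ 2 $ 1, T $ 1 $ 1]])"
  show ?thesis
  proof
    show "entries_in R U"
      using T b(1) by (simp add: U_def entries_in_iff mem_mult mem_uminus)
    show "T ** U = mat 1" "U ** T = mat 1"
      using b(2) by (simp_all add: U_def mat2_eq_iff mat2_mult_nth mat_nth det_2 algebra_simps)
  qed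
qed

lemma gauge_isoI:
  assumes T: "entries_in R T" "const_coeff (det T) \<noteq> 0"
    and eq: "smult_mat z (map_matrix d1 T) + A1 ** T - T ** B1 = 0"
      "smult_mat z (map_matrix d2 T) + A2 ** T - T ** B2 = 0"
  shows "gauge_iso R (A1, A2) (B1, B2)"
proof -
  obtain U where U: "entries_in R U" "T ** U = mat 1" "U ** T = mat 1"
    using mat2_inverse[OF T] .
  have "at_z0 T ** at_z0 U = mat 1" "at_z0 U ** at_z0 T = mat 1"
    using U(2,3) by (simp_all add: at_z0_mat flip: at_z0_mult)
  moreover have "entries_in Conv_t (at_z0 U)"
    using U(1) by (simp add: entries_in_def mem_at_z0)
  ultimately show ?thesis
    using T eq by auto
qed

text \<open>For zeta = s_1 the map X \<mapsto> C_X zeta is the identity in the chosen frames, and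
  C_X is multiplication by X in N_2. Hence \<open>holo_star\<close> and \<open>formal_star\<close>
  reduce to conditions on the series f alone.\<close>

lemma star_over_N2:
  assumes "f \<in> R2"
  shows "T_structure_over_N2 R (star f)"
proof -
  have "d2 1 = 0" "d1 1 = 0"
    using d2_of_t2z[of 1] d1_of_t2z[of 1] by (simp_all add: of_t2z_1 D_1 of_t2z_0)
  then have "T_structure R (star f)"
    using assms R2_mult[OF R2_X] unfolding star_eq
    by (simp add: mat2_eq_iff mat2_mult_nth mat_nth entries_in_iff mem_0 mem_1 d1_of_t2z R2_iff
        of_t2z_0 of_t2z_1 d1_0 d2_0)
  moreover have "induces_mult (star f) N2_mult N2_unit"
  proof -
    define \<zeta> :: "ser_t^2" where "\<zeta> = vector [1, 0]"
    have h: "higgs (star f) X = vector [vector [X $ 1, 0], vector [X $ 2, X $ 1]]" for X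
      unfolding star_eq by (simp add: higgs.simps mat2_eq_iff mat_nth of_t2z_def)
    have mv: "(A *v x) $ i = A $ i $ 1 * x $ 1 + A $ i $ 2 * x $ 2" for A :: "ser_t^2^2" and x i
      by (simp add: matrix_vector_mult_def sum_2)
    have h\<zeta>: "higgs (star f) X *v \<zeta> = X" for X
      unfolding vec_eq_iff forall_2 mv by (simp add: h \<zeta>_def)
    have "\<zeta> \<in> sections"
      by (simp add: \<zeta>_def sections_iff Conv_t_0 Conv_t_1)
    then have u: "unfolding_section (star f) \<zeta>"
      by (simp add: unfolding_section_def h\<zeta> bij_betw_def)
    have m: "N2_mult X Y = higgs (star f) X *v Y" for X Y
      unfolding vec_eq_iff forall_2 mv by (simp add: h N2_mult_def algebra_simps)
    show ?thesis
      unfolding induces_mult_def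
    proof (intro exI[of _ \<zeta>] conjI ballI u)
      show "higgs (star f) (N2_mult X Y) *v \<zeta> = higgs (star f) X *v (higgs (star f) Y *v \<zeta>)" for X Y
        by (simp only: m h\<zeta>)
      show "higgs (star f) N2_unit *v \<zeta> = \<zeta>"
        unfolding h\<zeta> by (simp only: N2_unit_def \<zeta>_def)
    qed
  qed
  ultimately show ?thesis by (simp add: T_structure_over_N2_def)
qed

text \<open>The new basis consists of u s_1 and its image under z d/dt_2 + F, which gives the first
  column of a companion matrix automatically. Entry (2, 2) has to vanish, and this fixes the unit u
  up to a constant.\<close>

lemma cyclic_normal_form:
  assumes F: "entries_in R2 F" and F0: "\<And>i j. fps_nth (F $ i $ j) 0 = fps_nth (companion 0 $ i $ j) 0"
  obtains U f where "entries_in R2 U" "f \<in> R2" "fps_nth (fps_nth (det U) 0) 0 \<noteq> 0"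
    "smult_mat fps_X (map_matrix D U) + F ** U - U ** companion f = 0"
proof -
  \<comment> \<open>F(0) is the constant nilpotent matrix \<open>C2\<close>, so three entries are
    divisible by z and r has constant term 1.\<close>
  define p q r s where "p = fps_shift 1 (F $ 1 $ 1)" and "q = fps_shift 1 (F $ 1 $ 2)"
    and "r = F $ 2 $ 1" and "s = fps_shift 1 (F $ 2 $ 2)"
  have X_shift: "fps_X * fps_shift 1 a = a" if "fps_nth a 0 = 0" for a :: ser_t2z
    by (rule fps_ext) (use that in \<open>auto simp: gr0_conv_Suc\<close>)
  have F_nth: "F $ 1 $ 1 = fps_X * p" "F $ 1 $ 2 = fps_X * q" "F $ 2 $ 1 = r" "F $ 2 $ 2 = fps_X * s"
    using F0[of 1 1] F0[of 1 2] F0[of 2 2] by (simp_all add: p_def q_def r_def s_def X_shift del: One_nat_def)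
  have pqrs: "p \<in> R2" "q \<in> R2" "r \<in> R2" "s \<in> R2"
    using F by (simp_all add: entries_in_iff p_def q_def r_def s_def R2_shift del: One_nat_def)
  have r0: "fps_nth (fps_nth r 0) 0 = 1"
    using F0[of 2 1] by (simp add: r_def)
  obtain ri where ri: "ri \<in> R2" "r * ri = 1"
    using R2_inverse[OF pqrs(3)] r0 by auto
  define half :: ser_t2z where "half = fps_const (fps_const (1 / 2))"
  have half: "half \<in> R2" "2 * half = 1"
    unfolding half_def by (rule R2_const, simp, simp add: numeral_fps_const)
  \<comment> \<open>Entry (2, 2) divided by z reads 2 r u' + (r' + r (p + s)) u = 0, that is, u' = k
    u.\<close>
  define k where "k = - (half * (D r * ri + p + s))"
  have k: "k \<in> R2"
    using half ri pqrs by (simp add: k_def R2_uminus R2_mult R2_add R2_D)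
  obtain u where u: "u \<in> R2" "D u = k * u" "fps_nth (fps_nth u 0) 0 = 1"
  proof -
    obtain v where v: "\<And>i::1. v i \<in> R2" "\<And>i::1. D (v i) = (\<Sum>j\<in>UNIV. ((\<chi> i j. k) :: ser_t2z^1^1) $ i $ j * v j)"
      "\<And>i::1. fps_nth (fps_nth (v i) 0) 0 = 1"
      using ode_t2[of "\<chi> i j. k" "\<lambda>_::1. 1"] k by auto
    then show ?thesis
      by (intro that[of "v 1"]) (simp_all add: UNIV_1)
  qed
  obtain ui where ui: "ui \<in> R2" "u * ui = 1"
    using R2_inverse[OF u(1)] u(3) by auto
  define w where "w = fps_X * D u + u * (fps_X * p)"
  \<comment> \<open>Entry (1, 2), divided by z u and solved for f.\<close>
  define f where "f = (D w + p * w + q * (u * r)) * ui"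
  define U :: "ser_t2z^2^2" where "U = vector [vector [u, w], vector [0, u * r]]"
  have U_nth: "U $ 1 $ 1 = u" "U $ 1 $ 2 = w" "U $ 2 $ 1 = 0" "U $ 2 $ 2 = u * r"
    by (simp_all add: U_def)
  have w_in: "w \<in> R2"
    using u k pqrs by (simp add: w_def R2_add R2_mult R2_X)
  have 12: "fps_X * D w + fps_X * p * w + fps_X * q * (u * r) - u * (fps_X * f) = 0"
  proof -
    have "u * (fps_X * f) = fps_X * ((D w + p * w + q * (u * r)) * (u * ui))"
      by (simp add: f_def algebra_simps)
    then show ?thesis by (simp add: ui algebra_simps)
  qed
  have 22: "fps_X * D (u * r) + r * w + fps_X * s * (u * r) = 0"
  proof -
    have "2 * (r * k) = - ((2 * half) * (D r * (r * ri) + r * (p + s)))"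
      by (simp add: k_def algebra_simps)
    then have "2 * (r * k) = - (D r + r * (p + s))"
      by (simp add: half ri)
    moreover have "fps_X * D (u * r) + r * w + fps_X * s * (u * r) =
        fps_X * u * (2 * (r * k) + (D r + r * (p + s)))"
      by (simp add: w_def D_mult u(2) algebra_simps)
    ultimately show ?thesis by simp
  qed
  show ?thesis
  proof
    show "entries_in R2 U"
      using u pqrs w_in by (simp add: entries_in_iff U_nth R2_0 R2_mult)
    show "f \<in> R2"
      using u pqrs w_in ui by (simp add: f_def R2_add R2_mult R2_D)
    show "fps_nth (fps_nth (det U) 0) 0 \<noteq> 0"
      by (simp add: det_2 U_nth u r0)
    show "smult_mat fps_X (map_matrix D U) + F ** U - U ** companion f = 0"
      using 12 22 by (simp add: mat2_eq_iff mat2_mult_nth U_nth F_nth D_0 w_def algebra_simps)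
  qed
qed

end


section \<open>Gauging a structure over N_2 to companion form\<close>

context germ_ring
begin

text \<open>
  If \<open>A\<^sub>1 = 1 + z B\<close>, the equation of the gauge transformation in the direction of \<open>\<partial>\<^sub>1\<close> is divisible
  by \<open>z\<close> and becomes the regular linear differential equation \<open>\<partial>\<^sub>1 T = - B T\<close>.  Flatness then makes the
  transformed matrix \<open>A\<^sub>2\<close> independent of \<open>t\<^sub>1\<close>.
\<close>

lemma trivialize_t1:
  assumes A: "T_structure R (A1, A2)" and A10: "at_z0 A1 = mat 1"
    and Z: "entries_in Conv_t Z" "fps_nth (fps_nth (det Z) 0) 0 \<noteq> 0" "at_z0 A2 ** Z = Z ** at_z0 C2"
  obtains T F where "entries_in R T" "const_coeff (det T) \<noteq> 0" "entries_in R2 F"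
    "\<And>i j. fps_nth (F $ i $ j) 0 = fps_nth (companion 0 $ i $ j) 0"
    "smult_mat z (map_matrix d1 T) + A1 ** T - T = 0"
    "smult_mat z (map_matrix d2 T) + A2 ** T - T ** map_matrix of_t2z F = 0"
proof -
  have A_in: "entries_in R A1" "entries_in R A2"
    and flat: "smult_mat z (map_matrix d1 A2) - smult_mat z (map_matrix d2 A1) + (A1 ** A2 - A2 ** A1) = 0"
    using A by simp_all
  \<comment> \<open>This is (1 - A_1) / z; the division is exact because A_1(0) = 1.\<close>
  define B where "B = (\<chi> i j. - fps_shift 1 (A1 $ i $ j))"
  \<comment> \<open>Initial value at t_1 = 0: the cyclic frame \<open>Z\<close> restricted to t_1 =
    0 and constant in z. It makes the new second matrix equal to \<open>C2\<close> at z = t_1 =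
    0.\<close>
  define g where "g k i = fps_const (fps_const (fps_nth (Z $ i $ k) 0))" for k i :: 2
  have A1_eq: "A1 = mat 1 - smult_mat z B"
  proof -
    have shift: "a = fps_const (fps_nth a 0) + z * fps_shift 1 a" for a :: ser_tz
      by (rule fps_ext) (auto simp: gr0_conv_Suc)
    have "A1 $ i $ j = (mat 1 - smult_mat z B) $ i $ j" for i j
    proof -
      have "fps_nth (A1 $ i $ j) 0 = mat 1 $ i $ j"
        by (metis A10 at_z0_nth)
      then show ?thesis
        using shift[of "A1 $ i $ j"] by (simp add: B_def mat_nth split: if_splits)
    qed
    then show ?thesis by (simp add: vec_eq_iff)
  qed
  have B_in: "B $ i $ j \<in> R" for i j
    unfolding B_def using A_in by (simp add: mem_uminus mem_shift entries_in_def del: One_nat_def)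
  have g: "g k i \<in> R" "d1 (g k i) = 0" for k i
  proof -
    show "g k i \<in> R"
      unfolding g_def using Z(1) by (intro mem_const2 Conv_t_fps_nth_0) (simp add: entries_in_def)
    show "d1 (g k i) = 0"
      unfolding g_def by (intro fps_ext) (simp add: d1_def)
  qed
  have "\<exists>v. \<forall>i. v i \<in> R \<and> d1 (v i) = (\<Sum>j\<in>UNIV. B $ i $ j * v j) \<and> to_t2z (v i) = to_t2z (g k i)" for k
    using B_in g by (rule ode_t1)
  then obtain v where v: "\<And>k i. v k i \<in> R" "\<And>k i. d1 (v k i) = (\<Sum>j\<in>UNIV. B $ i $ j * v k j)"
    "\<And>k i. to_t2z (v k i) = to_t2z (g k i)"
    by metis
  define T where "T = (\<chi> i k. v k i)"
  have T_in: "entries_in R T"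
    by (simp add: T_def entries_in_def v)
  have d1T: "map_matrix d1 T = B ** T"
    by (simp add: vec_eq_iff T_def matrix_matrix_mult_def v)
  have eq1: "smult_mat z (map_matrix d1 T) = T - A1 ** T"
    by (simp add: d1T A1_eq mat2_diff_mult smult_mat_mult_left)
  define ev where "ev a = fps_nth (to_t2z a) 0" for a
  have ev_eq: "ev a = fps_nth (fps_nth a 0) 0" for a
    by (simp add: ev_def to_t2z_def)
  have ev_hom: "ev (a + b) = ev a + ev b" "ev (a - b) = ev a - ev b" "ev (a * b) = ev a * ev b" for a b
    by (simp_all add: ev_eq)
  have evT: "map_matrix ev T = map_matrix (\<lambda>a. fps_nth a 0) Z"
    by (simp add: vec_eq_iff T_def ev_def v(3)) (simp add: g_def to_t2z_def)
  have "ev (det T) = fps_nth (det Z) 0"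
  proof -
    have "ev (det T) = det (map_matrix ev T)"
      by (intro det_map_matrix[symmetric] ev_hom)
    also have "\<dots> = fps_nth (det Z) 0"
      unfolding evT by (intro det_map_matrix) simp_all
    finally show ?thesis .
  qed
  then have detT: "const_coeff (det T) \<noteq> 0"
    using Z(2) by (simp add: const_coeff_def ev_eq)
  obtain U where U: "entries_in R U" "T ** U = mat 1" "U ** T = mat 1"
    using mat2_inverse[OF T_in detT] .
  define Y where "Y = A2 ** T + smult_mat z (map_matrix d2 T)"
  define A' where "A' = U ** Y"
  have TA': "T ** A' = Y"
    by (simp add: A'_def matrix_mul_assoc U)
  have Y_in: "entries_in R Y"
    using T_in A_in unfolding Y_def
    by (auto simp: entries_in_def mat2_mult_nth intro!: mem_add mem_mult mem_z mem_d2)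
  then have A'_in: "entries_in R A'"
    unfolding A'_def by (intro entries_mult U)
  \<comment> \<open>Flatness in the new frame: the first matrix is now the identity, so its
    commutator with A' and its t_2-derivative vanish and only z d_1 A' = 0 remains. This is derived,
    multiplied by T, from flatness in the old frame.\<close>
  have "smult_mat z (T ** map_matrix d1 A') = smult_mat z 0"
  proof -
    define W where "W = T - A1 ** T"
    have W: "smult_mat z (map_matrix d1 T) = W"
      by (simp add: eq1 W_def)
    have flat': "smult_mat z (map_matrix d1 A2) = smult_mat z (map_matrix d2 A1) - A1 ** A2 + A2 ** A1"
      using flat by (simp add: algebra_simps)
    have "d1 z = 0" "d2 z = 0"
      using d1_of_t2z[of fps_X] d2_of_t2z[of fps_X] by (simp_all add: of_t2z_X D_X of_t2z_0)
    then have "smult_mat z (map_matrix d1 Y) =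
        smult_mat z (map_matrix d1 A2) ** T + A2 ** smult_mat z (map_matrix d1 T) +
        smult_mat z (map_matrix d2 (smult_mat z (map_matrix d1 T)))"
      by (simp add: Y_def mat2_eq_iff mat2_mult_nth d1_add d1_mult d2_mult d1_d2_commute algebra_simps)
    also have "\<dots> = Y - A1 ** Y"
    proof -
      have "map_matrix d2 W = map_matrix d2 T - map_matrix d2 A1 ** T - A1 ** map_matrix d2 T"
        by (simp add: W_def mat2_eq_iff mat2_mult_nth d2_diff d2_add d2_mult algebra_simps)
      then show ?thesis
        unfolding W flat' unfolding W_def Y_def
        by (simp add: mat2_add_mult mat2_diff_mult mat2_mult_add mat2_mult_diff smult_mat_mult_left
            smult_mat_mult_right smult_mat_add smult_mat_diff matrix_mul_assoc)
    qed
    also have "\<dots> = W ** A'"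
      by (simp add: W_def mat2_diff_mult TA' flip: matrix_mul_assoc)
    finally have "smult_mat z (map_matrix d1 (T ** A')) = smult_mat z (map_matrix d1 T) ** A'"
      by (simp only: W TA')
    then show ?thesis
      by (simp add: map_matrix_d1_mult smult_mat_add smult_mat_mult_left) (simp add: mat2_eq_iff)
  qed
  then have "T ** map_matrix d1 A' = 0"
    by (simp add: smult_mat_cancel)
  from arg_cong[OF this, of "\<lambda>M. U ** M"] have "map_matrix d1 A' = 0"
    by (simp add: matrix_mul_assoc U)
  then have "d1 (A' $ i $ j) = 0" for i j
    by (simp add: vec_eq_iff)
  then have A'_eq: "map_matrix of_t2z (map_matrix to_t2z A') = A'"
    by (simp add: vec_eq_iff of_t2z_to_t2z)
  \<comment> \<open>\<open>ev\<close> evaluates at z = t_1 = 0. As A' does not depend on t_1, its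
    value there is its whole coefficient of z^0.\<close>
  have "map_matrix ev A' = map_matrix (\<lambda>a. fps_nth a 0) (at_z0 C2)"
  proof -
    let ?h = "map_matrix (\<lambda>a. fps_nth a 0) :: ser_t^2^2 \<Rightarrow> _"
    have hom: "?h (M ** N) = ?h M ** ?h N" for M N
      by (intro map_matrix_mult_hom) simp_all
    have evm: "map_matrix ev (M ** N) = map_matrix ev M ** map_matrix ev N" for M N :: "ser_tz^2^2"
      by (intro map_matrix_mult_hom ev_hom)
    have evh: "map_matrix ev M = ?h (at_z0 M)" for M
      by (simp add: vec_eq_iff ev_eq)
    have "map_matrix ev T ** map_matrix ev A' = map_matrix ev Y"
      by (simp only: TA' flip: evm)
    also have "\<dots> = ?h (at_z0 A2) ** ?h Z"
      by (simp add: evT[symmetric] evh[of A2, symmetric] flip: evm) (simp add: Y_def vec_eq_iff ev_eq)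
    also have "\<dots> = map_matrix ev T ** ?h (at_z0 C2)"
      by (simp add: evT Z(3) flip: hom)
    finally have "map_matrix ev U ** (map_matrix ev T ** map_matrix ev A') =
        map_matrix ev U ** (map_matrix ev T ** ?h (at_z0 C2))"
      by simp
    moreover have "map_matrix ev U ** map_matrix ev T = mat 1"
      by (simp add: U flip: evm) (simp add: vec_eq_iff mat_def ev_eq)
    ultimately show ?thesis
      by (simp add: matrix_mul_assoc)
  qed
  then have "fps_nth (map_matrix to_t2z A' $ i $ j) 0 = fps_nth (companion 0 $ i $ j) 0" for i j
    unfolding C2_companion vec_eq_iff by (simp add: ev_def of_t2z_def)
  moreover have "entries_in R2 (map_matrix to_t2z A')"
    using A'_in by (simp add: entries_in_def R2_to_t2z)
  moreover have "smult_mat z (map_matrix d1 T) + A1 ** T - T = 0"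
    by (simp add: eq1)
  moreover have "smult_mat z (map_matrix d2 T) + A2 ** T - T ** map_matrix of_t2z (map_matrix to_t2z A') = 0"
    unfolding A'_eq TA' by (simp add: Y_def)
  ultimately show ?thesis
    using that T_in detT by blast
qed

theorem gauge_iso_star:
  assumes "T_structure_over_N2 R A"
  shows "\<exists>f\<in>R2. gauge_iso R A (star f)"
proof -
  obtain A1 A2 where A: "A = (A1, A2)" by fastforce
  have T: "T_structure R (A1, A2)" and m: "induces_mult (A1, A2) N2_mult N2_unit"
    using assms by (simp_all add: A T_structure_over_N2_def)
  then have "entries_in Conv_t (at_z0 A2)"
    by (simp add: entries_in_def mem_at_z0)
  with m obtain Z where Z: "entries_in Conv_t Z" "fps_nth (fps_nth (det Z) 0) 0 \<noteq> 0"
    "at_z0 A1 = mat 1" "at_z0 A2 ** Z = Z ** at_z0 C2"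
    by (rule cyclic_frame)
  obtain T F where T: "entries_in R T" "const_coeff (det T) \<noteq> 0"
    and F: "entries_in R2 F" "\<And>i j. fps_nth (F $ i $ j) 0 = fps_nth (companion 0 $ i $ j) 0"
    and eq1: "smult_mat z (map_matrix d1 T) + A1 ** T - T = 0"
    and eq2: "smult_mat z (map_matrix d2 T) + A2 ** T - T ** map_matrix of_t2z F = 0"
    using trivialize_t1[OF \<open>T_structure R (A1, A2)\<close> Z(3,1,2,4)] by blast
  obtain U f where U: "entries_in R2 U" "fps_nth (fps_nth (det U) 0) 0 \<noteq> 0" and f: "f \<in> R2"
    and eqU: "smult_mat fps_X (map_matrix D U) + F ** U - U ** companion f = 0"
    using cyclic_normal_form[OF F] by blast
  define V where "V = map_matrix of_t2z U"
  have V_in: "entries_in R V"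
    using U by (simp add: V_def entries_in_def R2_iff)
  have "det V = of_t2z (det U)"
    unfolding V_def by (intro det_map_matrix of_t2z_diff of_t2z_mult)
  then have "const_coeff (det (T ** V)) \<noteq> 0"
    using T(2) U(2) by (simp add: det_mul const_coeff_def of_t2z_def)
  moreover have "smult_mat z (map_matrix d1 (T ** V)) + A1 ** (T ** V) - (T ** V) ** mat 1 = 0"
  proof -
    have "map_matrix d1 V = 0"
      by (simp add: V_def vec_eq_iff d1_of_t2z)
    then have "smult_mat z (map_matrix d1 (T ** V)) + A1 ** (T ** V) - (T ** V) ** mat 1 =
        (smult_mat z (map_matrix d1 T) + A1 ** T - T) ** V"
      by (simp add: map_matrix_d1_mult mat2_add_mult mat2_diff_mult smult_mat_mult_left matrix_mul_assoc)
    then show ?thesis by (simp add: eq1)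
  qed
  moreover have "smult_mat z (map_matrix d2 (T ** V)) + A2 ** (T ** V) -
      (T ** V) ** map_matrix of_t2z (companion f) = 0"
  proof -
    let ?F = "map_matrix of_t2z F"
    have eqV: "smult_mat z (map_matrix d2 V) + ?F ** V - V ** map_matrix of_t2z (companion f) = 0"
      using arg_cong[OF eqU, of "map_matrix of_t2z"]
      by (simp add: V_def mat2_eq_iff mat2_mult_nth of_t2z_diff of_t2z_add of_t2z_mult of_t2z_X of_t2z_0 of_t2z_1 d2_of_t2z)
    have "smult_mat z (map_matrix d2 (T ** V)) + A2 ** (T ** V) - (T ** V) ** map_matrix of_t2z (companion f) =
        (smult_mat z (map_matrix d2 T) + A2 ** T - T ** ?F) ** V +
        T ** (smult_mat z (map_matrix d2 V) + ?F ** V - V ** map_matrix of_t2z (companion f))"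
      by (simp add: map_matrix_d2_mult mat2_add_mult mat2_diff_mult mat2_mult_add mat2_mult_diff
          smult_mat_add smult_mat_mult_left smult_mat_mult_right matrix_mul_assoc)
    then show ?thesis by (simp add: eq2 eqV)
  qed
  ultimately have "gauge_iso R A (star f)"
    unfolding A star_eq by (rule gauge_isoI[OF entries_mult[OF T(1) V_in]])
  with f show ?thesis by blast
qed

end


subsection \<open>Gauge transformations between structures in companion form\<close>

text \<open>
  A gauge transformation between companion forms is determined by its first column \<open>(a, c)\<close>: its second
  column is \<open>(z (a' + f c), a + z c')\<close>, and \<open>a\<close> and \<open>c\<close> satisfy the two remaining equations.
\<close>

definition companion_gauge :: "ser_t2z \<Rightarrow> ser_t2z \<Rightarrow> ser_t2z \<Rightarrow> ser_t2z \<Rightarrow> bool" where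
  "companion_gauge f f' a c \<longleftrightarrow> fps_nth (fps_nth a 0) 0 \<noteq> 0 \<and>
     2 * D a + fps_X * D (D c) + (f - f') * c = 0 \<and>
     (f - f') * a + fps_X * (D (D a) + D (f * c) + f * D c) = 0"

lemma gauge_iso_starD:
  assumes "gauge_iso R (star f) (star f')"
  obtains a c where "companion_gauge f f' a c"
proof -
  obtain T S where S: "at_z0 T ** S = mat 1"
    and eq1: "smult_mat z (map_matrix d1 T) + mat 1 ** T - T ** mat 1 = 0"
    and eq2: "smult_mat z (map_matrix d2 T) + map_matrix of_t2z (companion f) ** T -
      T ** map_matrix of_t2z (companion f') = 0"
    using assms by (auto simp: star_eq)
  \<comment> \<open>Both first matrices are the identity, so the undifferentiated terms cancel and T
    cannot depend on t_1.\<close>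
  have "smult_mat z (map_matrix d1 T) = smult_mat z 0"
    using eq1 by (simp add: mat2_eq_iff mat2_mult_nth mat_nth)
  then have "d1 (T $ i $ j) = 0" for i j
    by (simp add: smult_mat_cancel vec_eq_iff)
  then have T: "of_t2z (to_t2z (T $ i $ j)) = T $ i $ j" for i j
    by (intro of_t2z_to_t2z)
  define a b c d where "a = to_t2z (T $ 1 $ 1)" and "b = to_t2z (T $ 1 $ 2)"
    and "c = to_t2z (T $ 2 $ 1)" and "d = to_t2z (T $ 2 $ 2)"
  have T_nth: "T $ 1 $ 1 = of_t2z a" "T $ 1 $ 2 = of_t2z b" "T $ 2 $ 1 = of_t2z c" "T $ 2 $ 2 = of_t2z d"
    by (simp_all add: a_def b_def c_def d_def T)
  have eqs: "fps_X * D a + fps_X * f * c - b = 0" "fps_X * D b + fps_X * f * d - a * (fps_X * f') = 0"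
    "fps_X * D c + a - d = 0" "fps_X * D d + b - c * (fps_X * f') = 0"
    using eq2
    by (simp_all add: mat2_eq_iff mat2_mult_nth T_nth of_t2z_0 of_t2z_1 d2_of_t2z
      of_t2z_eq_iff[of _ 0, unfolded of_t2z_0]
      flip: of_t2z_mult of_t2z_X of_t2z_add of_t2z_diff)
  \<comment> \<open>Entries (1, 1) and (2, 1) give the second column; the other two, divided by z,
    become the gauge equations.\<close>
  have b: "b = fps_X * (D a + f * c)" and d: "d = a + fps_X * D c"
    using eqs(1,3) by (simp_all add: algebra_simps)
  have "fps_X * (2 * D a + fps_X * D (D c) + (f - f') * c) = 0"
    using eqs(4) by (simp add: b d D_add D_mult D_X algebra_simps)
  moreover have "fps_X * ((f - f') * a + fps_X * (D (D a) + D (f * c) + f * D c)) = 0"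
    using eqs(2) by (simp add: b d D_add D_mult D_X algebra_simps)
  \<comment> \<open>At z = 0 the matrix T is lower triangular, b being a multiple of z;
    invertibility then forces a nonzero constant term of a.\<close>
  moreover have "fps_nth (fps_nth a 0) 0 \<noteq> 0"
  proof
    assume a0: "fps_nth (fps_nth a 0) 0 = 0"
    have "(at_z0 T ** S) $ 1 $ 1 = 1"
      by (simp add: S mat_nth)
    then have "fps_const (fps_nth a 0) * S $ 1 $ 1 = 1"
      by (simp add: mat2_mult_nth T_nth of_t2z_def b)
    from arg_cong[OF this, of "\<lambda>x. fps_nth (fps_nth x 0) 0"] show False
      using a0 by simp
  qed
  ultimately have "companion_gauge f f' a c"
    unfolding companion_gauge_def mult_eq_0_iff[of fps_X] by simp
  then show ?thesis by (rule that)
qed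

lemma (in germ_ring) gauge_iso_starI:
  assumes "f \<in> R2" "a \<in> R2" "c \<in> R2" "companion_gauge f f' a c"
  shows "gauge_iso R (star f) (star f')"
proof -
  define b d where "b = fps_X * (D a + f * c)" and "d = a + fps_X * D c"
  define T where "T = map_matrix of_t2z (vector [vector [a, b], vector [c, d]] :: ser_t2z^2^2)"
  have I: "2 * D a + fps_X * D (D c) + (f - f') * c = 0"
    and II: "(f - f') * a + fps_X * (D (D a) + D (f * c) + f * D c) = 0"
    using assms(4) by (simp_all add: companion_gauge_def)
  have eqs: "fps_X * D a + fps_X * f * c - b = 0" "fps_X * D b + fps_X * f * d - a * (fps_X * f') = 0"
    "fps_X * D c + a - d = 0" "fps_X * D d + b - c * (fps_X * f') = 0"
  proof -
    have "fps_X * D b + fps_X * f * d - a * (fps_X * f') =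
        fps_X * ((f - f') * a + fps_X * (D (D a) + D (f * c) + f * D c))"
      by (simp add: b_def d_def D_add D_mult D_X algebra_simps)
    then show "fps_X * D b + fps_X * f * d - a * (fps_X * f') = 0"
      unfolding II by simp
    have "fps_X * D d + b - c * (fps_X * f') = fps_X * (2 * D a + fps_X * D (D c) + (f - f') * c)"
      by (simp add: b_def d_def D_add D_mult D_X algebra_simps)
    then show "fps_X * D d + b - c * (fps_X * f') = 0"
      unfolding I by simp
  qed (simp_all add: b_def d_def algebra_simps)
  show ?thesis
    unfolding star_eq
  proof (rule gauge_isoI)
    show "entries_in R T"
      using assms R2_add R2_mult R2_D R2_X
      by (simp add: T_def entries_in_iff b_def d_def flip: R2_iff)
    show "const_coeff (det T) \<noteq> 0"
      using assms(4)
      by (simp add: T_def const_coeff_def det_2 of_t2z_def b_def d_def companion_gauge_def)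
    show "smult_mat z (map_matrix d1 T) + mat 1 ** T - T ** mat 1 = 0"
      by (simp add: T_def mat2_eq_iff mat2_mult_nth mat_nth d1_of_t2z)
    show "smult_mat z (map_matrix d2 T) + map_matrix of_t2z (companion f) ** T -
        T ** map_matrix of_t2z (companion f') = 0"
      using eqs
      by (simp add: T_def mat2_eq_iff mat2_mult_nth of_t2z_0 of_t2z_1 d2_of_t2z
        of_t2z_eq_iff[of _ 0, unfolded of_t2z_0]
        flip: of_t2z_mult of_t2z_X of_t2z_add of_t2z_diff)
  qed
qed

text \<open>At order z^0 the second equation says that the difference of the two coefficients f(0)
  times a(0) is 0 in a domain, and the first then makes the derivative of a(0) vanish. If f(0) = 0,
  all terms but the difference of the coefficients f(1) times a(0) drop out of the second equation
  at order z^1.\<close>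

lemma companion_gauge_invariant:
  assumes "companion_gauge f f' a c"
  shows "fps_nth f 0 = fps_nth f' 0" "fps_deriv (fps_nth a 0) = 0"
    "fps_nth f 0 = 0 \<Longrightarrow> fps_nth f 1 = fps_nth f' 1"
proof -
  have a0: "fps_nth a 0 \<noteq> 0"
    and I: "2 * D a + fps_X * D (D c) + (f - f') * c = 0"
    and II: "(f - f') * a + fps_X * (D (D a) + D (f * c) + f * D c) = 0"
    using assms by (auto simp: companion_gauge_def)
  show eq0: "fps_nth f 0 = fps_nth f' 0"
    using arg_cong[OF II, of "\<lambda>x. fps_nth x 0"] a0 by simp
  have "2 * fps_deriv (fps_nth a 0) = 0"
    using arg_cong[OF I, of "\<lambda>x. fps_nth x 0"] eq0 by (simp add: numeral_fps_const)
  then show deriv0: "fps_deriv (fps_nth a 0) = 0"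
    by (simp del: fps_deriv_eq_0_iff)
  assume "fps_nth f 0 = 0"
  then show "fps_nth f 1 = fps_nth f' 1"
    using arg_cong[OF II, of "\<lambda>x. fps_nth x 1"] a0 eq0
    by (simp add: deriv0 del: fps_deriv_eq_0_iff)
qed

section \<open>Holomorphic normal form for f(0) = 0\<close>

lemma vector_4 [simp]:
  "(vector [x, y, u, v] :: 'a::zero^4) $ 1 = x" "(vector [x, y, u, v] :: 'a::zero^4) $ 2 = y"
  "(vector [x, y, u, v] :: 'a::zero^4) $ 3 = u" "(vector [x, y, u, v] :: 'a::zero^4) $ 4 = v"
  unfolding vector_def by simp_all

lemma ex_half:
  obtains half :: ser_t2z where "half = fps_const (fps_const (1 / 2))" "2 * half = 1" "D half = 0"
proof
  show "2 * (fps_const (fps_const (1 / 2)) :: ser_t2z) = 1"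
    by (simp add: numeral_fps_const)
  show "D (fps_const (fps_const (1 / 2))) = 0"
    by (rule fps_ext) simp
qed simp

text \<open>
  For \<open>f = z g\<close> and \<open>f' = z g(0)\<close>, differentiating the first gauge equation and eliminating \<open>a''\<close> makes
  the equations divisible by \<open>z\<close>; what remains is a regular linear system for \<open>(a, c, c', c'')\<close>.
\<close>

lemma (in germ_ring) gauge_iso_star_z2:
  assumes f: "f \<in> R2" and f0: "fps_nth f 0 = 0" and rad: "0 < fps_conv_radius (fps_nth f 1)"
  shows "gauge_iso R (star f) (star_z2 (fps_nth f 1))"
proof -
  define g h where "g = fps_shift 1 f" and "h = fps_shift 1 g"
  define f' where "f' = fps_X * fps_const (fps_nth f 1)"
  have g: "g \<in> R2" and h: "h \<in> R2"
    using f by (simp_all add: g_def h_def R2_shift del: One_nat_def)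
  have f_eq: "f = fps_X * g"
    by (rule fps_ext) (use f0 in \<open>auto simp: g_def gr0_conv_Suc\<close>)
  have g_eq: "g = fps_const (fps_nth f 1) + fps_X * h"
    by (rule fps_ext) (auto simp: g_def h_def gr0_conv_Suc)
  have f'_eq: "f - f' = fps_X * (fps_X * h)"
    unfolding f'_def f_eq by (subst g_eq) (simp add: algebra_simps f_eq[symmetric])
  obtain half where half: "half = fps_const (fps_const (1 / 2))" "2 * half = 1" "D half = 0"
    by (rule ex_half)
  have half_in: "half \<in> R2"
    unfolding half by (rule R2_const) simp
  have two: "2 \<in> R2" "4 \<in> R2"
    using R2_const[of "2"] R2_const[of "4"] by (simp_all add: numeral_fps_const)
  \<comment> \<open>First row: the first gauge equation solved for a', with f - f' = z^2 h. Last
    row: the second one divided by z^2 after inserting a'', solved for c'''. No negative power of z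
    is left.\<close>
  define B :: "ser_t2z^4^4" where "B = vector [
     vector [0, - (half * fps_X * fps_X * h), 0, - (half * fps_X)],
     vector [0, 0, 1, 0],
     vector [0, 0, 0, 1],
     vector [2 * h, 2 * D g - fps_X * D h, 4 * g - fps_X * h, 0]]"
  have "\<forall>i j. B $ i $ j \<in> R2"
    unfolding forall_4 B_def using half_in two g h
    by (simp add: R2_0 R2_1 R2_X R2_uminus R2_mult R2_D R2_diff)
  \<comment> \<open>The initial value 1 of a secures invertibility; the zeros are a choice.\<close>
  then have "\<exists>v. \<forall>i. v i \<in> R2 \<and> D (v i) = (\<Sum>j\<in>UNIV. B $ i $ j * v j) \<and>
      fps_nth (fps_nth (v i) 0) 0 = (if i = 1 then 1 else 0)"
    by (intro ode_t2) simp
  then obtain v where v: "\<And>i. v i \<in> R2" "\<And>i. D (v i) = (\<Sum>j\<in>UNIV. B $ i $ j * v j)"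
    "\<And>i. fps_nth (fps_nth (v i) 0) 0 = (if i = 1 then 1 else 0)"
    by blast
  define a c c1 c2 where "a = v 1" and "c = v 2" and "c1 = v 3" and "c2 = v 4"
  have Da: "D a = - (half * (fps_X * (c2 + fps_X * h * c)))" and Dc: "D c = c1" and Dc1: "D c1 = c2"
    and Dc2: "D c2 = 2 * h * a + 4 * g * c1 + 2 * D g * c - fps_X * (D h * c + h * c1)"
    using v(2)[of 1] v(2)[of 2] v(2)[of 3] v(2)[of 4]
    unfolding sum_4 a_def[symmetric] c_def[symmetric] c1_def[symmetric] c2_def[symmetric] B_def
    by (simp_all add: algebra_simps)
  have half_mult: "2 * (half * x) = x" for x
    using half(2) by (simp flip: mult.assoc)
  have I: "2 * D a + fps_X * D (D c) + (f - f') * c = 0"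
  proof -
    have "2 * D a = - (fps_X * (c2 + fps_X * h * c))"
      by (simp only: Da mult_minus_right half_mult)
    then show ?thesis
      by (simp only: Dc Dc1 f'_eq) (simp add: algebra_simps)
  qed
  have "D (c2 + fps_X * h * c) = 2 * (h * a + 2 * g * c1 + D g * c)"
    by (simp add: D_add D_mult D_X Dc Dc2 algebra_simps)
  moreover have "D (D a) = - (half * (fps_X * D (c2 + fps_X * h * c)))"
    unfolding Da D_uminus D_mult[of half] D_mult[of fps_X "c2 + _"] half(3) D_X by simp
  ultimately have "D (D a) = - (2 * (half * (fps_X * (h * a + 2 * g * c1 + D g * c))))"
    by (simp only: mult.left_commute)
  then have "D (D a) = - (fps_X * (h * a + 2 * g * c1 + D g * c))"
    by (simp only: half_mult)
  then have "(f - f') * a + fps_X * (D (D a) + D (f * c) + f * D c) = 0"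
    unfolding f'_eq by (simp add: f_eq D_mult D_X Dc algebra_simps)
  with I have "companion_gauge f f' a c"
    by (simp add: companion_gauge_def a_def v)
  then show ?thesis
    unfolding star_z2_eq f'_def[symmetric] by (intro gauge_iso_starI[OF f]) (simp_all add: a_def c_def v)
qed


subsection \<open>The operator \<open>c \<mapsto> 2 f c' + f' c\<close>\<close>

text \<open>Its origin is the symmetric square of z y'' = f y: for equal f on both sides,
  eliminating a from the gauge equations leaves z c''' = 4 f c' + 2 f' c.\<close>

definition symm_deriv :: "ser_t2 \<Rightarrow> ser_t2 \<Rightarrow> ser_t2" where
  "symm_deriv f c = 2 * f * fps_deriv c + fps_deriv f * c"

text \<open>\<open>f c\<^sup>2\<close> has derivative \<open>c\<close> times \<open>symm_deriv f c\<close>, so it is constant, and it vanishes at the origin.\<close>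

lemma symm_deriv_injective:
  assumes "symm_deriv f c = 0" "f \<noteq> 0" "fps_nth f 0 = 0"
  shows "c = 0"
proof -
  have "fps_deriv (f * c * c) = c * symm_deriv f c"
    by (simp add: symm_deriv_def algebra_simps)
  also have "\<dots> = 0" using assms by simp
  finally have "f * c * c = fps_const (fps_nth (f * c * c) 0)"
    unfolding fps_deriv_eq_0_iff .
  with assms show ?thesis by simp
qed

text \<open>f c' has order at least r and f' c order at least r - 1; this is the source of the bound
  r - 2 in the normal form.\<close>

lemma symm_deriv_nth_eq_0:
  assumes "j + 1 < subdegree f"
  shows "fps_nth (symm_deriv f c) j = 0"
proof -
  have f: "fps_nth f i = 0" if "i \<le> j + 1" for i
    using that assms by (intro nth_less_subdegree_zero) simp
  have "fps_nth (f * fps_deriv c) j = 0" "fps_nth (fps_deriv f * c) j = 0"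
    unfolding fps_mult_nth fps_deriv_nth by (intro sum.neutral ballI; simp add: f)+
  then show ?thesis
    by (simp add: symm_deriv_def numeral_fps_const mult.assoc)
qed

lemma ereal_pos_real_below2:
  assumes "0 < (x :: ereal)" "0 < y"
  obtains R where "0 < R" "ereal R \<le> x" "ereal R \<le> y"
  using ereal_pos_real_below[of "min x y"] assms by auto

text \<open>
  With \<open>f = t\<^sup>r u\<close> the equation \<open>symm_deriv f c = w\<close> reads \<open>2 t c' + (r + t u' / u) c = t w / f\<close>, a recursion
  for the coefficients of \<open>c\<close> with denominators \<open>2 m + r\<close>.  (For \<open>m = r = 0\<close>, division by zero picks the
  solution with \<open>c(0) = 0\<close>.)
\<close>

lemma symm_deriv_right_inverse:
  assumes f: "f \<noteq> 0" and rad: "0 < fps_conv_radius f"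
  obtains S R where "0 < R"
    "\<And>w. (\<And>j. j + 1 < subdegree f \<Longrightarrow> fps_nth w j = 0) \<Longrightarrow> symm_deriv f (S w) = w"
    "\<And>w Q. Q \<le> ereal R \<Longrightarrow> Q \<le> fps_conv_radius w \<Longrightarrow> Q \<le> fps_conv_radius (S w)"
proof -
  define r u ui v where "r = subdegree f" and "u = fps_shift r f" and "ui = inverse u"
    and "v = fps_X * fps_deriv u * ui"
  have f_eq: "f = fps_X ^ r * u"
    unfolding u_def r_def by (simp add: mult.commute fps_shift_times_fps_X_power)
  have u0: "fps_nth u 0 \<noteq> 0"
    using f by (simp add: u_def r_def)
  have ui: "u * ui = 1"
    unfolding ui_def by (rule inverse_mult_eq_1') (rule u0)
  have u_rad: "0 < fps_conv_radius u"
    using rad by (simp add: u_def)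
  then have ui_rad: "0 < fps_conv_radius ui"
    unfolding ui_def using u0 by (intro fps_conv_radius_inverse_pos)
  have v0: "fps_nth v 0 = 0"
    by (simp add: v_def mult.assoc)
  have "0 < fps_conv_radius (fps_deriv u)"
    using u_rad fps_conv_radius_deriv[of u] by (rule less_le_trans)
  then have "0 < fps_conv_radius v"
    unfolding v_def using ui_rad by (intro fps_conv_radius_mult_pos) simp_all
  then have "0 < fps_conv_radius (maj1 v)"
    by (simp add: maj1_def)
  moreover have mv0: "fps_nth (maj1 v) 0 = 0"
    by (simp add: maj1_nth v0)
  ultimately have "0 < fps_conv_radius (inverse (1 - maj1 v))"
    by (intro fps_conv_radius_geometric_pos)
  \<comment> \<open>R depends on f alone; this matters because \<open>S\<close> will be applied at
    every order in z.\<close>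
  with ui_rad obtain R where R: "0 < R" "ereal R \<le> fps_conv_radius ui"
    "ereal R \<le> fps_conv_radius (inverse (1 - maj1 v))"
    by (rule ereal_pos_real_below2)
  \<comment> \<open>This is t w / f whenever t w is divisible by t^r; for other w it is a truncated
    quotient, so that \<open>S\<close> and its radius bound make sense for every w.\<close>
  define W where "W w = fps_shift r (fps_X * w) * ui" for w
  have "\<exists>c. c = (\<lambda>m. (fps_nth (W w) m - (\<Sum>k\<in>{1..m}. fps_nth v k * c (m - k))) / of_nat (2 * m + r))" for w
    by (rule graded_fixpoint[of "\<lambda>m. m"]) (auto intro!: sum.cong)
  then obtain c where c: "\<And>w. c w = (\<lambda>m. (fps_nth (W w) m - (\<Sum>k\<in>{1..m}. fps_nth v k * c w (m - k))) / of_nat (2 * m + r))"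
    by metis
  define S where "S w = Abs_fps (c w)" for w
  have S_nth: "fps_nth (S w) m = (fps_nth (W w) m - (\<Sum>k\<in>{1..m}. fps_nth v k * fps_nth (S w) (m - k))) / of_nat (2 * m + r)" for w m
    unfolding S_def fps_nth_Abs_fps by (subst c) simp
  have v_mult: "fps_nth (v * x) m = (\<Sum>k\<in>{1..m}. fps_nth v k * fps_nth x (m - k))" for x m
    by (simp add: fps_mult_nth sum.atLeast_Suc_atMost v0)
  show ?thesis
  proof
    show "0 < R" by (rule R)
  next
    fix w :: ser_t2
    assume w: "\<And>j. j + 1 < subdegree f \<Longrightarrow> fps_nth w j = 0"
    have X_w: "fps_X ^ r * fps_shift r (fps_X * w) = fps_X * w"
    proof (rule fps_ext)
      fix m
      show "fps_nth (fps_X ^ r * fps_shift r (fps_X * w)) m = fps_nth (fps_X * w) m"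
        using w[of "m - 1"] by (auto simp: fps_X_power_mult_nth r_def)
    qed
    have W0: "fps_nth (W w) 0 = 0" if "r = 0"
      using that by (simp add: W_def)
    have rec: "2 * fps_X * fps_deriv (S w) + of_nat r * S w + v * S w = W w"
    proof (rule fps_ext)
      fix m
      have "fps_nth (2 * fps_X * fps_deriv (S w) + of_nat r * S w) m = of_nat (2 * m + r) * fps_nth (S w) m"
        by (cases m) (simp_all add: numeral_fps_const mult.assoc fps_of_nat[symmetric] algebra_simps)
      also have "\<dots> = fps_nth (W w) m - fps_nth (v * S w) m"
      proof (cases "2 * m + r = 0")
        case True
        then show ?thesis using W0 by (simp add: v0)
      next
        case False
        then have "(of_nat (2 * m + r) :: complex) \<noteq> 0"
          by (metis of_nat_eq_0_iff)
        then show ?thesis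
          unfolding v_mult by (subst S_nth) simp
      qed
      finally show "fps_nth (2 * fps_X * fps_deriv (S w) + of_nat r * S w + v * S w) m = fps_nth (W w) m"
        by simp
    qed
    have Xf': "fps_X * fps_deriv f = fps_X ^ r * (of_nat r * u + fps_X * fps_deriv u)"
    proof -
      have "fps_X * fps_deriv (fps_X ^ r) = of_nat r * (fps_X ^ r :: ser_t2)"
      proof (cases r)
        case (Suc k)
        show ?thesis
          unfolding Suc fps_deriv_power'
          by (simp only: fps_deriv_fps_X mult_1_left mult_1_right power_Suc diff_Suc_1 mult_ac)
      qed simp
      then have "fps_X * fps_deriv f = of_nat r * fps_X ^ r * u + fps_X * fps_X ^ r * fps_deriv u"
        unfolding f_eq fps_deriv_mult distrib_left mult.assoc[symmetric] by (simp only: add.commute)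
      then show ?thesis
        by (simp only: distrib_left mult_ac)
    qed
    have "fps_X * symm_deriv f (S w) = 2 * fps_X * f * fps_deriv (S w) + fps_X * fps_deriv f * S w"
      by (simp add: symm_deriv_def algebra_simps)
    also have "\<dots> = fps_X ^ r * (2 * fps_X * u * fps_deriv (S w) + of_nat r * u * S w + fps_X * fps_deriv u * S w)"
      unfolding Xf' unfolding f_eq by (simp add: algebra_simps)
    also have "fps_X * fps_deriv u = u * v"
    proof -
      have "u * v = fps_X * fps_deriv u * (u * ui)"
        unfolding v_def by (simp only: mult_ac)
      then show ?thesis by (simp add: ui)
    qed
    also have "fps_X ^ r * (2 * fps_X * u * fps_deriv (S w) + of_nat r * u * S w + u * v * S w) =
        fps_X ^ r * (u * (2 * fps_X * fps_deriv (S w) + of_nat r * S w + v * S w))"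
      by (simp add: algebra_simps)
    also have "\<dots> = fps_X ^ r * fps_shift r (fps_X * w) * (u * ui)"
      unfolding rec W_def by (simp only: mult_ac)
    also have "\<dots> = fps_X * w"
      by (simp add: ui X_w)
    finally show "symm_deriv f (S w) = w" by simp
  next
    fix w :: ser_t2 and Q
    assume Q: "Q \<le> ereal R" "Q \<le> fps_conv_radius w"
    have "maj1 (S w) \<preceq> maj1 (W w) + maj1 v * maj1 (S w)"
      unfolding fps_le_def
    proof
      fix m
      let ?s = "fps_nth (W w) m - (\<Sum>k\<in>{1..m}. fps_nth v k * fps_nth (S w) (m - k))"
      \<comment> \<open>The denominators 2 m + r are at least 1, except when m = r = 0, where the
        quotient is 0 by convention.\<close>
      have "norm (fps_nth (S w) m) \<le> norm ?s"
      proof (cases "2 * m + r = 0")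
        case False
        then have "1 \<le> real (2 * m + r)" by linarith
        then have "norm ?s / real (2 * m + r) \<le> norm ?s"
          by (simp add: divide_le_eq mult_le_cancel_left1 del: of_nat_add of_nat_mult)
        then show ?thesis
          unfolding S_nth[of w m] norm_divide norm_of_nat .
      qed (subst S_nth, simp)
      also have "\<dots> \<le> norm (fps_nth (W w) m) + (\<Sum>k\<in>{1..m}. norm (fps_nth v k) * norm (fps_nth (S w) (m - k)))"
        by (rule order_trans[OF norm_triangle_ineq4]) (intro add_mono order_refl sum_norm_le, simp add: norm_mult)
      also have "\<dots> = fps_nth (maj1 (W w) + maj1 v * maj1 (S w)) m"
        by (simp add: fps_mult_nth sum.atLeast_Suc_atMost maj1_nth v0)
      finally show "fps_nth (maj1 (S w)) m \<le> fps_nth (maj1 (W w) + maj1 v * maj1 (S w)) m"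
        by (simp add: maj1_nth)
    qed
    then have "maj1 (S w) \<preceq> maj1 (W w) * inverse (1 - maj1 v)"
      by (rule fps_le_geometric[OF _ maj1_nonneg mv0])
    then have "fps_conv_radius (maj1 (W w) * inverse (1 - maj1 v)) \<le> fps_conv_radius (maj1 (S w))"
      by (rule fps_conv_radius_mono[OF maj1_nonneg])
    moreover have "Q \<le> fps_conv_radius (maj1 (W w) * inverse (1 - maj1 v))"
    proof (rule fps_conv_radius_mult_ge)
      have "Q \<le> fps_conv_radius (W w)"
        unfolding W_def using Q R
        by (intro fps_conv_radius_mult_ge) (auto intro: order_trans fps_conv_radius_mult_ge)
      then show "Q \<le> fps_conv_radius (maj1 (W w))"
        by (simp add: maj1_def)
    qed (use Q R in order)
    ultimately show "Q \<le> fps_conv_radius (S w)"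
      by (simp add: maj1_def)
  qed
qed

lemma D_mult_add_nth:
  "fps_nth (D (f * c) + f * D c) n =
    (\<Sum>i=0..n. symm_deriv (fps_nth f i) (fps_nth c (n - i)))"
proof -
  have "fps_nth (D (f * c) + f * D c) n =
      (\<Sum>i=0..n. fps_deriv (fps_nth f i * fps_nth c (n - i)) + fps_nth f i * fps_deriv (fps_nth c (n - i)))"
    by (simp add: fps_mult_nth fps_deriv_sum sum.distrib del: fps_deriv_mult)
  also have "\<dots> = (\<Sum>i=0..n. symm_deriv (fps_nth f i) (fps_nth c (n - i)))"
    by (intro sum.cong) (simp_all add: symm_deriv_def algebra_simps)
  finally show ?thesis .
qed

subsection \<open>Uniqueness of the formal normal forms\<close>

text \<open>At order z^(n+1) the second equation is d \<alpha> +
  \<open>symm_deriv (fps_nth f 0) (fps_nth c n)\<close> = 0, with d the difference of the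
  coefficients and \<alpha> a nonzero constant. The first term has degree at most r - 2, the second
  order at least r - 1, so both vanish. Injectivity gives c(n) = 0, and then the first equation
  makes a(n+1) constant.\<close>

lemma companion_gauge_unique:
  assumes g: "companion_gauge f f' a c" and f0: "fps_nth f 0 \<noteq> 0" and r: "2 \<le> subdegree (fps_nth f 0)"
    and f: "\<And>k. 1 \<le> k \<Longrightarrow> fps_nth f k \<in> Poly_t2_le (subdegree (fps_nth f 0) - 2)"
    and f': "\<And>k. 1 \<le> k \<Longrightarrow> fps_nth f' k \<in> Poly_t2_le (subdegree (fps_nth f 0) - 2)"
  shows "f = f'"
proof -
  define r where "r = subdegree (fps_nth f 0)"
  have I: "2 * D a + fps_X * D (D c) + (f - f') * c = 0"
    and II: "(f - f') * a + fps_X * (D (D a) + (D (f * c) + f * D c)) = 0"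
    and a0: "fps_nth (fps_nth a 0) 0 \<noteq> 0"
    using g by (simp_all add: companion_gauge_def add.assoc)
  define \<alpha> where "\<alpha> = fps_nth (fps_nth a 0) 0"
  have a0_eq: "fps_nth a 0 = fps_const \<alpha>"
    using companion_gauge_invariant(2)[OF g] unfolding fps_deriv_eq_0_iff \<alpha>_def .
  \<comment> \<open>The bounds are staggered: c vanishes only strictly below n, because c(n) first
    enters the second equation at order n + 1.\<close>
  have "(\<forall>k\<le>n. fps_nth f k = fps_nth f' k) \<and> (\<forall>k<n. fps_nth c k = 0) \<and> (\<forall>k\<le>n. fps_deriv (fps_nth a k) = 0)" for n
  proof (induction n)
    case 0
    then show ?case
      using companion_gauge_invariant(1,2)[OF g] by (simp del: fps_deriv_eq_0_iff)
  next
    case (Suc n)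
    then have eq: "\<And>k. k \<le> n \<Longrightarrow> fps_nth f k = fps_nth f' k" and c: "\<And>k. k < n \<Longrightarrow> fps_nth c k = 0"
      and a: "\<And>k. k \<le> n \<Longrightarrow> fps_deriv (fps_nth a k) = 0"
      by blast+
    let ?d = "fps_nth f (Suc n) - fps_nth f' (Suc n)"
    have mult: "fps_nth ((f - f') * b) (Suc n) = ?d * fps_nth b 0" for b
    proof -
      have "(\<Sum>i=0..n. fps_nth (f - f') i * fps_nth b (Suc n - i)) = 0"
        by (intro sum.neutral) (auto simp: eq)
      then show ?thesis by (simp add: fps_mult_nth)
    qed
    have "(\<Sum>i=0..n. symm_deriv (fps_nth f i) (fps_nth c (n - i))) = symm_deriv (fps_nth f 0) (fps_nth c n)"
    proof -
      have "(\<Sum>i\<in>{1..n}. symm_deriv (fps_nth f i) (fps_nth c (n - i))) = 0"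
        by (intro sum.neutral) (auto simp: c symm_deriv_def)
      then show ?thesis by (simp add: sum.atLeast_Suc_atMost)
    qed
    then have "fps_nth (D (f * c) + f * D c) n = symm_deriv (fps_nth f 0) (fps_nth c n)"
      unfolding D_mult_add_nth .
    then have II': "?d * fps_const \<alpha> + symm_deriv (fps_nth f 0) (fps_nth c n) = 0"
      using arg_cong[OF II, of "\<lambda>x. fps_nth x (Suc n)"] a[of n] mult[of a] a0_eq
      by (simp del: fps_deriv_eq_0_iff)
    have "fps_nth ?d j = 0" for j
    proof (cases "j + 1 < r")
      case True
      from arg_cong[OF II', of "\<lambda>x. fps_nth x j"] symm_deriv_nth_eq_0[of j "fps_nth f 0"] True a0
      show ?thesis by (simp add: r_def \<alpha>_def)
    next
      case False
      then show ?thesis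
        using f[of "Suc n"] f'[of "Suc n"] r by (auto simp: Poly_t2_le_def r_def)
    qed
    then have d: "?d = 0"
      by (intro fps_ext) simp
    then have "symm_deriv (fps_nth f 0) (fps_nth c n) = 0"
      using II' by simp
    moreover have "fps_nth (fps_nth f 0) 0 = 0"
      using r by (intro nth_less_subdegree_zero) linarith
    ultimately have cn: "fps_nth c n = 0"
      by (rule symm_deriv_injective[OF _ f0])
    have "2 * fps_deriv (fps_nth a (Suc n)) = 0"
      using arg_cong[OF I, of "\<lambda>x. fps_nth x (Suc n)"] mult[of c] d cn
      by (simp add: numeral_fps_const)
    then have "fps_deriv (fps_nth a (Suc n)) = 0"
      by (simp del: fps_deriv_eq_0_iff)
    then show ?case
      using eq c a cn d by (auto simp: le_Suc_eq less_Suc_eq simp del: fps_deriv_eq_0_iff)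
  qed
  then have "fps_nth f k = fps_nth f' k" for k
    by blast
  then show ?thesis by (rule fps_ext)
qed

subsection \<open>Existence of the formal normal forms\<close>

text \<open>Shows that the recursion for w is well founded: its operations preserve agreement below
  order n, and the factor z in front raises n by one.\<close>

definition agree_below :: "nat \<Rightarrow> 'a fps \<Rightarrow> 'a fps \<Rightarrow> bool" where
  "agree_below n a b \<longleftrightarrow> (\<forall>k<n. fps_nth a k = fps_nth b k)"

lemma agree_below_refl: "agree_below n a a"
  by (simp add: agree_below_def)

lemma agree_below_map: "agree_below n a b \<Longrightarrow> agree_below n (fps_map h a) (fps_map h b)"
  by (simp add: agree_below_def)

lemma agree_below_D: "agree_below n a b \<Longrightarrow> agree_below n (D a) (D b)"
  unfolding D_def by (rule agree_below_map)

lemma agree_below_add: "agree_below n a b \<Longrightarrow> agree_below n a' b' \<Longrightarrow> agree_below n (a + a') (b + b')"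
  by (simp add: agree_below_def)

lemma agree_below_diff: "agree_below n a b \<Longrightarrow> agree_below n a' b' \<Longrightarrow> agree_below n (a - a') (b - b')"
  by (simp add: agree_below_def)

lemma agree_below_mult:
  "agree_below n a b \<Longrightarrow> agree_below n a' b' \<Longrightarrow> agree_below n (a * a') (b * b')"
  by (auto simp: agree_below_def fps_mult_nth intro!: sum.cong)

text \<open>All operations of the recursion, differentiation included, keep the radius Q, so that it
  never has to shrink with n.\<close>

definition radius_below :: "ereal \<Rightarrow> nat \<Rightarrow> ser_t2z \<Rightarrow> bool" where
  "radius_below Q n a \<longleftrightarrow> (\<forall>k<n. Q \<le> fps_conv_radius (fps_nth a k))"

lemma radius_below_map:
  "radius_below Q n a \<Longrightarrow> (\<And>x. Q \<le> fps_conv_radius x \<Longrightarrow> Q \<le> fps_conv_radius (h x)) \<Longrightarrow>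
   radius_below Q n (fps_map h a)"
  by (simp add: radius_below_def)

lemma radius_below_D: "radius_below Q n a \<Longrightarrow> radius_below Q n (D a)"
  unfolding D_def by (rule radius_below_map) (auto intro: order_trans fps_conv_radius_deriv)

lemma radius_below_add: "radius_below Q n a \<Longrightarrow> radius_below Q n b \<Longrightarrow> radius_below Q n (a + b)"
  by (simp add: radius_below_def fps_conv_radius_add_ge)

lemma radius_below_diff: "radius_below Q n a \<Longrightarrow> radius_below Q n b \<Longrightarrow> radius_below Q n (a - b)"
  by (simp add: radius_below_def fps_conv_radius_diff_ge)

lemma radius_below_mult: "radius_below Q n a \<Longrightarrow> radius_below Q n b \<Longrightarrow> radius_below Q n (a * b)"
  by (auto simp: radius_below_def fps_mult_nth intro!: fps_conv_radius_sum_ge fps_conv_radius_mult_ge)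

lemma fps_conv_radius_integral0_ge:
  "fps_conv_radius x \<le> fps_conv_radius (fps_integral0 x)" for x :: ser_t2
proof -
  have "maj1 (fps_integral0 x) \<preceq> fps_X * maj1 x"
    unfolding fps_le_def
  proof
    fix n
    show "fps_nth (maj1 (fps_integral0 x)) n \<le> fps_nth (fps_X * maj1 x) n"
      by (cases n) (auto simp: maj1_nth fps_integral_def norm_mult norm_inverse norm_Suc_complex
          mult_le_cancel_right1 inverse_le_1_iff split: nat.splits intro!: mult_left_le_one_le)
  qed
  from fps_conv_radius_mono[OF maj1_nonneg this]
    fps_conv_radius_mult_ge[of "fps_conv_radius x" fps_X "maj1 x"]
  show ?thesis by (simp add: maj1_def)
qed

text \<open>
  Write \<open>f = f(0) + z q\<close>, \<open>f' = f(0) + z p\<close>, \<open>a = 1 + z \<alpha>\<close>.  Divided by \<open>z\<close>, the second gauge equation says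
  that \<open>p - 2 f(0) c' - f(0)' c\<close> equals a series \<open>w\<close> whose coefficient of \<open>z\<^sup>n\<close> involves only lower
  coefficients of \<open>p\<close>, \<open>c\<close>, \<open>\<alpha>\<close>.  The terms of \<open>w\<close> of degree below \<open>r - 1\<close> in \<open>t\<^sub>2\<close> go into \<open>p\<close>, the others
  are absorbed by \<open>c\<close>, and \<open>w\<close> is found as a fixed point.
\<close>

lemma formal_companion_reduction:
  assumes f: "f \<in> Form_t2z" and f0: "fps_nth f 0 \<noteq> 0"
  defines "r \<equiv> subdegree (fps_nth f 0)"
  obtains f' a c where "f' \<in> Form_t2z" "a \<in> Form_t2z" "c \<in> Form_t2z" "companion_gauge f f' a c"
    "fps_nth f' 0 = fps_nth f 0" "\<And>k j. 1 \<le> k \<Longrightarrow> r \<le> j + 1 \<Longrightarrow> fps_nth (fps_nth f' k) j = 0"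
proof -
  obtain Rf where Rf: "0 < Rf" "\<And>n. ereal Rf \<le> fps_conv_radius (fps_nth f n)"
    using f by (auto simp: Form_t2z_def)
  have "0 < fps_conv_radius (fps_nth f 0)"
    using Rf(1) Rf(2)[of 0] by (meson ereal_less(2) less_le_trans)
  with f0 obtain S Rs where Rs: "0 < Rs"
    and S: "\<And>w. (\<And>j. j + 1 < r \<Longrightarrow> fps_nth w j = 0) \<Longrightarrow> symm_deriv (fps_nth f 0) (S w) = w"
    and S_rad: "\<And>w Q. Q \<le> ereal Rs \<Longrightarrow> Q \<le> fps_conv_radius w \<Longrightarrow> Q \<le> fps_conv_radius (S w)"
    unfolding r_def by (rule symm_deriv_right_inverse) blast
  define Q where "Q = ereal (min Rf Rs)"
  have Q: "Q \<le> ereal Rs" "Q \<le> fps_conv_radius (fps_nth f n)" for n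
    using Rf(2)[of n] by (auto simp: Q_def min_le_iff_disj)
  have cutoff_rad: "fps_conv_radius (fps_cutoff m x) = \<infinity>" for m and x :: ser_t2
  proof -
    have "fps_conv_radius (fps_cutoff m x) = conv_radius (\<lambda>_. 0 :: complex)"
      unfolding fps_conv_radius_def
      by (intro conv_radius_cong eventually_mono[OF eventually_ge_at_top[of m]]) auto
    then show ?thesis by simp
  qed
  obtain half where half: "half = fps_const (fps_const (1 / 2))" "2 * half = 1" "D half = 0"
    by (rule ex_half)
  define q where "q = fps_shift 1 f"
  \<comment> \<open>p is the part of w of degree below r - 1, and c solves 2 f(0) c' + f(0)' c = p -
    w. For r = 0 the truncated difference r - 1 is 0, hence p = 0.\<close>
  define Pm Cm :: "ser_t2z \<Rightarrow> ser_t2z" where "Pm = fps_map (fps_cutoff (r - 1))"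
    and "Cm = fps_map (\<lambda>x. S (fps_cutoff (r - 1) x - x))"
  \<comment> \<open>The first gauge equation divided by z, solved for \<alpha>' and integrated from
    0.\<close>
  define Al where "Al w = fps_map fps_integral0 (half * (0 - (D (D (Cm w)) + (q - Pm w) * Cm w)))" for w
  define G where "G w = (q - Pm w) * Al w + D (D (Al w)) + (D (q * Cm w) + q * D (Cm w))" for w
  \<comment> \<open>Chosen so that the left-hand side of the second gauge equation becomes z (F w -
    w).\<close>
  define F where "F w = q + fps_X * G w" for w
  have F_nth: "fps_nth (F w) n = fps_nth q n + (if n = 0 then 0 else fps_nth (G w) (n - 1))" for w n
    by (simp add: F_def)
  have G_agree: "agree_below n (G w) (G w')" if "agree_below n w w'" for n w w'
  proof -
    have P: "agree_below n (Pm w) (Pm w')" "agree_below n (Cm w) (Cm w')"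
      using that by (simp_all add: Pm_def Cm_def agree_below_map)
    then have "agree_below n (Al w) (Al w')"
      unfolding Al_def
      by (intro agree_below_map agree_below_mult agree_below_diff agree_below_add agree_below_D agree_below_refl)
    with P show ?thesis
      unfolding G_def
      by (intro agree_below_mult agree_below_diff agree_below_add agree_below_D agree_below_refl)
  qed
  have "\<exists>y. y = (\<lambda>n. fps_nth (F (Abs_fps y)) n)"
  proof (rule graded_fixpoint[of "\<lambda>n. n"])
    fix x y :: "nat \<Rightarrow> ser_t2" and n
    assume "\<And>j. j < n \<Longrightarrow> x j = y j"
    then have "agree_below n (Abs_fps x) (Abs_fps y)"
      by (simp add: agree_below_def)
    from G_agree[OF this] show "fps_nth (F (Abs_fps x)) n = fps_nth (F (Abs_fps y)) n"
      by (simp add: F_nth agree_below_def)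
  qed
  then obtain y where y: "y = (\<lambda>n. fps_nth (F (Abs_fps y)) n)" by blast
  define w where "w = Abs_fps y"
  have w: "w = F w"
    by (rule fps_ext) (subst (1) w_def, subst y, simp add: w_def)
  define p c \<alpha> where "p = Pm w" and "c = Cm w" and "\<alpha> = Al w"
  define f' where "f' = fps_const (fps_nth f 0) + fps_X * p"
  define a where "a = 1 + fps_X * \<alpha>"
  have f_eq: "f = fps_const (fps_nth f 0) + fps_X * q"
    by (rule fps_ext) (auto simp: q_def gr0_conv_Suc)
  have diff: "f - f' = fps_X * (q - p)"
    unfolding f'_def by (subst f_eq) (simp add: algebra_simps)
  have D\<alpha>: "2 * D \<alpha> = - (D (D c) + (q - p) * c)"
  proof -
    have "D \<alpha> = half * (0 - (D (D c) + (q - p) * c))"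
      by (rule fps_ext) (simp add: \<alpha>_def Al_def c_def p_def fps_deriv_fps_integral)
    then have "2 * D \<alpha> = (2 * half) * (0 - (D (D c) + (q - p) * c))"
      by (simp only: mult.assoc)
    then show ?thesis by (simp add: half)
  qed
  have I: "2 * D a + fps_X * D (D c) + (f - f') * c = 0"
  proof -
    have "2 * D a + fps_X * D (D c) + (f - f') * c = fps_X * (2 * D \<alpha> + (D (D c) + (q - p) * c))"
      unfolding diff by (simp add: a_def D_add D_1 D_mult D_X algebra_simps)
    then show ?thesis unfolding D\<alpha> by simp
  qed
  have wr: "D (fps_const (fps_nth f 0) * c) + fps_const (fps_nth f 0) * D c = p - w"
  proof (rule fps_ext)
    fix n
    have "fps_nth (D (fps_const (fps_nth f 0) * c) + fps_const (fps_nth f 0) * D c) n =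
        symm_deriv (fps_nth f 0) (fps_nth c n)"
      by (simp add: symm_deriv_def algebra_simps)
    also have "\<dots> = fps_cutoff (r - 1) (fps_nth w n) - fps_nth w n"
      unfolding c_def Cm_def fps_map_nth by (rule S) simp
    finally show "fps_nth (D (fps_const (fps_nth f 0) * c) + fps_const (fps_nth f 0) * D c) n = fps_nth (p - w) n"
      by (simp add: p_def Pm_def)
  qed
  have II: "(f - f') * a + fps_X * (D (D a) + D (f * c) + f * D c) = 0"
  proof -
    have "D (f * c) + f * D c =
        (D (fps_const (fps_nth f 0) * c) + fps_const (fps_nth f 0) * D c) + fps_X * (D (q * c) + q * D c)"
      by (subst (1 2) f_eq) (simp add: D_add D_mult D_X algebra_simps)
    also have "\<dots> = p - w + fps_X * (D (q * c) + q * D c)"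
      unfolding wr ..
    finally have fc: "D (f * c) + f * D c = p - w + fps_X * (D (q * c) + q * D c)" .
    have "(f - f') * a + fps_X * (D (D a) + D (f * c) + f * D c) =
        (f - f') * a + fps_X * (D (D a) + (D (f * c) + f * D c))"
      by (simp add: add.assoc)
    also have "\<dots> = fps_X * (F w - w)"
      unfolding fc diff unfolding a_def F_def G_def p_def[symmetric] c_def[symmetric] \<alpha>_def[symmetric]
      by (simp add: D_add D_1 D_0 D_X_mult algebra_simps)
    finally show ?thesis using w by simp
  qed
  have q_rad: "radius_below Q n q" for n
    using Q(2) by (simp add: radius_below_def q_def)
  have half_rad: "radius_below Q n half" and zero_rad: "radius_below Q n 0" for n
    by (auto simp: radius_below_def half)
  have rad: "radius_below Q n (Pm x) \<and> radius_below Q n (Cm x) \<and> radius_below Q n (Al x) \<and> radius_below Q n (G x)"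
    if "radius_below Q n x" for n x
  proof -
    have P: "radius_below Q n (Pm x)"
      unfolding Pm_def by (rule radius_below_map[OF that]) (simp add: cutoff_rad)
    have C: "radius_below Q n (Cm x)"
      unfolding Cm_def using Q(1)
      by (intro radius_below_map[OF that] S_rad fps_conv_radius_diff_ge) (simp_all add: cutoff_rad)
    have A: "radius_below Q n (Al x)"
      unfolding Al_def
      by (intro radius_below_map[OF _ order_trans[OF _ fps_conv_radius_integral0_ge]] radius_below_mult
          radius_below_diff radius_below_add radius_below_D P C q_rad half_rad zero_rad)
    have "radius_below Q n (G x)"
      unfolding G_def
      by (intro radius_below_mult radius_below_diff radius_below_add radius_below_D P C A q_rad)
    with P C A show ?thesis by blast
  qed
  have w_rad: "Q \<le> fps_conv_radius (fps_nth w n)" for n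
  proof (induction n rule: less_induct)
    case (less n)
    then have "radius_below Q n w"
      by (simp add: radius_below_def)
    then have "radius_below Q n (G w)"
      using rad by blast
    then have "Q \<le> fps_conv_radius (fps_nth (F w) n)"
      unfolding F_nth using q_rad[of "Suc n"]
      by (cases n) (auto simp: radius_below_def intro: fps_conv_radius_add_ge)
    then show ?case by (simp flip: w)
  qed
  have Form: "x \<in> Form_t2z" if "\<And>n. radius_below Q n x" for x
  proof -
    have "ereal (min Rf Rs) \<le> fps_conv_radius (fps_nth x n)" for n
      using that[of "Suc n"] unfolding radius_below_def Q_def by blast
    then show ?thesis
      unfolding Form_t2z_def using Rf(1) Rs by (intro CollectI exI[of _ "min Rf Rs"]) simp
  qed
  have "radius_below Q n w" for n
    using w_rad by (simp add: radius_below_def)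
  then have prad: "radius_below Q n p" "radius_below Q n c" "radius_below Q n \<alpha>" for n
    using rad unfolding p_def c_def \<alpha>_def by blast+
  have X_rad: "radius_below Q n fps_X" and one_rad: "radius_below Q n 1" for n
    by (auto simp: radius_below_def)
  have "radius_below Q n (fps_const (fps_nth f 0))" for n
    using Q(2) by (simp add: radius_below_def)
  then have "f' \<in> Form_t2z" "a \<in> Form_t2z" "c \<in> Form_t2z"
    unfolding f'_def a_def using prad X_rad one_rad
    by (intro Form radius_below_add radius_below_mult; blast)+
  moreover have "companion_gauge f f' a c"
    using I II by (simp add: companion_gauge_def a_def)
  moreover have "fps_nth (fps_nth f' k) j = 0" if "1 \<le> k" "r \<le> j + 1" for k j
    using that by (simp add: f'_def p_def Pm_def)
  ultimately show ?thesis
    using that[of f' a c] by (simp add: f'_def)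
qed


section \<open>The two rings in t_2 and z, and the normal forms over them\<close>

interpretation conv: germ_ring Conv_tz conv_majorant
  by unfold_locales simp

interpretation form: germ_ring Form_tz form_majorant
  by unfold_locales simp

lemma maj3_of_t2z: "maj3 (of_t2z f) = fps_map maj1 f"
  by (rule fps_ext) (simp add: maj3_nth of_t2z_def maj2_const)

lemma conv_R2: "conv.R2 = Conv_t2z"
proof -
  have "collapse (fps_map maj1 f) = maj2 f" for f
    by (simp add: maj2_def fps_map_def)
  then show ?thesis
    by (auto simp: conv.R2_iff conv.mem_iff maj3_of_t2z conv_majorant_def Conv_t2z_iff)
qed

lemma form_R2: "form.R2 = Form_t2z"
  by (auto simp: form.R2_iff form.mem_iff maj3_of_t2z form_majorant_def Form_t2z_def maj1_def)

text \<open>Each z-coefficient is dominated by a shift of the total-degree majorant, and shifting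
  keeps the radius.\<close>

lemma Conv_t2z_subset_Form_t2z: "Conv_t2z \<subseteq> Form_t2z"
proof
  fix f assume "f \<in> Conv_t2z"
  then obtain r where r: "0 < r" "ereal r \<le> fps_conv_radius (maj2 f)"
    unfolding Conv_t2z_iff by (rule ereal_pos_real_below)
  have "fps_conv_radius (maj2 f) \<le> fps_conv_radius (fps_nth f n)" for n
  proof -
    have "maj1 (fps_nth f n) \<preceq> fps_shift n (maj2 f)"
      unfolding fps_le_def
    proof
      fix m
      have "norm (fps_nth (fps_nth f n) (m + n - n)) \<le> (\<Sum>i\<le>m + n. norm (fps_nth (fps_nth f i) (m + n - i)))"
        by (rule member_le_sum) auto
      then show "fps_nth (maj1 (fps_nth f n)) m \<le> fps_nth (fps_shift n (maj2 f)) m"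
        by (simp add: maj1_nth maj2_nth)
    qed
    from fps_conv_radius_mono[OF maj1_nonneg this] show ?thesis
      by (simp add: maj1_def)
  qed
  with r show "f \<in> Form_t2z"
    unfolding Form_t2z_def by (auto intro: order_trans)
qed

lemma holo_star_iff: "holo_star f \<longleftrightarrow> f \<in> Conv_t2z"
  using conv.star_over_N2[of f] by (auto simp: holo_star_def conv_R2)

lemma formal_star_iff: "formal_star f \<longleftrightarrow> f \<in> Form_t2z"
  using form.star_over_N2[of f] by (auto simp: formal_star_def form_R2)

lemma Form_t2z_nth_radius: "f \<in> Form_t2z \<Longrightarrow> 0 < fps_conv_radius (fps_nth f n)"
  unfolding Form_t2z_def by (auto intro: less_le_trans[of 0 "ereal _"])

lemma holo_star_gauge_iso_star_z2:
  assumes "holo_star f" "fps_nth f 0 = 0"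
  shows "T_structure Conv_tz (star_z2 (fps_nth f 1))"
    "gauge_iso Conv_tz (star f) (star_z2 (fps_nth f 1))"
proof -
  have f: "f \<in> Conv_t2z" and rad: "0 < fps_conv_radius (fps_nth f 1)"
    using assms(1) Conv_t2z_subset_Form_t2z Form_t2z_nth_radius by (auto simp: holo_star_iff)
  then have "fps_X * fps_const (fps_nth f 1) \<in> conv.R2"
    by (intro conv.R2_mult conv.R2_X conv.R2_const)
  then show "T_structure Conv_tz (star_z2 (fps_nth f 1))"
    using conv.star_over_N2 by (simp add: star_z2_eq T_structure_over_N2_def)
  show "gauge_iso Conv_tz (star f) (star_z2 (fps_nth f 1))"
    using f assms(2) rad by (intro conv.gauge_iso_star_z2) (simp_all add: conv_R2)
qed

text \<open>The target is itself of the form \<open>star\<close> with series z g, so the invariance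
  of f(1) decides.\<close>

lemma star_z2_unique:
  assumes "gauge_iso Conv_tz (star f) (star_z2 g)" "fps_nth f 0 = 0"
  shows "g = fps_nth f 1"
proof -
  obtain a c where "companion_gauge f (fps_X * fps_const g) a c"
    using assms(1) unfolding star_z2_eq by (rule gauge_iso_starD)
  from companion_gauge_invariant(3)[OF this assms(2)] show ?thesis by simp
qed

lemma formal_star_gauge_iso_normal_form:
  assumes f: "f \<in> Form_t2z" "fps_nth f 0 \<noteq> 0"
  defines "r \<equiv> subdegree (fps_nth f 0)"
  obtains f' where "f' \<in> Form_t2z" "fps_nth f' 0 = fps_nth f 0" "gauge_iso Form_tz (star f) (star f')"
    "\<And>k j. 1 \<le> k \<Longrightarrow> r \<le> j + 1 \<Longrightarrow> fps_nth (fps_nth f' k) j = 0"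
proof -
  obtain f' a c where *: "f' \<in> Form_t2z" "a \<in> Form_t2z" "c \<in> Form_t2z" "companion_gauge f f' a c"
    "fps_nth f' 0 = fps_nth f 0" "\<And>k j. 1 \<le> k \<Longrightarrow> r \<le> j + 1 \<Longrightarrow> fps_nth (fps_nth f' k) j = 0"
    using formal_companion_reduction[OF f] unfolding r_def by blast
  then have "gauge_iso Form_tz (star f) (star f')"
    using f by (intro form.gauge_iso_starI) (simp_all add: form_R2)
  with * show ?thesis by (intro that[of f'])
qed

lemma formal_star_gauge_iso_star_z1:
  assumes f: "f \<in> Form_t2z" "fps_nth f 0 \<noteq> 0" and r: "subdegree (fps_nth f 0) \<le> 1"
  shows "T_structure Conv_tz (star_z1 (fps_nth f 0))" "gauge_iso Form_tz (star f) (star_z1 (fps_nth f 0))"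
proof -
  obtain f' where f': "fps_nth f' 0 = fps_nth f 0" "gauge_iso Form_tz (star f) (star f')"
    "\<And>k j. 1 \<le> k \<Longrightarrow> subdegree (fps_nth f 0) \<le> j + 1 \<Longrightarrow> fps_nth (fps_nth f' k) j = 0"
    by (rule formal_star_gauge_iso_normal_form[OF f]) blast
  \<comment> \<open>As r \<le> 1, every j satisfies r \<le> j + 1, so nothing of positive order in z
    survives.\<close>
  have "f' = fps_const (fps_nth f 0)"
  proof (rule fps_ext)
    fix k
    show "fps_nth f' k = fps_nth (fps_const (fps_nth f 0)) k"
      by (cases "k = 0") (use f'(1) r in \<open>auto intro!: fps_ext f'(3)\<close>)
  qed
  with f'(2) show "gauge_iso Form_tz (star f) (star_z1 (fps_nth f 0))"
    by (simp add: star_z1_eq)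
  have "fps_const (fps_nth f 0) \<in> conv.R2"
    using Form_t2z_nth_radius[OF f(1)] by (rule conv.R2_const)
  then show "T_structure Conv_tz (star_z1 (fps_nth f 0))"
    using conv.star_over_N2 by (simp add: star_z1_eq T_structure_over_N2_def)
qed

lemma formal_normal_form_unique:
  assumes f: "formal_normal_form f" and f': "formal_normal_form f'"
    and "gauge_iso Form_tz (star f) (star f')"
  shows "f = f'"
proof -
  obtain a c where g: "companion_gauge f f' a c"
    using assms(3) by (rule gauge_iso_starD)
  \<comment> \<open>Equal f(0) gives both normal forms the same r, hence the same degree
    bound.\<close>
  have eq: "fps_nth f 0 = fps_nth f' 0"
    using companion_gauge_invariant(1)[OF g] .
  show ?thesis
  proof (cases "subdegree (fps_nth f 0) \<le> 1")
    case True
    have "fps_nth f k = fps_nth f' k" for k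
    proof (cases "k = 0")
      case False
      then have "fps_nth f k = 0" "fps_nth f' k = 0"
        using f f' True unfolding formal_normal_form_def eq by (simp_all only: if_True)
      then show ?thesis by simp
    qed (use eq in simp)
    then show ?thesis by (rule fps_ext)
  next
    case False
    show ?thesis
    proof (rule companion_gauge_unique[OF g])
      show "fps_nth f 0 \<noteq> 0"
        using f unfolding formal_normal_form_def by blast
      show "2 \<le> subdegree (fps_nth f 0)"
        using False by linarith
      show "fps_nth f k \<in> Poly_t2_le (subdegree (fps_nth f 0) - 2)" if "1 \<le> k" for k
        using f that unfolding formal_normal_form_def if_not_P[OF False] by blast
      show "fps_nth f' k \<in> Poly_t2_le (subdegree (fps_nth f 0) - 2)" if "1 \<le> k" for k
        using f' that unfolding formal_normal_form_def eq[symmetric] if_not_P[OF False] by blast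
    qed
  qed
qed

theorem theorem18:
  shows
    "(\<comment> \<open>(i)\<close>
      \<forall>A. T_structure_over_N2 Conv_tz A \<longrightarrow> (\<exists>f. holo_star f \<and> gauge_iso Conv_tz A (star f)))
   \<and> (\<comment> \<open>(ii)\<close>
      \<forall>A. T_structure_over_N2 Form_tz A \<longrightarrow> (\<exists>f. formal_star f \<and> gauge_iso Form_tz A (star f)))
   \<and> (\<comment> \<open>(iii)\<close>
      \<forall>f f'. (holo_star f \<or> formal_star f) \<longrightarrow> (holo_star f' \<or> formal_star f') \<longrightarrow>
        gauge_iso Form_tz (star f) (star f') \<longrightarrow>
          fps_nth f 0 = fps_nth f' 0 \<and>
          (fps_nth f 0 = 0 \<longrightarrow> fps_nth f 1 = fps_nth f' 1))
   \<and> (\<comment> \<open>(iv)\<close>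
      \<forall>f. holo_star f \<longrightarrow> fps_nth f 0 = 0 \<longrightarrow>
        T_structure Conv_tz (star_z2 (fps_nth f 1)) \<and>
        gauge_iso Conv_tz (star f) (star_z2 (fps_nth f 1)) \<and>
        (\<forall>g\<in>Conv_t2. gauge_iso Conv_tz (star f) (star_z2 g) \<longrightarrow> g = fps_nth f 1))
   \<and> (\<comment> \<open>(v): existence\<close>
      \<forall>f r. (holo_star f \<or> formal_star f) \<longrightarrow> fps_nth f 0 \<noteq> 0 \<longrightarrow> subdegree (fps_nth f 0) = r \<longrightarrow>
        (r \<in> {0, 1} \<longrightarrow>
           T_structure Conv_tz (star_z1 (fps_nth f 0)) \<and>
           gauge_iso Form_tz (star f) (star_z1 (fps_nth f 0))) \<and>
        (r \<ge> 2 \<longrightarrow>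
           (\<exists>f'. formal_star f' \<and> fps_nth f' 0 = fps_nth f 0 \<and>
                 (\<forall>k\<ge>1. fps_nth f' k \<in> Poly_t2_le (r - 2)) \<and>
                 gauge_iso Form_tz (star f) (star f'))))
   \<and> (\<comment> \<open>(v): uniqueness\<close>
      \<forall>f f'. formal_normal_form f \<longrightarrow> formal_normal_form f' \<longrightarrow>
        gauge_iso Form_tz (star f) (star f') \<longrightarrow> f = f')"
proof (intro conjI allI impI)
  fix A assume "T_structure_over_N2 Conv_tz A"
  then show "\<exists>f. holo_star f \<and> gauge_iso Conv_tz A (star f)"
    unfolding holo_star_iff conv_R2[symmetric] Bex_def[symmetric] by (rule conv.gauge_iso_star)
next
  fix A assume "T_structure_over_N2 Form_tz A"
  then show "\<exists>f. formal_star f \<and> gauge_iso Form_tz A (star f)"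
    unfolding formal_star_iff form_R2[symmetric] Bex_def[symmetric] by (rule form.gauge_iso_star)
next
  fix f f' assume "gauge_iso Form_tz (star f) (star f')"
  then obtain a c where g: "companion_gauge f f' a c"
    by (rule gauge_iso_starD)
  show "fps_nth f 0 = fps_nth f' 0"
    using companion_gauge_invariant(1)[OF g] .
  show "fps_nth f 1 = fps_nth f' 1" if "fps_nth f 0 = 0"
    using companion_gauge_invariant(3)[OF g that] .
next
  fix f assume f: "holo_star f" "fps_nth f 0 = 0"
  show "T_structure Conv_tz (star_z2 (fps_nth f 1))" "gauge_iso Conv_tz (star f) (star_z2 (fps_nth f 1))"
    using holo_star_gauge_iso_star_z2[OF f] .
  show "\<forall>g\<in>Conv_t2. gauge_iso Conv_tz (star f) (star_z2 g) \<longrightarrow> g = fps_nth f 1"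
    using star_z2_unique f(2) by blast
next
  fix f r assume "holo_star f \<or> formal_star f" and f0: "fps_nth f 0 \<noteq> 0" and r: "subdegree (fps_nth f 0) = r"
  then have f: "f \<in> Form_t2z"
    using Conv_t2z_subset_Form_t2z by (auto simp: holo_star_iff formal_star_iff)
  show "T_structure Conv_tz (star_z1 (fps_nth f 0))" "gauge_iso Form_tz (star f) (star_z1 (fps_nth f 0))"
    if "r \<in> {0, 1}"
    using formal_star_gauge_iso_star_z1[OF f f0] r that by auto
  assume "2 \<le> r"
  obtain f' where "f' \<in> Form_t2z" "fps_nth f' 0 = fps_nth f 0" "gauge_iso Form_tz (star f) (star f')"
    "\<And>k j. 1 \<le> k \<Longrightarrow> r \<le> j + 1 \<Longrightarrow> fps_nth (fps_nth f' k) j = 0"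
    using formal_star_gauge_iso_normal_form[OF f f0] unfolding r by blast
  with \<open>2 \<le> r\<close> show "\<exists>f'. formal_star f' \<and> fps_nth f' 0 = fps_nth f 0 \<and>
      (\<forall>k\<ge>1. fps_nth f' k \<in> Poly_t2_le (r - 2)) \<and> gauge_iso Form_tz (star f) (star f')"
    by (intro exI[of _ f']) (auto simp: formal_star_iff Poly_t2_le_def)
next
  fix f f' assume "formal_normal_form f" "formal_normal_form f'" "gauge_iso Form_tz (star f) (star f')"
  then show "f = f'" by (rule formal_normal_form_unique)
qed

end
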